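(* Consider the polynomial control-affine system $\dot x=f(x)+g(x)u$, $y=h(x)$ with $f(x)=Ax+\sum_{p=2}^{\ell}F_p x^{\otimes p}$, $g(x)=B+\sum_{p=1}^{\ell}G_p(x^{\otimes p}\otimes I_m)$, $h(x)=Cx+\sum_{p=2}^{\ell}H_p x^{\otimes p}$, where $x\in\mathbb{R}^n$, $u\in\mathbb{R}^m$, $y\in\mathbb{R}^r$. Let $\gamma>\gamma_0\ge0$ and $\eta=1-\gamma^{-2}$, where $\gamma_0$ denotes the smallest $\tilde\gamma$ such that a stabilizing controller exists for which the $\mathcal{H}_\infty$ norm of the closed-loop system is less than $\tilde\gamma$. Let $\frac12\sum_{i=2}^d v_i^\top x^{\otimes i}$ and $\frac12\sum_{i=2}^d w_i^\top x^{\otimes i}$ be the degree-$d$ expansions of the past and future energy functions $\mathcal{E}_\gamma^-$ and $\mathcal{E}_\gamma^+$, with $v_2=\mathrm{vec}[V_2]$, $w_2=\mathrm{vec}[W_2]$, where $V_2,W_2$ are the symmetric positive semidefinite solutions of $0=A^\top V_2+V_2A-\eta C^\top C+V_2BB^\top V_2$ and $0=A^\top W_2+W_2A+C^\top C-\eta W_2BB^\top W_2$. Then for each $3\le k\le d$ the linear systems $$\begin{aligned} \mathcal{L}_k(A+BB^\top V_2)^\top\tilde v_k={}&-\sum_{\substack{i,p\ge2\\ i+p=k+1}}\mathcal{L}_i(F_p)^\top v_i-\frac14\sum_{\substack{i,j>2\\ i+j=k+2}}ij\,\mathrm{vec}[V_i^\top BB^\top V_j]+\eta\sum_{\substack{p,q\ge1\\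 p+q=k}}\mathrm{vec}[H_p^\top H_q]\\ &-\frac14\sum_{o=1}^{2\ell}\sum_{\substack{p,q\ge0\\ p+q=o}}\sum_{\substack{i,j\ge2\\ i+j=k-o+2}}ij\,\mathrm{vec}\big[\Gamma^{p,q}_{i,j}(V_i,V_j)\big] \end{aligned}$$ and $$\begin{aligned} \mathcal{L}_k(A-\eta BB^\top W_2)^\top\tilde w_k={}&-\sum_{\substack{i,p\ge2\\ i+p=k+1}}\mathcal{L}_i(F_p)^\top w_i+\frac{\eta}{4}\sum_{\substack{i,j>2\\ i+j=k+2}}ij\,\mathrm{vec}[W_i^\top BB^\top W_j]-\sum_{\substack{p,q\ge1\\ p+q=k}}\mathrm{vec}[H_p^\top H_q]\\ &+\frac{\eta}{4}\sum_{o=1}^{2\ell}\sum_{\substack{p,q\ge0\\ p+q=o}}\sum_{\substack{i,j\ge2\\ i+j=k-o+2}}ij\,\mathrm{vec}\big[\Gamma^{p,q}_{i,j}(W_i,W_j)\big] \end{aligned}$$ have unique solutions $\tilde v_k\in\mathbb{R}^{n^k}$ and $\tilde w_k\in\mathbb{R}^{n^k}$, where $H_1:=C$, $G_0:=B$, and, with $k=i+j+p+q-2$, $$\Gamma^{p,q}_{i,j}(X,Y)=\big(I_{n^p}\otimes\mathrm{vec}[I_m]^\top\big)\Big(\mathrm{vec}[G_q^\top Y]^\top\otimes\big(G_p^\top X\otimes I_m\big)\Big)\big(I_{n^{j-1}}\otimes S_{n^{i-1}\times n^qm}\otimes I_m\big)\big(I_{n^{k-p}}\otimes\mathrm{ve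c}[I_m]\big).$$
   Context: Notation. $x^{\otimes k}=x\otimes\cdots\otimes x$ ($k$ factors), $\otimes$ is the Kronecker product; $\mathrm{vec}[\cdot]$ stacks the columns of a matrix. Matrices: $A\in\mathbb{R}^{n\times n}$, $F_p\in\mathbb{R}^{n\times n^p}$, $B\in\mathbb{R}^{n\times m}$, $G_p\in\mathbb{R}^{n\times mn^p}$, $C\in\mathbb{R}^{r\times n}$, $H_p\in\mathbb{R}^{r\times n^p}$; coefficient matrices $F_p,G_p,H_p$ with $p>\ell$ are zero. The perfect shuffle matrix $S_{q\times p}$ is the permutation matrix with $\mathrm{vec}[M^\top]=S_{q\times p}\mathrm{vec}[M]$ for every $M\in\mathbb{R}^{p\times q}$. For $M\in\mathbb{R}^{p\times q}$, the $k$-way Lyapunov matrix is $\mathcal{L}_k(M)=\sum_{i=1}^k I_p\otimes\cdots\otimes M\otimes\cdots\otimes I_p\in\mathbb{R}^{p^k\times p^{k-1}q}$ ($k$ factors, $M$ in position $i$). The coefficients $v_i,w_i\in\mathbb{R}^{n^i}$ are symmetric (invariant under permuting the $i$ tensor factors), and $V_i,W_i\in\mathbb{R}^{n\times n^{i-1}}$ satisfy $v_i=\mathrm{vec}[V_i]$, $w_i=\mathrm{vec}[W_i]$. The right-hand sides involve only coefficients of index less than $k$. Energy functions. For $\gamma>0,\gamma\neq1$: $$\mathcal{E}_\gamma^-(x_0)=\min_{u\in L_2(-\infty,0],\,x(-\infty)=0,\,x(0)=x_0}\tfrac12\int_{-\infty}^0\eta\|y\|^2+\|u\|^2dt,$$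 $$\mathcal{E}_\gamma^+(x_0)=\min/\max_{u\in L_2[0,\infty),\,x(0)=x_0,\,x(\infty)=0}\tfrac12\int_0^\infty\|y\|^2+\tfrac{1}{\eta}\|u\|^2dt$$ (minimum for $\gamma>1$, maximum for $\gamma<1$). Standing assumptions: the HJB equation $0=\frac{\partial\mathcal{E}_\gamma^-}{\partial x}f+\frac12\frac{\partial\mathcal{E}_\gamma^-}{\partial x}gg^\top\frac{\partial^\top\mathcal{E}_\gamma^-}{\partial x}-\frac{\eta}{2}h^\top h$ has a solution with $\mathcal{E}_\gamma^-(0)=0$ such that $-f-gg^\top\partial^\top\mathcal{E}_\gamma^-/\partial x$ is asymptotically stable, and this solution is the past energy function; the HJB equation $0=\frac{\partial\mathcal{E}_\gamma^+}{\partial x}f-\frac{\eta}{2}\frac{\partial\mathcal{E}_\gamma^+}{\partial x}gg^\top\frac{\partial^\top\mathcal{E}_\gamma^+}{\partial x}+\frac12h^\top h$ has a solution with $\mathcal{E}_\gamma^+(0)=0$ such that $f-\eta gg^\top\partial^\top\mathcal{E}_\gamma^+/\partial x$ is asymptotically stable, and this solution is the future energy function. Both are analytic near the origin. *)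

theory Defs
  imports
    "HOL-Analysis.Derivative"
    "HOL-Analysis.Set_Integral"
    "HOL-Analysis.Lebesgue_Measure"
    "HOL-Analysis.L2_Norm"
    "Jordan_Normal_Form.Gauss_Jordan_Elimination"
    "Jordan_Normal_Form.Char_Poly"
begin

section \<open>Tensor algebra\<close>

definition vsum :: "nat \<Rightarrow> 'c set \<Rightarrow> ('c \<Rightarrow> real vec) \<Rightarrow> real vec" where
  "vsum N I f = finsum_vec TYPE(real) N f I"

definition vnorm :: "'a::real_normed_vector vec \<Rightarrow> real" where
  "vnorm x = L2_set (\<lambda>i. norm (x $ i)) {..<dim_vec x}"

definition kron :: "'a::times mat \<Rightarrow> 'a mat \<Rightarrow> 'a mat" (infixl \<open>\<otimes>\<^sub>m\<close> 70) where
  "M \<otimes>\<^sub>m N = mat (dim_row M * dim_row N) (dim_col M * dim_col N)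
     (\<lambda>(i, j). M $$ (i div dim_row N, j div dim_col N) * N $$ (i mod dim_row N, j mod dim_col N))"

definition kron_vec :: "'a::times vec \<Rightarrow> 'a vec \<Rightarrow> 'a vec" (infixl \<open>\<otimes>\<^sub>v\<close> 70) where
  "x \<otimes>\<^sub>v y = vec (dim_vec x * dim_vec y) (\<lambda>i. x $ (i div dim_vec y) * y $ (i mod dim_vec y))"

definition kron_list :: "real mat list \<Rightarrow> real mat" where
  "kron_list Ms = foldr (\<otimes>\<^sub>m) Ms (1\<^sub>m 1)"

definition kron_vecs :: "real vec list \<Rightarrow> real vec" where
  "kron_vecs xs = foldr (\<otimes>\<^sub>v) xs (vec 1 (\<lambda>_. 1))"

definition kron_pow :: "real vec \<Rightarrow> nat \<Rightarrow> real vec" where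
  "kron_pow x k = kron_vecs (replicate k x)"

definition col_mat :: "'a vec \<Rightarrow> 'a mat" where
  "col_mat x = mat_of_cols (dim_vec x) [x]"

text \<open>Column-stacking: entry \<open>(i, j)\<close> of a matrix with \<open>a\<close> rows sits at position \<open>i + a * j\<close>.\<close>

definition vec_of_mat :: "'a mat \<Rightarrow> 'a vec" where
  "vec_of_mat M = vec (dim_row M * dim_col M) (\<lambda>k. M $$ (k mod dim_row M, k div dim_row M))"

text \<open>\<open>shuffle q p\<close> is the perfect shuffle matrix \<open>S\<close> with first index \<open>q\<close> and second index
  \<open>p\<close>; it is characterised by lemma \<open>shuffle_vec_of_mat\<close> below.\<close>

definition shuffle :: "nat \<Rightarrow> nat \<Rightarrow> real mat" where
  "shuffle q p = mat (q * p) (q * p)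
     (\<lambda>(b, a). if b mod q = a div p \<and> b div q = a mod p then 1 else 0)"

lemma shuffle_vec_of_mat:
  assumes M: "M \<in> carrier_mat p q"
  shows "shuffle q p *\<^sub>v vec_of_mat M = vec_of_mat (M\<^sup>T)"
proof (rule eq_vecI)
  show "dim_vec (shuffle q p *\<^sub>v vec_of_mat M) = dim_vec (vec_of_mat (M\<^sup>T))"
    using M by (simp add: shuffle_def vec_of_mat_def)
next
  fix b assume "b < dim_vec (vec_of_mat (M\<^sup>T))"
  then have b: "b < q * p" using M by (simp add: vec_of_mat_def)
  then have qp: "0 < q" "0 < p" by (auto intro: gr0I)
  have bq: "b div q < p" using b by (simp add: less_mult_imp_div_less mult.commute)
  have bm: "b mod q < q" using qp by simp
  let ?a = "b div q + p * (b mod q)"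
  have "?a < p * (b mod q + 1)" using bq by simp
  also have "\<dots> \<le> p * q" using bm by (intro mult_le_mono2) simp
  finally have a: "?a < q * p" by (simp add: mult.commute)
  have iff: "(b mod q = a div p \<and> b div q = a mod p) \<longleftrightarrow> a = ?a" for a
  proof
    assume h: "b mod q = a div p \<and> b div q = a mod p"
    have "a = a mod p + p * (a div p)" by simp
    then show "a = ?a" using h by simp
  next
    assume "a = ?a" then show "b mod q = a div p \<and> b div q = a mod p" using bq by simp
  qed
  have "(shuffle q p *\<^sub>v vec_of_mat M) $ b
      = (\<Sum>a\<in>{0..<q * p}. (if a = ?a then 1 else 0) * vec_of_mat M $ a)"
    using b M by (simp add: shuffle_def scalar_prod_def iff vec_of_mat_def mult.commute)
  also have "\<dots> = vec_of_mat M $ ?a"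
    using a by (simp add: if_distrib[of "\<lambda>c. c * _"] sum.delta cong: if_cong)
  also have "\<dots> = M $$ (b div q, b mod q)"
    using a M bq by (simp add: vec_of_mat_def mult.commute)
  also have "\<dots> = vec_of_mat (M\<^sup>T) $ b"
    using b M bq bm by (simp add: vec_of_mat_def)
  finally show "(shuffle q p *\<^sub>v vec_of_mat M) $ b = vec_of_mat (M\<^sup>T) $ b" .
qed

definition lyap :: "nat \<Rightarrow> real mat \<Rightarrow> real mat" where
  "lyap k M = mat (dim_row M ^ k) (dim_row M ^ (k - 1) * dim_col M)
     (\<lambda>ab. \<Sum>i\<in>{1..k}.
        kron_list (map (\<lambda>j. if j = i then M else 1\<^sub>m (dim_row M)) [1..<k+1]) $$ ab)"

text \<open>A coefficient is symmetric iff the multilinear form \<open>v \<bullet> (x\<^sub>1 \<otimes> \<dots> \<otimes> x\<^sub>i)\<close> does not change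
  when the factors are permuted.\<close>

definition symmetric_tensor :: "nat \<Rightarrow> nat \<Rightarrow> real vec \<Rightarrow> bool" where
  "symmetric_tensor n i v \<longleftrightarrow>
     (\<forall>xs ys. length xs = i \<and> set xs \<subseteq> carrier_vec n \<and> mset xs = mset ys
        \<longrightarrow> v \<bullet> kron_vecs xs = v \<bullet> kron_vecs ys)"

text \<open>The \<open>k\<close> of the defining formula is \<open>i + j + p + q - 2\<close>, so that \<open>k - p = i + j + q - 2\<close>.\<close>

definition Gam ::
  "nat \<Rightarrow> nat \<Rightarrow> (nat \<Rightarrow> real mat) \<Rightarrow> nat \<Rightarrow> nat \<Rightarrow> nat \<Rightarrow> nat \<Rightarrow> real mat \<Rightarrow> real mat \<Rightarrow> real mat" where
  "Gam n m G p q i j X Y =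
     (let k = i + j + p + q - 2 in
      (1\<^sub>m (n ^ p) \<otimes>\<^sub>m (col_mat (vec_of_mat (1\<^sub>m m)))\<^sup>T)
      * ((col_mat (vec_of_mat ((G q)\<^sup>T * Y)))\<^sup>T \<otimes>\<^sub>m ((G p)\<^sup>T * X \<otimes>\<^sub>m 1\<^sub>m m))
      * (1\<^sub>m (n ^ (j - 1)) \<otimes>\<^sub>m shuffle (n ^ (i - 1)) (n ^ q * m) \<otimes>\<^sub>m 1\<^sub>m m)
      * (1\<^sub>m (n ^ (k - p)) \<otimes>\<^sub>m col_mat (vec_of_mat (1\<^sub>m m))))"

definition sym_psd :: "nat \<Rightarrow> real mat \<Rightarrow> bool" where
  "sym_psd n V \<longleftrightarrow> V \<in> carrier_mat n n \<and> V\<^sup>T = V \<and> (\<forall>x\<in>carrier_vec n. 0 \<le> x \<bullet> (V *\<^sub>v x))"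


section \<open>Polynomial control-affine systems\<close>

definition drift :: "nat \<Rightarrow> nat \<Rightarrow> real mat \<Rightarrow> (nat \<Rightarrow> real mat) \<Rightarrow> real vec \<Rightarrow> real vec" where
  "drift n l A F x = A *\<^sub>v x + vsum n {2..l} (\<lambda>p. F p *\<^sub>v kron_pow x p)"

definition input_map ::
  "nat \<Rightarrow> nat \<Rightarrow> nat \<Rightarrow> real mat \<Rightarrow> (nat \<Rightarrow> real mat) \<Rightarrow> real vec \<Rightarrow> real mat" where
  "input_map n m l B G x =
     B + mat n m (\<lambda>ab. \<Sum>p\<in>{1..l}. (G p * (col_mat (kron_pow x p) \<otimes>\<^sub>m 1\<^sub>m m)) $$ ab)"

definition output_map :: "nat \<Rightarrow> nat \<Rightarrow> real mat \<Rightarrow> (nat \<Rightarrow> real mat) \<Rightarrow> real vec \<Rightarrow> real vec" where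
  "output_map r l C H x = C *\<^sub>v x + vsum r {2..l} (\<lambda>p. H p *\<^sub>v kron_pow x p)"

text \<open>Caratheodory trajectories of \<open>x' = f(x) + g(x) u\<close> on the time interval \<open>T\<close>, driven by an
  \<open>L\<^sub>2(T)\<close> input.\<close>

definition trajectory ::
  "nat \<Rightarrow> nat \<Rightarrow> (real vec \<Rightarrow> real vec) \<Rightarrow> (real vec \<Rightarrow> real mat) \<Rightarrow> real set
    \<Rightarrow> (real \<Rightarrow> real vec) \<Rightarrow> (real \<Rightarrow> real vec) \<Rightarrow> bool" where
  "trajectory n m f g T u x \<longleftrightarrow>
     (\<forall>t\<in>T. x t \<in> carrier_vec n \<and> u t \<in> carrier_vec m)
   \<and> (\<forall>i<m. set_borel_measurable lborel T (\<lambda>t. u t $ i))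
   \<and> (\<integral>\<^sup>+t\<in>T. ennreal ((vnorm (u t))\<^sup>2) \<partial>lborel) < \<infinity>
   \<and> (\<forall>s\<in>T. \<forall>t\<in>T. s \<le> t \<longrightarrow> (\<forall>i<n.
        set_integrable lborel {s..t} (\<lambda>\<tau>. (f (x \<tau>) + g (x \<tau>) *\<^sub>v u \<tau>) $ i)
      \<and> x t $ i - x s $ i = (LINT \<tau>:{s..t}|lborel. (f (x \<tau>) + g (x \<tau>) *\<^sub>v u \<tau>) $ i)))"

text \<open>Costs are extended reals. The input has finite energy, so \<open>\<infinity> - \<infinity>\<close> does not occur even when
  the weight \<open>a\<close> (or \<open>b\<close>) is negative.\<close>

definition cost ::
  "(real vec \<Rightarrow> real vec) \<Rightarrow> real \<Rightarrow> real \<Rightarrow> real set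
    \<Rightarrow> (real \<Rightarrow> real vec) \<Rightarrow> (real \<Rightarrow> real vec) \<Rightarrow> ereal" where
  "cost h a b T u x = ereal (1/2) *
     (ereal a * enn2ereal (\<integral>\<^sup>+t\<in>T. ennreal ((vnorm (h (x t)))\<^sup>2) \<partial>lborel)
    + ereal b * enn2ereal (\<integral>\<^sup>+t\<in>T. ennreal ((vnorm (u t))\<^sup>2) \<partial>lborel))"

definition past_costs ::
  "nat \<Rightarrow> nat \<Rightarrow> (real vec \<Rightarrow> real vec) \<Rightarrow> (real vec \<Rightarrow> real mat) \<Rightarrow> (real vec \<Rightarrow> real vec)
    \<Rightarrow> real \<Rightarrow> real vec \<Rightarrow> ereal set" where
  "past_costs n m f g h \<eta> x0 =
     {cost h \<eta> 1 {..0} u x | u x. trajectory n m f g {..0} u x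
        \<and> ((\<lambda>t. vnorm (x t)) \<longlongrightarrow> 0) at_bot \<and> x 0 = x0}"

definition future_costs ::
  "nat \<Rightarrow> nat \<Rightarrow> (real vec \<Rightarrow> real vec) \<Rightarrow> (real vec \<Rightarrow> real mat) \<Rightarrow> (real vec \<Rightarrow> real vec)
    \<Rightarrow> real \<Rightarrow> real vec \<Rightarrow> ereal set" where
  "future_costs n m f g h \<eta> x0 =
     {cost h 1 (1 / \<eta>) {0..} u x | u x. trajectory n m f g {0..} u x
        \<and> x 0 = x0 \<and> ((\<lambda>t. vnorm (x t)) \<longlongrightarrow> 0) at_top}"

definition is_minimum :: "ereal \<Rightarrow> ereal set \<Rightarrow> bool" where
  "is_minimum c S \<longleftrightarrow> c \<in> S \<and> (\<forall>s\<in>S. c \<le> s)"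

definition is_maximum :: "ereal \<Rightarrow> ereal set \<Rightarrow> bool" where
  "is_maximum c S \<longleftrightarrow> c \<in> S \<and> (\<forall>s\<in>S. s \<le> c)"

definition grad :: "nat \<Rightarrow> (real vec \<Rightarrow> real) \<Rightarrow> real vec \<Rightarrow> real vec" where
  "grad n E x = vec n (\<lambda>i. deriv (\<lambda>t. E (x + t \<cdot>\<^sub>v unit_vec n i)) 0)"

definition ode_solution :: "nat \<Rightarrow> (real vec \<Rightarrow> real vec) \<Rightarrow> (real \<Rightarrow> real vec) \<Rightarrow> bool" where
  "ode_solution n \<phi> x \<longleftrightarrow>
     (\<forall>t\<ge>0. x t \<in> carrier_vec n
        \<and> (\<forall>i<n. ((\<lambda>s. x s $ i) has_real_derivative \<phi> (x t) $ i) (at t within {0..})))"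

text \<open>Local asymptotic stability of the origin in the sense of Lyapunov: solutions starting near
  \<open>0\<close> exist for all \<open>t \<ge> 0\<close>, stay near \<open>0\<close>, and converge to \<open>0\<close>.\<close>

definition asymptotically_stable :: "nat \<Rightarrow> (real vec \<Rightarrow> real vec) \<Rightarrow> bool" where
  "asymptotically_stable n \<phi> \<longleftrightarrow>
     (\<forall>\<epsilon>>0. \<exists>\<delta>>0. \<forall>x0\<in>carrier_vec n. vnorm x0 < \<delta> \<longrightarrow>
        (\<exists>x. ode_solution n \<phi> x \<and> x 0 = x0)
      \<and> (\<forall>x. ode_solution n \<phi> x \<and> x 0 = x0 \<longrightarrow> (\<forall>t\<ge>0. vnorm (x t) < \<epsilon>)))
   \<and> (\<exists>\<delta>>0. \<forall>x. ode_solution n \<phi> x \<and> vnorm (x 0) < \<delta> \<longrightarrow> ((\<lambda>t. vnorm (x t)) \<longlongrightarrow> 0) at_top)"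

text \<open>\<open>E\<close> is the past (future) energy function near the origin, and there it is the solution, with
  \<open>E 0 = 0\<close> and a stabilizing closed loop, of the respective Hamilton-Jacobi-Bellman equation.\<close>

definition past_energy_function ::
  "nat \<Rightarrow> nat \<Rightarrow> (real vec \<Rightarrow> real vec) \<Rightarrow> (real vec \<Rightarrow> real mat) \<Rightarrow> (real vec \<Rightarrow> real vec)
    \<Rightarrow> real \<Rightarrow> (real vec \<Rightarrow> real) \<Rightarrow> bool" where
  "past_energy_function n m f g h \<eta> E \<longleftrightarrow>
     (\<exists>\<rho>>0. \<forall>x\<in>carrier_vec n. vnorm x < \<rho> \<longrightarrow>
        is_minimum (ereal (E x)) (past_costs n m f g h \<eta> x)
      \<and> 0 = grad n E x \<bullet> f x
          + 1/2 * (grad n E x \<bullet> (g x *\<^sub>v ((g x)\<^sup>T *\<^sub>v grad n E x)))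
          - \<eta>/2 * (h x \<bullet> h x))
   \<and> E (0\<^sub>v n) = 0
   \<and> asymptotically_stable n (\<lambda>x. - f x - g x *\<^sub>v ((g x)\<^sup>T *\<^sub>v grad n E x))"

definition future_energy_function ::
  "nat \<Rightarrow> nat \<Rightarrow> (real vec \<Rightarrow> real vec) \<Rightarrow> (real vec \<Rightarrow> real mat) \<Rightarrow> (real vec \<Rightarrow> real vec)
    \<Rightarrow> real \<Rightarrow> real \<Rightarrow> (real vec \<Rightarrow> real) \<Rightarrow> bool" where
  "future_energy_function n m f g h \<gamma> \<eta> E \<longleftrightarrow>
     (\<exists>\<rho>>0. \<forall>x\<in>carrier_vec n. vnorm x < \<rho> \<longrightarrow>
        (if 1 < \<gamma> then is_minimum (ereal (E x)) (future_costs n m f g h \<eta> x)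
         else is_maximum (ereal (E x)) (future_costs n m f g h \<eta> x))
      \<and> 0 = grad n E x \<bullet> f x
          - \<eta>/2 * (grad n E x \<bullet> (g x *\<^sub>v ((g x)\<^sup>T *\<^sub>v grad n E x)))
          + 1/2 * (h x \<bullet> h x))
   \<and> E (0\<^sub>v n) = 0
   \<and> asymptotically_stable n (\<lambda>x. f x - \<eta> \<cdot>\<^sub>v (g x *\<^sub>v ((g x)\<^sup>T *\<^sub>v grad n E x)))"

text \<open>\<open>E\<close> is analytic near the origin (its power series converges absolutely on a polydisc), with
  homogeneous symmetric coefficients \<open>c\<close>, and \<open>v\<^sub>2, \<dots>, v\<^sub>d\<close> are the coefficients up to degree \<open>d\<close>.
  The factors \<open>1/2\<close> and the start at degree \<open>2\<close> are those of the energy expansions.\<close>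

definition energy_expansion ::
  "nat \<Rightarrow> nat \<Rightarrow> (real vec \<Rightarrow> real) \<Rightarrow> (nat \<Rightarrow> real vec) \<Rightarrow> bool" where
  "energy_expansion n d E v \<longleftrightarrow>
     (\<exists>c. (\<forall>i\<ge>2. c i \<in> carrier_vec (n ^ i) \<and> symmetric_tensor n i (c i))
        \<and> (\<exists>\<rho>>0. summable (\<lambda>i. (\<Sum>a<n ^ (i + 2). \<bar>c (i + 2) $ a\<bar>) * \<rho> ^ (i + 2))
             \<and> (\<forall>x\<in>carrier_vec n. (\<forall>i<n. \<bar>x $ i\<bar> < \<rho>) \<longrightarrow>
                  (\<lambda>i. 1/2 * (c (i + 2) \<bullet> kron_pow x (i + 2))) sums E x))
        \<and> (\<forall>i\<in>{2..d}. v i = c i))"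


section \<open>The optimal H-infinity level\<close>

definition hurwitz :: "real mat \<Rightarrow> bool" where
  "hurwitz M \<longleftrightarrow> (\<forall>z. eigenvalue (map_mat complex_of_real M) z \<longrightarrow> Re z < 0)"

definition transfer :: "real mat \<Rightarrow> real mat \<Rightarrow> real mat \<Rightarrow> real mat \<Rightarrow> complex \<Rightarrow> complex mat" where
  "transfer A B C D s =
     map_mat complex_of_real C
       * the (mat_inverse (s \<cdot>\<^sub>m 1\<^sub>m (dim_row A) - map_mat complex_of_real A))
       * map_mat complex_of_real B
     + map_mat complex_of_real D"

definition spectral_norm :: "complex mat \<Rightarrow> ereal" where
  "spectral_norm M = (SUP w\<in>{w\<in>carrier_vec (dim_col M). vnorm w \<le> 1}. ereal (vnorm (M *\<^sub>v w)))"

text \<open>Meaningful for Hurwitz \<open>A\<close> only: the supremum runs over the imaginary axis.\<close>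

definition hinf_norm :: "real mat \<Rightarrow> real mat \<Rightarrow> real mat \<Rightarrow> real mat \<Rightarrow> ereal" where
  "hinf_norm A B C D = (SUP \<omega>::real. spectral_norm (transfer A B C D (\<i> * complex_of_real \<omega>)))"

text \<open>The normalized H-infinity problem that underlies H-infinity balancing: the plant
  \<open>x' = A x + B w\<^sub>1 + B u\<close>, \<open>z = (C x, u)\<close>, \<open>y = C x + w\<^sub>2\<close> is controlled by
  \<open>\<xi>' = AK \<xi> + BK y\<close>, \<open>u = CK \<xi> + DK y\<close>. Below are the closed-loop matrices from
  \<open>(w\<^sub>1, w\<^sub>2)\<close> to \<open>z\<close> in the state \<open>(x, \<xi>)\<close>.\<close>

definition cl_A where
  "cl_A (A :: real mat) B C AK BK CK DK = four_block_mat (A + B * DK * C) (B * CK) (BK * C) AK"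

definition cl_B where
  "cl_B (B :: real mat) BK DK
     = four_block_mat B (B * DK) (0\<^sub>m (dim_row BK) (dim_col B)) BK"

definition cl_C where
  "cl_C (C :: real mat) CK DK
     = four_block_mat C (0\<^sub>m (dim_row C) (dim_col CK)) (DK * C) CK"

definition cl_D where
  "cl_D (DK :: real mat)
     = four_block_mat (0\<^sub>m (dim_col DK) (dim_row DK)) (0\<^sub>m (dim_col DK) (dim_col DK))
                      (0\<^sub>m (dim_row DK) (dim_row DK)) DK"

definition hinf_level ::
  "nat \<Rightarrow> nat \<Rightarrow> nat \<Rightarrow> real mat \<Rightarrow> real mat \<Rightarrow> real mat \<Rightarrow> ereal" where
  "hinf_level n m r A B C = Inf {ereal \<gamma> | \<gamma>. \<exists>nk AK BK CK DK.
       AK \<in> carrier_mat nk nk \<and> BK \<in> carrier_mat nk r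
     \<and> CK \<in> carrier_mat m nk \<and> DK \<in> carrier_mat m r
     \<and> hurwitz (cl_A A B C AK BK CK DK)
     \<and> hinf_norm (cl_A A B C AK BK CK DK) (cl_B B BK DK) (cl_C C CK DK) (cl_D DK) < ereal \<gamma>}"

lemma spectral_norm_nonneg: "0 \<le> spectral_norm M"
proof -
  have "(0\<^sub>v (dim_col M) :: complex vec) \<in> {w\<in>carrier_vec (dim_col M). vnorm w \<le> 1}"
    by (auto simp: vnorm_def L2_set_def)
  then have "ereal (vnorm (M *\<^sub>v 0\<^sub>v (dim_col M))) \<le> spectral_norm M"
    unfolding spectral_norm_def by (rule SUP_upper)
  moreover have "0 \<le> ereal (vnorm (M *\<^sub>v 0\<^sub>v (dim_col M)))"
    by (simp add: vnorm_def)
  ultimately show ?thesis by (rule order_trans[rotated])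
qed

lemma hinf_level_nonneg: "0 \<le> hinf_level n m r A B C"
  unfolding hinf_level_def
proof (rule Inf_greatest, clarify)
  fix \<gamma> AK BK CK DK
  assume h: "hinf_norm (cl_A A B C AK BK CK DK) (cl_B B BK DK) (cl_C C CK DK) (cl_D DK) < ereal \<gamma>"
  have "0 \<le> hinf_norm (cl_A A B C AK BK CK DK) (cl_B B BK DK) (cl_C C CK DK) (cl_D DK)"
    unfolding hinf_norm_def by (rule SUP_upper2[of 0]) (auto intro: spectral_norm_nonneg)
  with h show "0 \<le> ereal \<gamma>" by (meson less_imp_le order_trans)
qed

end

theory Submission
  imports
    Defs
    "Jordan_Normal_Form.Schur_Decomposition"
    "Jordan_Normal_Form.Spectral_Radius"
    "HOL-Library.Landau_Symbols"
begin

text \<open>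
  Each right-hand side has length \<open>n ^ k\<close>, so everything rests on the invertibility of the \<open>k\<close>-way
  Lyapunov matrix of the closed-loop matrix \<open>M\<close>. Its eigenvalues are sums of \<open>k\<close> eigenvalues of \<open>M\<close>, hence
  it suffices that the spectrum of \<open>M\<close> lies strictly on one side of the imaginary axis.

  The nonlinear closed loop has linear part \<open>- M\<close> (past) or \<open>M\<close> (future); its asymptotic stability
  only excludes eigenvalues strictly on the wrong side. For an imaginary eigenvalue \<open>i \<omega>\<close> of \<open>M\<close> with
  eigenvector \<open>x\<close>, the Riccati equation yields an input \<open>u\<^sub>t\<close> with \<open>i \<omega> x = A x + B u\<^sub>t\<close> and
  \<open>\<eta> |C x|\<^sup>2 + |u\<^sub>t|\<^sup>2 = 0\<close>. This contradicts the existence of a stabilizing controller whose closed loop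
  has H-infinity norm less than \<open>\<gamma>\<close>.
\<close>

text \<open>Stability of the nonlinear loop can give no more than Re \<le> 0 for its linearization:
  x' = - x^3 is asymptotically stable with eigenvalue 0. Strictness has to come from the linear
  data. With \<open>M = A + q B B\<^sup>T V\<close> the Riccati equation reads, as a quadratic form,
  \<open>M\<^sup>T V + V M = - p C\<^sup>T C + q V B B\<^sup>T V\<close>, where p q = - \<eta>. At
  an eigenvector x of an imaginary eigenvalue the left side vanishes; multiplying by q and setting
  \<open>u\<^sub>t = q B\<^sup>T V x\<close> yields the energy balance. For \<gamma> > 1 we have
  \<eta> > 0 and both terms of the balance vanish. For \<gamma> < 1 they may cancel, so the
  stability of the closed loop with the controller no longer suffices and its gain bound has to be
  exploited.

  The matrices of the two Riccati equations appear in the nonlinear closed loops because the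
  quadratic part of an energy function determines the linear part of its gradient.\<close>

unbundle no vec_syntax

section \<open>Kronecker sums\<close>

lemma dim_kron [simp]:
  "dim_row (M \<otimes>\<^sub>m N) = dim_row M * dim_row N" "dim_col (M \<otimes>\<^sub>m N) = dim_col M * dim_col N"
  by (simp_all add: kron_def)

lemma kron_carrier:
  "M \<in> carrier_mat a b \<Longrightarrow> N \<in> carrier_mat c d \<Longrightarrow> M \<otimes>\<^sub>m N \<in> carrier_mat (a * c) (b * d)"
  by auto

lemma index_kron:
  "i < dim_row M * dim_row N \<Longrightarrow> j < dim_col M * dim_col N \<Longrightarrow>
    (M \<otimes>\<^sub>m N) $$ (i, j)
      = M $$ (i div dim_row N, j div dim_col N) * N $$ (i mod dim_row N, j mod dim_col N)"
  by (simp add: kron_def)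

lemma div_mod_bounds:
  fixes i :: nat
  assumes "i < a * b"
  shows "i div b < a" "i mod b < b"
proof -
  have "b > 0" using assms by (cases b) auto
  then show "i div b < a" "i mod b < b" using assms by (simp_all add: less_mult_imp_div_less)
qed

lemma map_mat_kron:
  assumes "\<And>x y. h (x * y) = h x * h y"
  shows "map_mat h (M \<otimes>\<^sub>m N) = map_mat h M \<otimes>\<^sub>m map_mat h N"
  by (rule eq_matI) (simp_all add: index_kron div_mod_bounds assms)

lemma kron_one_one: "1\<^sub>m a \<otimes>\<^sub>m 1\<^sub>m b = (1\<^sub>m (a * b) :: 'a::semiring_1 mat)"
proof (rule eq_matI, goal_cases)
  case (1 i j)
  then have *: "i < a * b" "j < a * b" by auto
  have "i = j \<longleftrightarrow> i div b = j div b \<and> i mod b = j mod b"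
    by (metis div_mult_mod_eq)
  then show ?case using * by (auto simp: index_kron div_mod_bounds)
qed auto

lemma kron_one_right: "M \<otimes>\<^sub>m 1\<^sub>m 1 = (M :: 'a::semiring_1 mat)"
  by (rule eq_matI) (auto simp: index_kron)

lemma kron_list_carrier:
  "(\<And>M. M \<in> set Ms \<Longrightarrow> M \<in> carrier_mat n n) \<Longrightarrow>
    kron_list Ms \<in> carrier_mat (n ^ length Ms) (n ^ length Ms)"
proof (induction Ms)
  case Nil
  then show ?case by (simp add: kron_list_def)
next
  case (Cons M Ms)
  then have "kron_list Ms \<in> carrier_mat (n ^ length Ms) (n ^ length Ms)" "M \<in> carrier_mat n n" by auto
  then show ?case using kron_carrier[of M n n "kron_list Ms"] by (simp add: kron_list_def)
qed

lemma kron_list_ones: "kron_list (map (\<lambda>_. 1\<^sub>m n) xs) = 1\<^sub>m (n ^ length xs)"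
proof (induction xs)
  case Nil
  then show ?case by (simp add: kron_list_def)
next
  case (Cons x xs)
  then show ?case by (simp add: kron_list_def kron_one_one)
qed

lemma lyap_carrier: "lyap k M \<in> carrier_mat (dim_row M ^ k) (dim_row M ^ (k - 1) * dim_col M)"
  by (simp add: lyap_def)

lemma lyap_one: 
  assumes "M \<in> carrier_mat n n"
  shows "lyap 1 M = M"
proof (rule eq_matI, goal_cases)
  case (1 i j)
  then show ?case using assms by (simp add: lyap_def kron_list_def kron_one_right[simplified])
qed (use assms in \<open>auto simp: lyap_def\<close>)

text \<open>The summand with \<open>M\<close> in position 1 is the left term; all others start with
  an identity factor followed by a summand of \<open>lyap k M\<close>. Thus \<open>lyap k M\<close>
  is an iterated Kronecker sum, and its spectrum can be reached by induction.\<close>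

lemma lyap_Suc:
  assumes M: "M \<in> carrier_mat n n" and k: "1 \<le> k"
  shows "lyap (Suc k) M = M \<otimes>\<^sub>m 1\<^sub>m (n ^ k) + 1\<^sub>m n \<otimes>\<^sub>m lyap k M"
proof -
  let ?L = "\<lambda>k i. kron_list (map (\<lambda>j. if j = i then M else 1\<^sub>m n) [1..<k + 1])"
  have dims: "dim_row M = n" "dim_col M = n" using M by auto
  have nk: "n ^ (k - 1) * n = n ^ k" using k by (metis power_minus_mult mult.commute less_eq_Suc_le One_nat_def)
  have Lc: "?L k i \<in> carrier_mat (n ^ k) (n ^ k)" for i
  proof -
    have "?L k i \<in> carrier_mat (n ^ length (map (\<lambda>j. if j = i then M else 1\<^sub>m n) [1..<k + 1]))
       (n ^ length (map (\<lambda>j. if j = i then M else 1\<^sub>m n) [1..<k + 1]))"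
      by (rule kron_list_carrier) (use M in auto)
    then show ?thesis by (simp del: upt_Suc)
  qed
  \<comment> \<open>Splitting off position 1 and shifting the rest aligns summand
    \<open>Suc i\<close> for \<open>Suc k\<close> factors with summand \<open>i\<close> for
    \<open>k\<close> factors.\<close>
  have upt: "[1..<Suc k + 1] = 1 # map Suc [1..<k + 1]"
    by (simp add: upt_conv_Cons map_Suc_upt del: upt_Suc)
  have first: "?L (Suc k) 1 = M \<otimes>\<^sub>m 1\<^sub>m (n ^ k)"
  proof -
    have "?L (Suc k) 1 = kron_list (M # map (\<lambda>_. 1\<^sub>m n) [1..<k + 1])"
      unfolding upt by (rule arg_cong[of _ _ kron_list]) (auto simp del: upt_Suc)
    then show ?thesis
      using kron_list_ones[of n "[1..<k+1]"] by (simp add: kron_list_def del: upt_Suc)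
  qed
  have later: "?L (Suc k) (Suc i) = 1\<^sub>m n \<otimes>\<^sub>m ?L k i" if "1 \<le> i" for i
  proof -
    have "?L (Suc k) (Suc i) = kron_list (1\<^sub>m n # map (\<lambda>j. if j = i then M else 1\<^sub>m n) [1..<k + 1])"
      unfolding upt using that by (intro arg_cong[of _ _ kron_list]) (auto simp del: upt_Suc)
    then show ?thesis by (simp add: kron_list_def del: upt_Suc)
  qed
  show ?thesis
  proof (rule eq_matI, goal_cases)
    case (1 a b)
    then have a: "a < n * n ^ k" and b: "b < n * n ^ k" using dims nk
      by (auto simp: lyap_def)
    have b': "b < n ^ (Suc k - 1) * n" using b by (simp add: mult.commute)
    have "lyap (Suc k) M $$ (a, b) = (\<Sum>i\<in>{1..Suc k}. ?L (Suc k) i $$ (a, b))"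
      unfolding lyap_def dims using a b' by (simp add: mult.commute del: upt_Suc)
    also have "\<dots> = ?L (Suc k) 1 $$ (a, b) + (\<Sum>i\<in>{Suc 1..Suc k}. ?L (Suc k) i $$ (a, b))"
      by (subst sum.atLeast_Suc_atMost) auto
    also have "(\<Sum>i\<in>{Suc 1..Suc k}. ?L (Suc k) i $$ (a, b))
        = (\<Sum>i\<in>{1..k}. ?L (Suc k) (Suc i) $$ (a, b))"
      by (rule sum.shift_bounds_cl_Suc_ivl)
    also have "\<dots> = (\<Sum>i\<in>{1..k}. (1\<^sub>m n \<otimes>\<^sub>m ?L k i) $$ (a, b))"
      by (rule sum.cong[OF refl]) (simp only: later atLeastAtMost_iff)
    also have "\<dots> = (\<Sum>i\<in>{1..k}. 1\<^sub>m n $$ (a div n ^ k, b div n ^ k) * ?L k i $$ (a mod n ^ k, b mod n ^ k))"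
      using a b carrier_matD[OF Lc] by (intro sum.cong[OF refl]) (simp add: index_kron del: upt_Suc)
    also have "\<dots> = 1\<^sub>m n $$ (a div n ^ k, b div n ^ k) * lyap k M $$ (a mod n ^ k, b mod n ^ k)"
      unfolding lyap_def dims using div_mod_bounds[OF a] div_mod_bounds[OF b] nk
      by (simp add: sum_distrib_left del: upt_Suc)
    also have "\<dots> = (1\<^sub>m n \<otimes>\<^sub>m lyap k M) $$ (a, b)"
      using a b nk dims by (simp add: index_kron lyap_def del: upt_Suc)
    finally show ?case
      unfolding first using a b nk dims lyap_carrier[of k M] by (simp del: upt_Suc)
  qed (use dims nk in \<open>auto simp: lyap_def mult.commute\<close>)
qed

section \<open>Spectra of Sylvester operators and Kronecker sums\<close>

lemma eigenvalue_transpose: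
  fixes M :: "'a::field mat"
  assumes M: "M \<in> carrier_mat n n"
  shows "eigenvalue M\<^sup>T e \<longleftrightarrow> eigenvalue M e"
  using M by (simp add: eigenvalue_root_char_poly[of _ n])

text \<open>Over the complex numbers the characteristic polynomial splits, so \<open>Y\<close> is
  similar to a triangular matrix. Similar matrices share their characteristic polynomial, which
  identifies the diagonal entries as eigenvalues of \<open>Y\<close>.\<close>

lemma complex_schur:
  fixes Y :: "complex mat"
  assumes Y: "Y \<in> carrier_mat b b"
  obtains P Q T where "P \<in> carrier_mat b b" "Q \<in> carrier_mat b b" "T \<in> carrier_mat b b"
    "P * Q = 1\<^sub>m b" "Q * P = 1\<^sub>m b" "Y = P * T * Q"
    "\<And>i j. j < i \<Longrightarrow> i < b \<Longrightarrow> T $$ (i, j) = 0" "\<And>i. i < b \<Longrightarrow> eigenvalue Y (T $$ (i, i))"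
proof -
  obtain es where "char_poly Y = (\<Prod>a\<leftarrow>es. [:- a, 1:])"
    using char_poly_factorized[OF Y] by blast
  then obtain T where T: "T \<in> carrier_mat b b" "upper_triangular T" "similar_mat Y T"
    using schur_decomposition_exists[OF Y] by blast
  then obtain P Q where w: "similar_mat_wit Y T P Q" by (auto simp: similar_mat_def)
  note PQ = similar_mat_witD2[OF Y w]
  have ev: "eigenvalue Y (T $$ (i, i))" if "i < b" for i
  proof -
    have "char_poly Y = char_poly T" by (rule char_poly_similar[OF T(3)])
    also have "\<dots> = (\<Prod>a\<leftarrow>diag_mat T. [:- a, 1:])" by (rule char_poly_upper_triangular[OF T(1,2)])
    finally have "poly (char_poly Y) (T $$ (i, i)) = 0 \<longleftrightarrow> T $$ (i, i) \<in> set (diag_mat T)"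
      by (simp add: poly_prod_list prod_list_zero_iff image_iff)
    moreover have "T $$ (i, i) \<in> set (diag_mat T)" using that T(1) by (auto simp: diag_mat_def)
    ultimately show ?thesis by (simp add: eigenvalue_root_char_poly[OF Y])
  qed
  show ?thesis
    by (rule that[OF PQ(6,7) T(1) PQ(1,2,3)]) (use T ev in \<open>auto simp: upper_triangular_def\<close>)
qed

text \<open>If \<open>Y = P T P\<^sup>-\<^sup>1\<close> with \<open>T\<close> upper triangular, the first nonzero column of \<open>Z P\<close> is an eigenvector of \<open>X\<close>.\<close>

lemma sylvester_eigenvalue:
  fixes X Y Z :: "complex mat"
  assumes X: "X \<in> carrier_mat a a" and Y: "Y \<in> carrier_mat b b" and Z: "Z \<in> carrier_mat a b"
    and Z0: "Z \<noteq> 0\<^sub>m a b" and eq: "X * Z + Z * Y = \<mu> \<cdot>\<^sub>m Z"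
  shows "\<exists>\<alpha> \<beta>. eigenvalue X \<alpha> \<and> eigenvalue Y \<beta> \<and> \<mu> = \<alpha> + \<beta>"
proof -
  obtain P Q T where P: "P \<in> carrier_mat b b" and Q: "Q \<in> carrier_mat b b" and T: "T \<in> carrier_mat b b"
    and PQ: "P * Q = 1\<^sub>m b" and QP: "Q * P = 1\<^sub>m b" and YT: "Y = P * T * Q"
    and up: "\<And>i j. j < i \<Longrightarrow> i < b \<Longrightarrow> T $$ (i, j) = 0" and ev: "\<And>i. i < b \<Longrightarrow> eigenvalue Y (T $$ (i, i))"
    by (rule complex_schur[OF Y]) blast
  define R where "R = Z * P"
  have R: "R \<in> carrier_mat a b" using Z P by (simp add: R_def)
  have "R * Q = Z" using Z P Q PQ by (simp add: R_def assoc_mult_mat[of _ a b _ b _ b])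
  then have R0: "R \<noteq> 0\<^sub>m a b" using Z0 Q by auto
  \<comment> \<open>Multiplication by \<open>P\<close> from the right replaces \<open>Y\<close> by
    \<open>T\<close>, so that column \<open>c\<close> of the equation involves only the columns of
    \<open>R\<close> up to \<open>c\<close>.\<close>
  have YP: "Y * P = P * T"
    using P Q T by (simp add: YT assoc_mult_mat[of _ b b _ b _ b] QP mult_carrier_mat[of _ b b])
  have eqR: "X * R + R * T = \<mu> \<cdot>\<^sub>m R"
  proof -
    have "\<mu> \<cdot>\<^sub>m R = (X * Z + Z * Y) * P" by (simp add: R_def eq mult_smult_assoc_mat[OF Z P])
    also have "\<dots> = X * Z * P + Z * Y * P"
      using X Y Z P by (intro add_mult_distrib_mat) auto
    also have "X * Z * P = X * R" using X Z P by (simp add: R_def assoc_mult_mat[of _ a a _ b _ b])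
    also have "Z * Y * P = Z * (P * T)" using Z Y P by (simp add: YP assoc_mult_mat[of _ a b _ b _ b])
    also have "\<dots> = R * T" using Z T P by (simp add: R_def assoc_mult_mat[of _ a b _ b _ b])
    finally show ?thesis by simp
  qed
  have "\<exists>c. c < b \<and> col R c \<noteq> 0\<^sub>v a"
  proof (rule ccontr)
    assume "\<nexists>c. c < b \<and> col R c \<noteq> 0\<^sub>v a"
    then have z: "col R c = 0\<^sub>v a" if "c < b" for c using that by blast
    have "R $$ (i, j) = 0" if "i < a" "j < b" for i j
    proof -
      have "R $$ (i, j) = col R j $ i" using that R by auto
      then show ?thesis using z[OF that(2)] that(1) by simp
    qed
    then have "R = 0\<^sub>m a b" using R by (intro eq_matI) auto
    then show False using R0 by simp
  qed
  then obtain c where c: "c < b" "col R c \<noteq> 0\<^sub>v a" and least: "\<And>c'. c' < c \<Longrightarrow> \<not> (c' < b \<and> col R c' \<noteq> 0\<^sub>v a)"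
    using exists_least_iff[of "\<lambda>c. c < b \<and> col R c \<noteq> 0\<^sub>v a"] by blast
  have zero: "R $$ (i, c') = 0" if "c' < c" "i < a" for i c'
  proof -
    have "R $$ (i, c') = col R c' $ i" using that c R by auto
    then show ?thesis using least[OF that(1)] that c(1) by simp
  qed
  have "X *\<^sub>v col R c = (\<mu> - T $$ (c, c)) \<cdot>\<^sub>v col R c"
  proof (rule eq_vecI, goal_cases)
    case (1 i)
    then have i: "i < a" using R by auto
    \<comment> \<open>Triangularity removes the terms with \<open>k > c\<close>, minimality of
      \<open>c\<close> those with \<open>k < c\<close>.\<close>
    have "(R * T) $$ (i, c) = (\<Sum>k\<in>{0..<b}. R $$ (i, k) * T $$ (k, c))"
      using i c R T by (simp add: scalar_prod_def)
    also have "\<dots> = (\<Sum>k\<in>{0..<b}. if k = c then R $$ (i, c) * T $$ (c, c) else 0)"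
      using i up zero by (intro sum.cong[OF refl]) (metis atLeastLessThan_iff mult_eq_0_iff linorder_neqE_nat)
    also have "\<dots> = R $$ (i, c) * T $$ (c, c)" using c by simp
    finally have RT: "(R * T) $$ (i, c) = R $$ (i, c) * T $$ (c, c)" .
    have "(X * R + R * T) $$ (i, c) = (X * R) $$ (i, c) + (R * T) $$ (i, c)"
      using i c R T X by simp
    then have "(X * R) $$ (i, c) + R $$ (i, c) * T $$ (c, c) = \<mu> * R $$ (i, c)"
      using i c R by (simp add: eqR RT)
    moreover have "(X *\<^sub>v col R c) $ i = (X * R) $$ (i, c)" using i c R X by simp
    ultimately show ?case using i c R by (simp add: algebra_simps)
  qed (use X R in auto)
  then have "eigenvalue X (\<mu> - T $$ (c, c))"
    unfolding eigenvalue_def eigenvector_def using X R c by (intro exI[of _ "col R c"]) auto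
  then show ?thesis using ev[OF c(1)] by (intro exI[of _ "\<mu> - T $$ (c, c)"] exI[of _ "T $$ (c, c)"]) auto
qed

lemma sum_div_mod:
  fixes h :: "nat \<Rightarrow> 'a::comm_monoid_add"
  shows "(\<Sum>k<a * b. h k) = (\<Sum>i<a. \<Sum>j<b. h (i * b + j))"
proof (cases "b = 0")
  case False
  have "(\<Sum>i<a. \<Sum>j<b. h (i * b + j)) = (\<Sum>p\<in>{..<a} \<times> {..<b}. h (fst p * b + snd p))"
    by (simp add: sum.cartesian_product case_prod_beta)
  also have "\<dots> = (\<Sum>k<a * b. h k)"
  proof (rule sum.reindex_bij_witness[of _ "\<lambda>k. (k div b, k mod b)" "\<lambda>p. fst p * b + snd p"])
    fix p assume p: "p \<in> {..<a} \<times> {..<b}"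
    then have "Suc (fst p) * b \<le> a * b" by (intro mult_right_mono) auto
    then show "fst p * b + snd p \<in> {..<a * b}" using p by auto
  qed (use False in \<open>auto simp: div_mod_bounds\<close>)
  finally show ?thesis by simp
qed simp

text \<open>If \<open>z\<close> is read row by row as an \<open>a\<close> by \<open>b\<close> matrix
  \<open>Z\<close>, the right side is entry \<open>(i, j)\<close> of
  \<open>X * Z + Z * Y\<^sup>T\<close>: a Kronecker sum is a Sylvester operator in
  coordinates.\<close>

lemma kron_sum_mult_vec:
  fixes X Y :: "'a::comm_semiring_1 mat"
  assumes X: "X \<in> carrier_mat a a" and Y: "Y \<in> carrier_mat b b" and z: "z \<in> carrier_vec (a * b)"
    and i: "i < a" and j: "j < b"
  shows "((X \<otimes>\<^sub>m 1\<^sub>m b + 1\<^sub>m a \<otimes>\<^sub>m Y) *\<^sub>v z) $ (i * b + j)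
    = (\<Sum>i'<a. X $$ (i, i') * z $ (i' * b + j)) + (\<Sum>j'<b. Y $$ (j, j') * z $ (i * b + j'))"
proof -
  have "Suc i * b \<le> a * b" using i by (intro mult_right_mono) auto
  then have ij: "i * b + j < a * b" using j by auto
  have bnd: "i' * b + j' < a * b" if "i' < a" "j' < b" for i' j'
  proof -
    have "Suc i' * b \<le> a * b" using that by (intro mult_right_mono) auto
    then show ?thesis using that by auto
  qed
  have "((X \<otimes>\<^sub>m 1\<^sub>m b + 1\<^sub>m a \<otimes>\<^sub>m Y) *\<^sub>v z) $ (i * b + j)
     = (\<Sum>k<a * b. (X \<otimes>\<^sub>m 1\<^sub>m b + 1\<^sub>m a \<otimes>\<^sub>m Y) $$ (i * b + j, k) * z $ k)"
    using ij X Y z by (simp add: scalar_prod_def atLeast0LessThan)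
  also have "\<dots> = (\<Sum>i'<a. \<Sum>j'<b. (X \<otimes>\<^sub>m 1\<^sub>m b + 1\<^sub>m a \<otimes>\<^sub>m Y) $$ (i * b + j, i' * b + j') * z $ (i' * b + j'))"
    by (rule sum_div_mod)
  also have "\<dots> = (\<Sum>i'<a. \<Sum>j'<b. (X $$ (i, i') * (if j = j' then 1 else 0)
      + (if i = i' then 1 else 0) * Y $$ (j, j')) * z $ (i' * b + j'))"
    using X Y i j ij bnd by (intro sum.cong refl arg_cong[of _ _ "\<lambda>t. t * _"]) (auto simp: index_kron)
  also have "\<dots> = (\<Sum>i'<a. \<Sum>j'<b. if j = j' then X $$ (i, i') * z $ (i' * b + j') else 0)
      + (\<Sum>i'<a. \<Sum>j'<b. if i = i' then Y $$ (j, j') * z $ (i' * b + j') else 0)"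
    unfolding sum.distrib[symmetric] by (intro sum.cong refl) (auto simp: algebra_simps)
  also have "(\<Sum>i'<a. \<Sum>j'<b. if j = j' then X $$ (i, i') * z $ (i' * b + j') else 0)
      = (\<Sum>i'<a. X $$ (i, i') * z $ (i' * b + j))"
    using j by simp
  also have "(\<Sum>i'<a. \<Sum>j'<b. if i = i' then Y $$ (j, j') * z $ (i' * b + j') else 0)
      = (\<Sum>j'<b. Y $$ (j, j') * z $ (i * b + j'))"
    using i by (subst sum.swap) simp
  finally show ?thesis .
qed

text \<open>An eigenvector, reshaped to a matrix, is a nonzero solution of a Sylvester eigenvalue
  equation with \<open>X\<close> and \<open>Y\<^sup>T\<close>; the transpose does not change the
  spectrum of \<open>Y\<close>.\<close>

lemma eigenvalue_kron_sum:
  fixes X Y :: "complex mat"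
  assumes X: "X \<in> carrier_mat a a" and Y: "Y \<in> carrier_mat b b"
    and ev: "eigenvalue (X \<otimes>\<^sub>m 1\<^sub>m b + 1\<^sub>m a \<otimes>\<^sub>m Y) \<mu>"
  shows "\<exists>\<alpha> \<beta>. eigenvalue X \<alpha> \<and> eigenvalue Y \<beta> \<and> \<mu> = \<alpha> + \<beta>"
proof -
  obtain z where z: "z \<in> carrier_vec (a * b)" "z \<noteq> 0\<^sub>v (a * b)"
    and eqz: "(X \<otimes>\<^sub>m 1\<^sub>m b + 1\<^sub>m a \<otimes>\<^sub>m Y) *\<^sub>v z = \<mu> \<cdot>\<^sub>v z"
    using ev X Y by (auto simp: eigenvalue_def eigenvector_def)
  define Z where "Z = mat a b (\<lambda>(i, j). z $ (i * b + j))"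
  have bnd: "i * b + j < a * b" if "i < a" "j < b" for i j
  proof -
    have "Suc i * b \<le> a * b" using that by (intro mult_right_mono) auto
    then show ?thesis using that by auto
  qed
  have Z0: "Z \<noteq> 0\<^sub>m a b"
  proof
    assume h: "Z = 0\<^sub>m a b"
    have "z $ k = 0" if k: "k < a * b" for k
    proof -
      have "z $ k = Z $$ (k div b, k mod b)" using div_mod_bounds[OF k] by (simp add: Z_def)
      then show ?thesis using div_mod_bounds[OF k] by (simp add: h)
    qed
    then have "z = 0\<^sub>v (a * b)" using z(1) by (intro eq_vecI) auto
    then show False using z(2) by simp
  qed
  have "X * Z + Z * Y\<^sup>T = \<mu> \<cdot>\<^sub>m Z"
  proof (rule eq_matI, goal_cases)
    case (1 i j)
    then have i: "i < a" and j: "j < b" by (auto simp: Z_def)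
    have "(X * Z + Z * Y\<^sup>T) $$ (i, j)
        = (\<Sum>i'<a. X $$ (i, i') * z $ (i' * b + j)) + (\<Sum>j'<b. Y $$ (j, j') * z $ (i * b + j'))"
      using i j X Y by (simp add: Z_def scalar_prod_def atLeast0LessThan mult.commute)
    also have "\<dots> = \<mu> * z $ (i * b + j)"
      using kron_sum_mult_vec[OF X Y z(1) i j] bnd[OF i j] z(1) by (simp add: eqz)
    finally show ?case using i j by (simp add: Z_def)
  qed (use X Y in \<open>auto simp: Z_def\<close>)
  from sylvester_eigenvalue[OF X _ _ Z0 this, of] show ?thesis
    using Y by (simp add: eigenvalue_transpose[OF Y] Z_def)
qed

abbreviation cmat :: "real mat \<Rightarrow> complex mat" where "cmat \<equiv> map_mat complex_of_real"

lemma cmat_kron_sum: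
  assumes "X \<in> carrier_mat a a" "Y \<in> carrier_mat b b"
  shows "cmat (X \<otimes>\<^sub>m 1\<^sub>m b + 1\<^sub>m a \<otimes>\<^sub>m Y) = cmat X \<otimes>\<^sub>m 1\<^sub>m b + 1\<^sub>m a \<otimes>\<^sub>m cmat Y"
proof -
  have "cmat (X \<otimes>\<^sub>m 1\<^sub>m b + 1\<^sub>m a \<otimes>\<^sub>m Y) = cmat (X \<otimes>\<^sub>m 1\<^sub>m b) + cmat (1\<^sub>m a \<otimes>\<^sub>m Y)"
    using assms by (intro eq_matI) auto
  then show ?thesis by (simp add: map_mat_kron of_real_hom.mat_hom_one)
qed

text \<open>An open half plane bounded by the imaginary axis is closed under addition, so sums of
  eigenvalues cannot leave it. The sign of \<open>s\<close> selects the half plane, which lets one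
  proof serve both energy functions.\<close>

lemma eigenvalue_lyap_half_plane:
  fixes s :: real
  assumes M: "M \<in> carrier_mat n n" and pos: "\<And>\<alpha>. eigenvalue (cmat M) \<alpha> \<Longrightarrow> 0 < s * Re \<alpha>"
    and k: "1 \<le> k" and ev: "eigenvalue (cmat (lyap k M)) \<mu>"
  shows "0 < s * Re \<mu>"
  using k ev
proof (induction k arbitrary: \<mu> rule: nat_induct_at_least)
  case base
  then show ?case using pos M by (simp add: lyap_one[OF M, simplified])
next
  case (Suc k)
  have "n ^ (k - 1) * n = n ^ k" using Suc(1) by (metis power_minus_mult mult.commute less_eq_Suc_le One_nat_def)
  then have L: "lyap k M \<in> carrier_mat (n ^ k) (n ^ k)" using lyap_carrier[of k M] M by simp
  have "eigenvalue (cmat M \<otimes>\<^sub>m 1\<^sub>m (n ^ k) + 1\<^sub>m n \<otimes>\<^sub>m cmat (lyap k M)) \<mu>"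
    using Suc(3) by (simp add: lyap_Suc[OF M Suc(1)] cmat_kron_sum[OF M L])
  then obtain \<alpha> \<beta> where "eigenvalue (cmat M) \<alpha>" "eigenvalue (cmat (lyap k M)) \<beta>" "\<mu> = \<alpha> + \<beta>"
    using eigenvalue_kron_sum[of "cmat M" n "cmat (lyap k M)" "n ^ k" \<mu>] M L by auto
  then show ?case using pos[of \<alpha>] Suc(2)[of \<beta>] by (simp add: distrib_left)
qed

section \<open>From the spectrum to unique solvability\<close>

lemma injective_unique_solution:
  fixes M :: "'a::field mat"
  assumes M: "M \<in> carrier_mat N N" and inj: "\<And>z. z \<in> carrier_vec N \<Longrightarrow> M *\<^sub>v z = 0\<^sub>v N \<Longrightarrow> z = 0\<^sub>v N"
    and b: "b \<in> carrier_vec N"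
  shows "\<exists>!z. z \<in> carrier_vec N \<and> M *\<^sub>v z = b"
proof -
  have "det M \<noteq> 0" using inj by (auto simp: det_0_iff_vec_prod_zero_field[OF M])
  then obtain R where R: "R \<in> carrier_mat N N" "R * M = 1\<^sub>m N" "M * R = 1\<^sub>m N"
    using det_non_zero_imp_unit[OF M, of "()"] by (auto simp: Units_def ring_mat_def)
  show ?thesis
  proof (rule ex1I[of _ "R *\<^sub>v b"])
    show "R *\<^sub>v b \<in> carrier_vec N \<and> M *\<^sub>v (R *\<^sub>v b) = b"
      using R M b by (simp flip: assoc_mult_mat_vec[of M N N R N b])
    fix z assume "z \<in> carrier_vec N \<and> M *\<^sub>v z = b"
    then show "z = R *\<^sub>v b"
      using R M by (auto simp flip: assoc_mult_mat_vec[of R N N M N z])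
  qed
qed

text \<open>A real kernel vector would also be a complex one, so a spectral condition over the
  complex numbers yields a unique real solution.\<close>

lemma unique_solution_real:
  assumes M: "M \<in> carrier_mat N N" and ev: "\<not> eigenvalue (cmat M) 0" and b: "b \<in> carrier_vec N"
  shows "\<exists>!z. z \<in> carrier_vec N \<and> M *\<^sub>v z = b"
proof (rule injective_unique_solution[OF M _ b])
  have "\<not> eigenvalue M 0" using of_real_hom.eigenvalue_hom[OF M, of 0] ev by auto
  moreover have "0 \<cdot>\<^sub>v x = 0\<^sub>v N" if "x \<in> carrier_vec N" for x :: "real vec"
    using that by auto
  ultimately show "z = 0\<^sub>v N" if "z \<in> carrier_vec N" "M *\<^sub>v z = 0\<^sub>v N" for z
    using M that by (auto simp: eigenvalue_def eigenvector_def)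
qed

lemma lyap_transpose_unique_solution:
  assumes M: "M \<in> carrier_mat n n" and k: "1 \<le> k" and b: "b \<in> carrier_vec (n ^ k)"
    and half: "\<And>\<alpha>. eigenvalue (cmat M) \<alpha> \<Longrightarrow> 0 < s * Re \<alpha>"
  shows "\<exists>!z. z \<in> carrier_vec (n ^ k) \<and> (lyap k M)\<^sup>T *\<^sub>v z = b"
proof -
  have "n ^ (k - 1) * n = n ^ k" using k by (metis power_minus_mult mult.commute less_eq_Suc_le One_nat_def)
  then have L: "lyap k M \<in> carrier_mat (n ^ k) (n ^ k)" using lyap_carrier[of k M] M by simp
  have "\<not> eigenvalue (cmat (lyap k M)) 0"
    using eigenvalue_lyap_half_plane[OF M half k, of 0] by auto
  then have "\<not> eigenvalue (cmat ((lyap k M)\<^sup>T)) 0"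
    using L eigenvalue_transpose[of "cmat (lyap k M)" "n ^ k" 0]
    by (metis map_carrier_mat map_mat_transpose)
  then show ?thesis using L by (intro unique_solution_real b) auto
qed

section \<open>Instability by linearization\<close>

lemma abs_index_le_vnorm: "i < dim_vec x \<Longrightarrow> \<bar>x $ i\<bar> \<le> vnorm (x :: real vec)"
  using member_le_L2_set[of "{..<dim_vec x}" i "\<lambda>i. norm (x $ i)"] by (simp add: vnorm_def)

lemma vnorm_nonneg [simp]: "0 \<le> vnorm x"
  by (simp add: vnorm_def L2_set_nonneg)

lemma vnorm_power2: "(vnorm x)\<^sup>2 = (\<Sum>i<dim_vec x. (norm (x $ i))\<^sup>2)"
  by (simp add: vnorm_def L2_set_def sum_nonneg)

lemma vnorm_power2_real: "(vnorm (x :: real vec))\<^sup>2 = x \<bullet> x"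
  unfolding vnorm_power2 scalar_prod_def atLeast0LessThan by (simp add: power2_eq_square)

lemma vnorm_smult: "vnorm (c \<cdot>\<^sub>v x) = norm c * vnorm (x :: 'a::real_normed_div_algebra vec)"
proof (rule power2_eq_imp_eq)
  show "(vnorm (c \<cdot>\<^sub>v x))\<^sup>2 = (norm c * vnorm x)\<^sup>2"
    by (simp add: power_mult_distrib vnorm_power2 norm_mult sum_distrib_left)
qed simp_all

lemma vnorm_eq_0_iff: "vnorm x = 0 \<longleftrightarrow> x = 0\<^sub>v (dim_vec x)"
proof -
  have "vnorm x = 0 \<longleftrightarrow> (\<forall>i<dim_vec x. x $ i = 0)"
    by (simp add: vnorm_def L2_set_eq_0_iff Ball_def)
  also have "\<dots> \<longleftrightarrow> x = 0\<^sub>v (dim_vec x)"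
    by (metis eq_vecI index_zero_vec)
  finally show ?thesis .
qed

lemma scalar_prod_mult_mat_vec:
  fixes S :: "'a::comm_semiring_0 mat"
  assumes "x \<in> carrier_vec n" "y \<in> carrier_vec n'" "S \<in> carrier_mat n n'"
  shows "x \<bullet> (S *\<^sub>v y) = (\<Sum>i<n. \<Sum>j<n'. x $ i * S $$ (i, j) * y $ j)"
  using assms by (simp add: scalar_prod_def atLeast0LessThan sum_distrib_left mult.assoc)

lemma abs_bilinear_le:
  assumes "x \<in> carrier_vec n" "y \<in> carrier_vec n" "S \<in> carrier_mat n n"
    and "\<And>i. i < n \<Longrightarrow> \<bar>x $ i\<bar> \<le> p" and "\<And>i. i < n \<Longrightarrow> \<bar>y $ i\<bar> \<le> q"
  shows "\<bar>x \<bullet> (S *\<^sub>v y)\<bar> \<le> (\<Sum>i<n. \<Sum>j<n. \<bar>S $$ (i, j)\<bar>) * (p * q :: real)"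
proof -
  have "\<bar>x \<bullet> (S *\<^sub>v y)\<bar> \<le> (\<Sum>i<n. \<Sum>j<n. \<bar>x $ i * S $$ (i, j) * y $ j\<bar>)"
    unfolding scalar_prod_mult_mat_vec[OF assms(1-3)]
    by (rule order_trans[OF sum_abs]) (intro sum_mono sum_abs)
  also have "\<dots> \<le> (\<Sum>i<n. \<Sum>j<n. \<bar>S $$ (i, j)\<bar> * (p * q))"
  proof (intro sum_mono)
    fix i j assume "i \<in> {..<n}" "j \<in> {..<n}"
    then have "\<bar>x $ i\<bar> * \<bar>y $ j\<bar> \<le> p * q"
      using assms(4,5)[of i] assms(4,5)[of j] by (intro mult_mono) auto
    from mult_left_mono[OF this, of "\<bar>S $$ (i, j)\<bar>"]
    show "\<bar>x $ i * S $$ (i, j) * y $ j\<bar> \<le> \<bar>S $$ (i, j)\<bar> * (p * q)"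
      by (simp add: abs_mult algebra_simps)
  qed
  finally show ?thesis by (simp add: sum_distrib_right)
qed

text \<open>For \<open>x = y\<close> the right side is the derivative of the form
  \<open>x \<bullet> (S *\<^sub>v x)\<close> along solutions of the linear system with matrix
  \<open>M\<close>.\<close>

lemma lyapunov_form:
  fixes M S :: "'a::comm_ring_1 mat"
  assumes M: "M \<in> carrier_mat n n" and S: "S \<in> carrier_mat n n"
    and x: "x \<in> carrier_vec n" and y: "y \<in> carrier_vec n"
  shows "x \<bullet> ((M\<^sup>T * S + S * M) *\<^sub>v y) = (M *\<^sub>v x) \<bullet> (S *\<^sub>v y) + x \<bullet> (S *\<^sub>v (M *\<^sub>v y))"
proof -
  have "x \<bullet> ((M\<^sup>T * S + S * M) *\<^sub>v y) = x \<bullet> (M\<^sup>T *\<^sub>v (S *\<^sub>v y)) + x \<bullet> (S *\<^sub>v (M *\<^sub>v y))"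
    using M S x y by (simp add: add_mult_distrib_mat_vec[of _ n n] scalar_prod_add_distrib[of _ n])
  also have "x \<bullet> (M\<^sup>T *\<^sub>v (S *\<^sub>v y)) = (M\<^sup>T *\<^sub>v (S *\<^sub>v y)) \<bullet> x"
    using M S x y by (intro comm_scalar_prod[of _ n]) auto
  also have "\<dots> = (S *\<^sub>v y) \<bullet> (M *\<^sub>v x)"
    using M S x y by (intro transpose_vec_mult_scalar) auto
  also have "\<dots> = (M *\<^sub>v x) \<bullet> (S *\<^sub>v y)"
    using M S x y by (intro comm_scalar_prod[of _ n]) auto
  finally show ?thesis .
qed

text \<open>For an eigenvector a + i b with eigenvalue \<alpha> + i \<beta> this is the real part of
  the Hermitian form of \<open>M\<^sup>T * S + S * M\<close> at that vector; the contributions of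
  \<beta> cancel. It is applied with a Lyapunov solution to prove instability and with the Riccati
  solution to treat imaginary eigenvalues.\<close>

lemma lyapunov_form_eigen:
  fixes M S :: "real mat"
  assumes M: "M \<in> carrier_mat n n" and S: "S \<in> carrier_mat n n"
    and a: "a \<in> carrier_vec n" and b: "b \<in> carrier_vec n"
    and Ma: "M *\<^sub>v a = \<alpha> \<cdot>\<^sub>v a - \<beta> \<cdot>\<^sub>v b" and Mb: "M *\<^sub>v b = \<beta> \<cdot>\<^sub>v a + \<alpha> \<cdot>\<^sub>v b"
  shows "a \<bullet> ((M\<^sup>T * S + S * M) *\<^sub>v a) + b \<bullet> ((M\<^sup>T * S + S * M) *\<^sub>v b)
    = 2 * \<alpha> * (a \<bullet> (S *\<^sub>v a) + b \<bullet> (S *\<^sub>v b))"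
proof -
  note simps = mult_add_distrib_mat_vec[of _ n n] mult_minus_distrib_mat_vec[of _ n n]
    mult_mat_vec[of _ n n] scalar_prod_add_distrib[of _ n] scalar_prod_minus_distrib[of _ n]
    add_scalar_prod_distrib[of _ n] minus_scalar_prod_distrib[of _ n]
  have Sa: "S *\<^sub>v a \<in> carrier_vec n" "S *\<^sub>v b \<in> carrier_vec n" using S a b by (auto intro!: mult_mat_vec_carrier)
  have 1: "(M *\<^sub>v a) \<bullet> (S *\<^sub>v a) = \<alpha> * (a \<bullet> (S *\<^sub>v a)) - \<beta> * (b \<bullet> (S *\<^sub>v a))"
    and 2: "a \<bullet> (S *\<^sub>v (M *\<^sub>v a)) = \<alpha> * (a \<bullet> (S *\<^sub>v a)) - \<beta> * (a \<bullet> (S *\<^sub>v b))"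
    and 3: "(M *\<^sub>v b) \<bullet> (S *\<^sub>v b) = \<beta> * (a \<bullet> (S *\<^sub>v b)) + \<alpha> * (b \<bullet> (S *\<^sub>v b))"
    and 4: "b \<bullet> (S *\<^sub>v (M *\<^sub>v b)) = \<beta> * (b \<bullet> (S *\<^sub>v a)) + \<alpha> * (b \<bullet> (S *\<^sub>v b))"
    unfolding Ma Mb using S a b Sa by (simp_all add: simps)
  show ?thesis
    unfolding lyapunov_form[OF M S a a] lyapunov_form[OF M S b b] 1 2 3 4 by (simp add: algebra_simps)
qed

lemma cmat_mult_vec_parts:
  assumes "M \<in> carrier_mat m n" "z \<in> carrier_vec n"
  shows "M *\<^sub>v map_vec Re z = map_vec Re (cmat M *\<^sub>v z)" "M *\<^sub>v map_vec Im z = map_vec Im (cmat M *\<^sub>v z)"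
  using assms by (auto simp: scalar_prod_def)

lemma eigenvector_parts:
  assumes M: "M \<in> carrier_mat n n" and z: "z \<in> carrier_vec n" "cmat M *\<^sub>v z = \<mu> \<cdot>\<^sub>v z"
  shows "M *\<^sub>v map_vec Re z = Re \<mu> \<cdot>\<^sub>v map_vec Re z - Im \<mu> \<cdot>\<^sub>v map_vec Im z"
    and "M *\<^sub>v map_vec Im z = Im \<mu> \<cdot>\<^sub>v map_vec Re z + Re \<mu> \<cdot>\<^sub>v map_vec Im z"
  unfolding cmat_mult_vec_parts[OF M z(1)] z(2) by (auto simp: add.commute)

lemma vnorm_parts: "(vnorm z)\<^sup>2 = map_vec Re z \<bullet> map_vec Re z + map_vec Im z \<bullet> map_vec Im z"
  unfolding vnorm_power2_real[symmetric] by (simp add: vnorm_power2 cmod_power2 sum.distrib)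

lemma minus_smult_one_mult_vec:
  fixes M :: "'a::comm_ring_1 mat"
  assumes "M \<in> carrier_mat n n" "v \<in> carrier_vec n"
  shows "(M - c \<cdot>\<^sub>m 1\<^sub>m n) *\<^sub>v v = M *\<^sub>v v - c \<cdot>\<^sub>v v"
proof -
  have "(c \<cdot>\<^sub>m 1\<^sub>m n) *\<^sub>v v = c \<cdot>\<^sub>v v"
    using assms by (intro eq_vecI) auto
  then show ?thesis using assms by (simp add: minus_mult_distrib_mat_vec[of _ n n])
qed

lemma eigenvalue_minus_smult_one:
  fixes M :: "'a::field mat"
  assumes M: "M \<in> carrier_mat n n" and ev: "eigenvalue (M - c \<cdot>\<^sub>m 1\<^sub>m n) e"
  shows "eigenvalue M (e + c)"
proof -
  obtain v where v: "v \<in> carrier_vec n" "v \<noteq> 0\<^sub>v n" "(M - c \<cdot>\<^sub>m 1\<^sub>m n) *\<^sub>v v = e \<cdot>\<^sub>v v"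
    using ev M by (auto simp: eigenvalue_def eigenvector_def)
  have "M *\<^sub>v v - c \<cdot>\<^sub>v v = e \<cdot>\<^sub>v v"
    using v M by (simp add: minus_smult_one_mult_vec)
  then have "M *\<^sub>v v = (e + c) \<cdot>\<^sub>v v"
  proof (intro eq_vecI, goal_cases)
    case (1 i)
    from arg_cong[OF 1(1), of "\<lambda>u. u $ i"] show ?case using 1(2) v(1) M by (simp add: algebra_simps)
  qed (use v M in auto)
  then show ?thesis using v M by (auto simp: eigenvalue_def eigenvector_def)
qed

text \<open>Read row by row, the equation is a linear system whose matrix is the Kronecker sum of
  \<open>N\<^sup>T\<close> with itself. Its eigenvalues are sums of two eigenvalues of
  \<open>N\<close>, none of which is zero. The right side of the system is the identity matrix read
  in the same order.\<close>

lemma lyapunov_equation_solution: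
  assumes N: "N \<in> carrier_mat n n"
    and ne: "\<And>\<alpha> \<beta>. eigenvalue (cmat N) \<alpha> \<Longrightarrow> eigenvalue (cmat N) \<beta> \<Longrightarrow> \<alpha> + \<beta> \<noteq> 0"
  obtains S where "S \<in> carrier_mat n n" "N\<^sup>T * S + S * N = 1\<^sub>m n"
proof -
  have NT: "N\<^sup>T \<in> carrier_mat n n" "cmat (N\<^sup>T) \<in> carrier_mat n n" using N by auto
  let ?K = "N\<^sup>T \<otimes>\<^sub>m 1\<^sub>m n + 1\<^sub>m n \<otimes>\<^sub>m N\<^sup>T"
  have K: "?K \<in> carrier_mat (n * n) (n * n)" using N by auto
  have evT: "eigenvalue (cmat (N\<^sup>T)) e \<longleftrightarrow> eigenvalue (cmat N) e" for e
    using eigenvalue_transpose[of "cmat N" n e] N by (simp add: map_mat_transpose)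
  have "\<not> eigenvalue (cmat ?K) 0"
    unfolding cmat_kron_sum[OF NT(1) NT(1)]
    using eigenvalue_kron_sum[OF NT(2) NT(2), of 0] ne evT by metis
  then obtain z where z: "z \<in> carrier_vec (n * n)"
    and eq: "?K *\<^sub>v z = vec (n * n) (\<lambda>k. if k div n = k mod n then 1 else 0)"
    using unique_solution_real[OF K, of "vec (n * n) (\<lambda>k. if k div n = k mod n then 1 else 0)"] by auto
  define S where "S = mat n n (\<lambda>(i, j). z $ (i * n + j))"
  have "N\<^sup>T * S + S * N = 1\<^sub>m n"
  proof (rule eq_matI, goal_cases)
    case (1 i j)
    then have i: "i < n" and j: "j < n" by auto
    have "Suc i * n \<le> n * n" using i by (intro mult_right_mono) auto
    then have ij: "i * n + j < n * n" using j by auto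
    have "(N\<^sup>T * S + S * N) $$ (i, j)
        = (\<Sum>i'<n. N\<^sup>T $$ (i, i') * z $ (i' * n + j)) + (\<Sum>j'<n. N\<^sup>T $$ (j, j') * z $ (i * n + j'))"
      using i j N by (simp add: S_def scalar_prod_def atLeast0LessThan mult.commute)
    also have "\<dots> = (?K *\<^sub>v z) $ (i * n + j)"
      by (rule kron_sum_mult_vec[OF NT(1) NT(1) z i j, symmetric])
    also have "\<dots> = (if i = j then 1 else 0)" using i j ij by (simp add: eq)
    finally show ?case using i j by simp
  qed (use N in \<open>auto simp: S_def\<close>)
  then show ?thesis using that[of S] by (simp add: S_def)
qed

text \<open>Chetaev's instability argument: for generic \<open>\<sigma> > 0\<close> below the unstable real part, the solution
  \<open>S\<close> of \<open>(M - \<sigma>)\<^sup>T S + S (M - \<sigma>) = 1\<close> is positive somewhere, and \<open>x\<^sup>T S x\<close> grows at least like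
  \<open>exp (2 \<sigma> t)\<close> along solutions that stay close to the origin.\<close>

lemma asymptotically_stable_eigenvalue_Re_le_0:
  assumes M: "M \<in> carrier_mat n n" and stab: "asymptotically_stable n \<phi>"
    and lin: "\<And>c. 0 < c \<Longrightarrow> \<exists>\<delta>>0. \<forall>x\<in>carrier_vec n. vnorm x < \<delta> \<longrightarrow>
        (\<forall>i<n. \<bar>\<phi> x $ i - (M *\<^sub>v x) $ i\<bar> \<le> c * vnorm x)"
    and ev: "eigenvalue (cmat M) \<mu>"
  shows "Re \<mu> \<le> 0"
proof (rule ccontr)
  assume "\<not> Re \<mu> \<le> 0"
  then have \<mu>: "0 < Re \<mu>" by simp
  have cM: "cmat M \<in> carrier_mat n n" using M by simp
  \<comment> \<open>The eigenvalues \<alpha> - \<sigma> and \<beta> - \<sigma> of the shifted matrix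
    add up to zero only if \<sigma> is half the real part of \<alpha> + \<beta>. This excludes
    finitely many values from an open interval.\<close>
  let ?bad = "(\<lambda>(\<alpha>, \<beta>). Re (\<alpha> + \<beta>) / 2) ` (spectrum (cmat M) \<times> spectrum (cmat M))"
  have "finite ?bad" using card_finite_spectrum(1)[OF cM] by simp
  then have "infinite ({0<..<Re \<mu>} - ?bad)" using \<mu> by (simp add: Diff_infinite_finite)
  then obtain \<sigma> where "\<sigma> \<in> {0<..<Re \<mu>} - ?bad" by (metis equals0I finite.emptyI)
  then have \<sigma>: "0 < \<sigma>" "\<sigma> < Re \<mu>" "\<sigma> \<notin> ?bad" by auto
  define N where "N = M - \<sigma> \<cdot>\<^sub>m 1\<^sub>m n"
  have N: "N \<in> carrier_mat n n" using M by (auto simp: N_def)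
  have cN: "cmat N = cmat M - complex_of_real \<sigma> \<cdot>\<^sub>m 1\<^sub>m n"
    using M by (intro eq_matI) (auto simp: N_def)
  have "\<alpha> + \<beta> \<noteq> 0" if "eigenvalue (cmat N) \<alpha>" "eigenvalue (cmat N) \<beta>" for \<alpha> \<beta>
  proof
    assume 0: "\<alpha> + \<beta> = 0"
    have "eigenvalue (cmat M) (\<alpha> + \<sigma>)" "eigenvalue (cmat M) (\<beta> + \<sigma>)"
      using that eigenvalue_minus_smult_one[OF cM] by (auto simp: cN)
    then have "Re ((\<alpha> + \<sigma>) + (\<beta> + \<sigma>)) / 2 \<in> ?bad" by (force simp: spectrum_def)
    moreover have "Re ((\<alpha> + \<sigma>) + (\<beta> + \<sigma>)) / 2 = \<sigma>"
      using arg_cong[OF 0, of Re] by simp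
    ultimately show False using \<sigma>(3) by metis
  qed
  from lyapunov_equation_solution[OF N this] obtain S
    where S: "S \<in> carrier_mat n n" and NS: "N\<^sup>T * S + S * N = 1\<^sub>m n" by blast
  \<comment> \<open>Undoing the shift: along the linear flow the form grows at rate 2 \<sigma>, with
    a surplus \<open>x \<bullet> x\<close> that will absorb the nonlinear remainder.\<close>
  have MS: "x \<bullet> ((M\<^sup>T * S + S * M) *\<^sub>v x) = 2 * \<sigma> * (x \<bullet> (S *\<^sub>v x)) + x \<bullet> x"
    if x: "x \<in> carrier_vec n" for x
  proof -
    have Nx: "N *\<^sub>v x = M *\<^sub>v x - \<sigma> \<cdot>\<^sub>v x"
      using x M by (simp add: N_def minus_smult_one_mult_vec)
    have "x \<bullet> x = x \<bullet> ((N\<^sup>T * S + S * N) *\<^sub>v x)" using x by (simp add: NS)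
    also have "\<dots> = (M *\<^sub>v x - \<sigma> \<cdot>\<^sub>v x) \<bullet> (S *\<^sub>v x) + x \<bullet> (S *\<^sub>v (M *\<^sub>v x - \<sigma> \<cdot>\<^sub>v x))"
      by (simp add: lyapunov_form[OF N S x x] Nx)
    also have "\<dots> = (M *\<^sub>v x) \<bullet> (S *\<^sub>v x) + x \<bullet> (S *\<^sub>v (M *\<^sub>v x)) - 2 * \<sigma> * (x \<bullet> (S *\<^sub>v x))"
      using x M S by (simp add: mult_minus_distrib_mat_vec[of _ n n] mult_mat_vec[of _ n n]
        scalar_prod_minus_distrib[of _ n] minus_scalar_prod_distrib[of _ n])
    finally show ?thesis by (simp add: lyapunov_form[OF M S x x])
  qed
  obtain v where v: "v \<in> carrier_vec n" "0 < v \<bullet> (S *\<^sub>v v)"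
  proof -
    obtain z where z: "z \<in> carrier_vec n" "z \<noteq> 0\<^sub>v n" "cmat M *\<^sub>v z = \<mu> \<cdot>\<^sub>v z"
      using ev M by (auto simp: eigenvalue_def eigenvector_def)
    define a where "a = map_vec Re z"
    define b where "b = map_vec Im z"
    have ab: "a \<in> carrier_vec n" "b \<in> carrier_vec n" using z(1) by (auto simp: a_def b_def)
    note Mab = eigenvector_parts[OF M z(1,3), folded a_def b_def]
    let ?s = "a \<bullet> (S *\<^sub>v a) + b \<bullet> (S *\<^sub>v b)"
    \<comment> \<open>Evaluating the derivative of the form at the eigenvector in two ways leaves a
      positive right side. Since \<sigma> lies below the real part of \<mu>, the form is positive at
      the real or at the imaginary part.\<close>
    have "2 * Re \<mu> * ?s = 2 * \<sigma> * ?s + (a \<bullet> a + b \<bullet> b)"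
      using lyapunov_form_eigen[OF M S ab(1,2) Mab] MS[OF ab(1)] MS[OF ab(2)] by (simp add: algebra_simps)
    then have "2 * (Re \<mu> - \<sigma>) * ?s = (vnorm a)\<^sup>2 + (vnorm b)\<^sup>2"
      by (simp add: vnorm_power2_real algebra_simps)
    moreover have "(vnorm a)\<^sup>2 + (vnorm b)\<^sup>2 > 0"
    proof -
      have "(vnorm a)\<^sup>2 + (vnorm b)\<^sup>2 = (vnorm z)\<^sup>2"
        by (simp add: vnorm_parts[of z] vnorm_power2_real a_def b_def)
      moreover have "vnorm z \<noteq> 0" using z by (auto simp: vnorm_eq_0_iff)
      ultimately show ?thesis by simp
    qed
    ultimately have "?s > 0" using \<sigma>(2) by (metis zero_less_mult_pos diff_gt_0_iff_gt zero_less_numeral mult_pos_pos)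
    then have "0 < a \<bullet> (S *\<^sub>v a) \<or> 0 < b \<bullet> (S *\<^sub>v b)" by linarith
    then show ?thesis using that ab by blast
  qed
  define K where "K = (\<Sum>i<n. \<Sum>j<n. \<bar>S $$ (i, j)\<bar>)"
  have K: "0 \<le> K" by (auto simp: K_def intro!: sum_nonneg)
  \<comment> \<open>The remainder \<open>r\<close> enters the derivative of the form through two
    terms, each at most \<open>K\<close> times its relative size times the squared norm. The chosen
    size keeps their sum within the surplus; \<open>K + 1\<close> avoids a division by zero.\<close>
  obtain \<delta> where \<delta>: "0 < \<delta>" and lin\<delta>: "\<And>x i. x \<in> carrier_vec n \<Longrightarrow> vnorm x < \<delta> \<Longrightarrow> i < n \<Longrightarrow>
      \<bar>\<phi> x $ i - (M *\<^sub>v x) $ i\<bar> \<le> 1 / (2 * (K + 1)) * vnorm x"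
    using lin[of "1 / (2 * (K + 1))"] K by auto
  \<comment> \<open>Lyapunov stability supplies, from every small initial value, a solution that
    never leaves the ball where the linear estimate holds.\<close>
  obtain \<delta>' where \<delta>': "0 < \<delta>'" and stab': "\<And>x0. x0 \<in> carrier_vec n \<Longrightarrow> vnorm x0 < \<delta>' \<Longrightarrow>
      \<exists>x. ode_solution n \<phi> x \<and> x 0 = x0 \<and> (\<forall>t\<ge>0. vnorm (x t) < \<delta>)"
    using stab \<delta> unfolding asymptotically_stable_def by metis
  have v1: "0 < vnorm v + 1" by (simp add: add_nonneg_pos)
  \<comment> \<open>Positive scaling keeps the form positive at the initial value. Adding 1 to the
    norm avoids a separate case for division by zero, and halving makes the bound strict.\<close>
  define s where "s = \<delta>' / 2 / (vnorm v + 1)"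
  have s: "0 < s" using \<delta>' v1 by (simp add: s_def)
  have "vnorm (s \<cdot>\<^sub>v v) = s * vnorm v" using s by (simp add: vnorm_smult)
  also have "\<dots> \<le> s * (vnorm v + 1)" using s by simp
  also have "\<dots> = \<delta>' / 2" using v1 unfolding s_def by (intro nonzero_eq_divide_eq[THEN iffD1] refl) simp
  finally have "vnorm (s \<cdot>\<^sub>v v) < \<delta>'" using \<delta>' by simp
  then obtain x where ode: "ode_solution n \<phi> x" and x0: "x 0 = s \<cdot>\<^sub>v v" and small: "\<And>t. 0 \<le> t \<Longrightarrow> vnorm (x t) < \<delta>"
    using stab'[of "s \<cdot>\<^sub>v v"] v(1) by auto
  have xc: "x t \<in> carrier_vec n" if "0 \<le> t" for t using ode that by (auto simp: ode_solution_def)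
  have xd: "((\<lambda>s. x s $ i) has_real_derivative \<phi> (x t) $ i) (at t within {0..})" if "0 \<le> t" "i < n" for t i
    using ode that by (auto simp: ode_solution_def)
  \<comment> \<open>The form is written in entries because the differential equation is given
    entrywise.\<close>
  define U where "U t = (\<Sum>i<n. \<Sum>j<n. x t $ i * S $$ (i, j) * x t $ j)" for t
  have U: "U t = x t \<bullet> (S *\<^sub>v x t)" if "0 \<le> t" for t
    unfolding U_def using scalar_prod_mult_mat_vec[OF xc[OF that] xc[OF that] S] by simp
  have growth: "\<exists>D. (U has_real_derivative D) (at t within {0..}) \<and> 2 * \<sigma> * U t \<le> D" if t: "0 \<le> t" for t
  proof -
    define y where "y = x t"
    have y: "y \<in> carrier_vec n" using xc[OF t] by (simp add: y_def)
    have Uy: "U t = y \<bullet> (S *\<^sub>v y)" using U[OF t] by (simp add: y_def)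
    \<comment> \<open>The length of \<open>\<phi> y\<close> is not prescribed; only its first
      \<open>n\<close> entries enter the differential equation, so these are collected in a vector
      of length \<open>n\<close>.\<close>
    define \<psi> where "\<psi> = vec n (\<lambda>i. \<phi> y $ i)"
    define r where "r = \<psi> - M *\<^sub>v y"
    have carr: "\<psi> \<in> carrier_vec n" "r \<in> carrier_vec n" "M *\<^sub>v y \<in> carrier_vec n" "S *\<^sub>v y \<in> carrier_vec n" "S *\<^sub>v r \<in> carrier_vec n"
      using M S y by (auto simp: \<psi>_def r_def)
    have \<psi>: "\<psi> = M *\<^sub>v y + r"
      using carr M by (intro eq_vecI) (auto simp: r_def)
    have "(U has_real_derivative (\<Sum>i<n. \<Sum>j<n. \<psi> $ i * S $$ (i, j) * y $ j + y $ i * S $$ (i, j) * \<psi> $ j)) (at t within {0..})"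
      unfolding U_def using t
      by (auto intro!: DERIV_sum derivative_eq_intros xd simp: \<psi>_def y_def algebra_simps)
    also have "(\<Sum>i<n. \<Sum>j<n. \<psi> $ i * S $$ (i, j) * y $ j + y $ i * S $$ (i, j) * \<psi> $ j)
        = \<psi> \<bullet> (S *\<^sub>v y) + y \<bullet> (S *\<^sub>v \<psi>)"
      using scalar_prod_mult_mat_vec[OF carr(1) y S] scalar_prod_mult_mat_vec[OF y carr(1) S]
      by (simp add: sum.distrib)
    also have "\<dots> = y \<bullet> ((M\<^sup>T * S + S * M) *\<^sub>v y) + (r \<bullet> (S *\<^sub>v y) + y \<bullet> (S *\<^sub>v r))"
      unfolding lyapunov_form[OF M S y y] \<psi> using carr y S
      by (simp add: mult_add_distrib_mat_vec[of _ n n] scalar_prod_add_distrib[of _ n] add_scalar_prod_distrib[of _ n])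
    finally have D: "(U has_real_derivative 2 * \<sigma> * U t + (y \<bullet> y + (r \<bullet> (S *\<^sub>v y) + y \<bullet> (S *\<^sub>v r)))) (at t within {0..})"
      by (simp add: MS[OF y] Uy algebra_simps)
    let ?c = "1 / (2 * (K + 1))"
    have r: "\<bar>r $ i\<bar> \<le> ?c * vnorm y" if "i < n" for i
      using lin\<delta>[OF y _ that] small[OF t] that M y by (simp add: r_def \<psi>_def y_def)
    have yi: "\<bar>y $ i\<bar> \<le> vnorm y" if "i < n" for i
      using abs_index_le_vnorm[of i y] that y by simp
    have "\<bar>r \<bullet> (S *\<^sub>v y)\<bar> \<le> K * (?c * vnorm y * vnorm y)" "\<bar>y \<bullet> (S *\<^sub>v r)\<bar> \<le> K * (vnorm y * (?c * vnorm y))"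
      unfolding K_def using abs_bilinear_le[OF carr(2) y S r yi] abs_bilinear_le[OF y carr(2) S yi r]
      by (auto simp: K_def)
    moreover have "K * (?c * vnorm y * vnorm y) + K * (vnorm y * (?c * vnorm y)) \<le> (vnorm y)\<^sup>2"
    proof -
      have "K * (c * w * w) + K * (w * (c * w)) = 2 * K * c * w\<^sup>2" for c w :: real
        by (simp add: power2_eq_square algebra_simps)
      then have "K * (?c * vnorm y * vnorm y) + K * (vnorm y * (?c * vnorm y)) = 2 * K * ?c * (vnorm y)\<^sup>2" .
      also have "\<dots> \<le> 1 * (vnorm y)\<^sup>2"
        using K by (intro mult_right_mono) (simp_all add: divide_le_eq)
      finally show ?thesis by simp
    qed
    ultimately have "0 \<le> y \<bullet> y + (r \<bullet> (S *\<^sub>v y) + y \<bullet> (S *\<^sub>v r))"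
      unfolding vnorm_power2_real[symmetric] by linarith
    then show ?thesis using D by (intro exI[of _ "2 * \<sigma> * U t + (y \<bullet> y + (r \<bullet> (S *\<^sub>v y) + y \<bullet> (S *\<^sub>v r)))"]) auto
  qed
  \<comment> \<open>The integrating factor turns the differential inequality for \<open>U\<close>
    into monotonicity.\<close>
  define P where "P t = U t * exp (- 2 * \<sigma> * t)" for t
  have Pd: "\<exists>D. (P has_real_derivative D) (at t within {0..}) \<and> 0 \<le> D" if t: "0 \<le> t" for t
  proof -
    obtain D where D: "(U has_real_derivative D) (at t within {0..})" "2 * \<sigma> * U t \<le> D" using growth[OF t] by blast
    have "(P has_real_derivative (D - 2 * \<sigma> * U t) * exp (- 2 * \<sigma> * t)) (at t within {0..})"
      unfolding P_def by (auto intro!: derivative_eq_intros D(1) simp: algebra_simps)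
    then show ?thesis using D(2) by (intro exI[of _ "(D - 2 * \<sigma> * U t) * exp (- 2 * \<sigma> * t)"]) auto
  qed
  have mono: "P 0 \<le> P t" if t: "0 \<le> t" for t
  proof (rule DERIV_nonneg_imp_increasing_open[OF t])
    fix \<tau> assume \<tau>: "0 < \<tau>" "\<tau> < t"
    \<comment> \<open>At interior times the derivative within the half line is two-sided; the
      endpoint 0 is covered by continuity.\<close>
    then have "at \<tau> within {0..} = at \<tau>" by (intro at_within_interior) auto
    then show "\<exists>D. (P has_real_derivative D) (at \<tau>) \<and> 0 \<le> D" using Pd[of \<tau>] \<tau> by auto
  next
    have "continuous_on {0..} P"
      using Pd DERIV_continuous unfolding continuous_on_eq_continuous_within by (metis atLeast_iff)
    then show "continuous_on {0..t} P" by (rule continuous_on_subset) auto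
  qed
  have U0: "0 < U 0" using U[of 0] v s S by (simp add: x0 mult_mat_vec[of _ n n])
  \<comment> \<open>At this time already the lower bound 1 + y for exp y forces \<open>U t\<close>
    to be at least \<open>U 0 + K * \<delta>\<^sup>2\<close>, whereas the ball of radius \<delta>
    only admits \<open>K * \<delta>\<^sup>2\<close>.\<close>
  define t where "t = K * \<delta>\<^sup>2 / (2 * \<sigma> * U 0)"
  have t: "0 \<le> t" using K \<sigma>(1) U0 by (simp add: t_def)
  have "U 0 \<le> U t * exp (- 2 * \<sigma> * t)" using mono[OF t] by (simp add: P_def)
  then have "U 0 * exp (2 * \<sigma> * t) \<le> U t" by (simp add: exp_minus field_simps)
  moreover have "U 0 * (1 + 2 * \<sigma> * t) \<le> U 0 * exp (2 * \<sigma> * t)"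
    using U0 by (intro mult_left_mono exp_ge_add_one_self) auto
  moreover have "U 0 * (1 + 2 * \<sigma> * t) = U 0 + K * \<delta>\<^sup>2" using U0 \<sigma>(1) by (simp add: t_def field_simps)
  moreover have "U t \<le> K * \<delta>\<^sup>2"
  proof -
    have "\<bar>x t $ i\<bar> \<le> \<delta>" if "i < n" for i
      using abs_index_le_vnorm[of i "x t"] small[OF t] xc[OF t] that by force
    then show ?thesis using abs_bilinear_le[OF xc[OF t] xc[OF t] S, of \<delta> \<delta>] U[OF t]
      by (simp add: K_def power2_eq_square)
  qed
  ultimately show False using U0 by linarith
qed

section \<open>Expansion of the closed loop at the origin\<close>

text \<open>Vectors of all lengths share one type. The neighbourhood filter of the origin is
  therefore pulled back along \<open>vnorm\<close> and restricted to one length, which makes Landau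
  symbols available for the expansions.\<close>

definition near_origin :: "nat \<Rightarrow> real vec filter" where
  "near_origin n = inf (filtercomap vnorm (nhds 0)) (principal (carrier_vec n))"

lemma eventually_near_origin:
  "eventually P (near_origin n) \<longleftrightarrow> (\<exists>\<delta>>0. \<forall>x\<in>carrier_vec n. vnorm x < \<delta> \<longrightarrow> P x)"
proof
  assume "eventually P (near_origin n)"
  then obtain Q where Q: "eventually Q (nhds (0::real))" "\<And>x. Q (vnorm x) \<Longrightarrow> x \<in> carrier_vec n \<Longrightarrow> P x"
    unfolding near_origin_def eventually_inf_principal eventually_filtercomap by blast
  then obtain \<delta> where "\<delta> > 0" "\<And>y. dist y 0 < \<delta> \<Longrightarrow> Q y" unfolding eventually_nhds_metric by blast
  then show "\<exists>\<delta>>0. \<forall>x\<in>carrier_vec n. vnorm x < \<delta> \<longrightarrow> P x"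
    using Q(2) by (intro exI[of _ \<delta>]) auto
next
  assume "\<exists>\<delta>>0. \<forall>x\<in>carrier_vec n. vnorm x < \<delta> \<longrightarrow> P x"
  then obtain \<delta> where \<delta>: "\<delta> > 0" "\<forall>x\<in>carrier_vec n. vnorm x < \<delta> \<longrightarrow> P x" by blast
  have "eventually (\<lambda>y::real. y < \<delta>) (nhds 0)" using \<delta>(1) by (intro order_tendstoD(2)[OF filterlim_ident])
  then show "eventually P (near_origin n)"
    unfolding near_origin_def eventually_inf_principal eventually_filtercomap
    using \<delta>(2) by (intro exI[of _ "\<lambda>y. y < \<delta>"]) auto
qed

lemma eventually_near_origin_carrier: "eventually (\<lambda>x. x \<in> carrier_vec n) (near_origin n)"
  unfolding eventually_near_origin by (intro exI[of _ 1]) auto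

lemma near_origin_bigoI:
  assumes "\<And>x. x \<in> carrier_vec n \<Longrightarrow> \<bar>h x\<bar> \<le> c * vnorm x ^ k"
  shows "h \<in> O[near_origin n](\<lambda>x. vnorm x ^ k)"
  by (rule bigoI[of _ c], rule eventually_mono[OF eventually_near_origin_carrier]) (use assms in auto)

lemma near_origin_bigo_cong:
  assumes "\<And>x. x \<in> carrier_vec n \<Longrightarrow> h x = h' x"
  shows "h \<in> O[near_origin n](w) \<longleftrightarrow> h' \<in> O[near_origin n](w)"
  by (rule landau_o.big.in_cong, rule eventually_mono[OF eventually_near_origin_carrier]) (use assms in auto)

lemma vnorm_power_bigo:
  assumes "j \<le> k"
  shows "(\<lambda>x. vnorm x ^ k) \<in> O[near_origin n](\<lambda>x. vnorm x ^ j)"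
proof (rule bigoI[of _ 1])
  show "eventually (\<lambda>x. norm (vnorm x ^ k) \<le> 1 * norm (vnorm x ^ j)) (near_origin n)"
    unfolding eventually_near_origin
    by (intro exI[of _ 1]) (auto intro!: power_decreasing assms)
qed

text \<open>The difference splits as \<open>(p - p') * q + p' * (q - q')\<close>. An error of first
  order in \<open>p\<close> is harmless because it meets a factor of first order.\<close>

lemma bigo_mult_diff:
  fixes p p' q q' :: "_ \<Rightarrow> real"
  assumes p: "(\<lambda>x. p x - p' x) \<in> O[near_origin n](\<lambda>x. vnorm x ^ 1)" and p': "p' \<in> O[near_origin n](\<lambda>x. vnorm x ^ 0)"
    and q: "(\<lambda>x. q x - q' x) \<in> O[near_origin n](\<lambda>x. vnorm x ^ 2)" and q': "q' \<in> O[near_origin n](\<lambda>x. vnorm x ^ 1)"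
  shows "(\<lambda>x. p x * q x - p' x * q' x) \<in> O[near_origin n](\<lambda>x. vnorm x ^ 2)"
proof -
  have "(\<lambda>x. q x - q' x) \<in> O[near_origin n](\<lambda>x. vnorm x ^ 1)"
    by (rule landau_o.big_trans[OF q vnorm_power_bigo]) simp
  from sum_in_bigo(1)[OF this q'] have "q \<in> O[near_origin n](\<lambda>x. vnorm x ^ 1)" by simp
  from landau_o.big.mult[OF p this] landau_o.big.mult[OF p' q]
  have "(\<lambda>x. (p x - p' x) * q x) \<in> O[near_origin n](\<lambda>x. vnorm x ^ 2)"
    "(\<lambda>x. p' x * (q x - q' x)) \<in> O[near_origin n](\<lambda>x. vnorm x ^ 2)"
    by (simp_all add: power2_eq_square)
  from sum_in_bigo(1)[OF this] show ?thesis by (simp add: algebra_simps)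
qed

section \<open>Kronecker powers and the gradient of an energy function\<close>

lemma dim_kron_pow: "x \<in> carrier_vec n \<Longrightarrow> dim_vec (kron_pow x k) = n ^ k"
  by (induction k) (simp_all add: kron_pow_def kron_vecs_def kron_vec_def)

lemma kron_pow_carrier: "x \<in> carrier_vec n \<Longrightarrow> kron_pow x k \<in> carrier_vec (n ^ k)"
  by (rule carrier_vecI) (rule dim_kron_pow)

lemma index_kron_pow_0: "kron_pow x 0 $ 0 = 1"
  by (simp add: kron_pow_def kron_vecs_def)

lemma index_kron_pow_Suc:
  assumes "x \<in> carrier_vec n" "a < n ^ Suc k"
  shows "kron_pow x (Suc k) $ a = x $ (a div n ^ k) * kron_pow x k $ (a mod n ^ k)"
proof -
  have "kron_pow x (Suc k) = x \<otimes>\<^sub>v kron_pow x k" by (simp add: kron_pow_def kron_vecs_def)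
  then show ?thesis using assms dim_kron_pow[OF assms(1), of k] by (simp add: kron_vec_def)
qed

lemma abs_kron_pow_le:
  assumes x: "x \<in> carrier_vec n" and M: "\<And>j. j < n \<Longrightarrow> \<bar>x $ j\<bar> \<le> M" and a: "a < n ^ k"
  shows "\<bar>kron_pow x k $ a\<bar> \<le> M ^ k"
  using a
proof (induction k arbitrary: a)
  case 0
  then show ?case by (simp add: index_kron_pow_0)
next
  case (Suc k)
  have *: "a div n ^ k < n" "a mod n ^ k < n ^ k" using div_mod_bounds[of a n "n ^ k"] Suc(2) by simp_all
  then show ?case
    using Suc(1)[OF *(2)] M[OF *(1)] order_trans[OF abs_ge_zero M[OF *(1)]]
    by (auto simp: index_kron_pow_Suc[OF x Suc(2)] abs_mult intro!: mult_mono)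
qed

text \<open>The partial derivative in coordinate \<open>i\<close> of entry \<open>a\<close> of the
  Kronecker power, by the product rule applied to \<open>index_kron_pow_Suc\<close>. An explicit
  recursion permits the uniform bounds needed for termwise differentiation.\<close>

primrec kron_pow_deriv :: "nat \<Rightarrow> nat \<Rightarrow> nat \<Rightarrow> nat \<Rightarrow> real vec \<Rightarrow> real" where
  "kron_pow_deriv n i 0 a x = 0"
| "kron_pow_deriv n i (Suc k) a x =
    (if a div n ^ k = i then kron_pow x k $ (a mod n ^ k) else 0)
    + x $ (a div n ^ k) * kron_pow_deriv n i k (a mod n ^ k) x"

lemma kron_pow_has_deriv:
  assumes x: "x \<in> carrier_vec n" and i: "i < n" and a: "a < n ^ k"
  shows "((\<lambda>t. kron_pow (x + t \<cdot>\<^sub>v unit_vec n i) k $ a)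
    has_real_derivative kron_pow_deriv n i k a (x + t \<cdot>\<^sub>v unit_vec n i)) (at t)"
  using a
proof (induction k arbitrary: a)
  case 0
  then show ?case by (simp add: index_kron_pow_0)
next
  case (Suc k)
  have *: "a div n ^ k < n" "a mod n ^ k < n ^ k" using div_mod_bounds[of a n "n ^ k"] Suc(2) by simp_all
  have c: "x + t \<cdot>\<^sub>v unit_vec n i \<in> carrier_vec n" for t using x by simp
  have "((\<lambda>t. (x + t \<cdot>\<^sub>v unit_vec n i) $ (a div n ^ k)) has_real_derivative
      (if a div n ^ k = i then 1 else 0)) (at t)"
    using x i * by (auto intro!: derivative_eq_intros)
  from DERIV_mult[OF this Suc(1)[OF *(2)]] show ?case
    unfolding index_kron_pow_Suc[OF c Suc(2)] by (rule DERIV_cong) simp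
qed

lemma abs_kron_pow_deriv_le:
  assumes x: "x \<in> carrier_vec n" and M: "\<And>j. j < n \<Longrightarrow> \<bar>x $ j\<bar> \<le> M" and M0: "0 \<le> M" and a: "a < n ^ k"
  shows "\<bar>kron_pow_deriv n i k a x\<bar> \<le> real k * M ^ (k - 1)"
  using a
proof (induction k arbitrary: a)
  case 0
  then show ?case by simp
next
  case (Suc k)
  have *: "a div n ^ k < n" "a mod n ^ k < n ^ k" using div_mod_bounds[of a n "n ^ k"] Suc(2) by simp_all
  have "\<bar>kron_pow_deriv n i (Suc k) a x\<bar>
     \<le> \<bar>if a div n ^ k = i then kron_pow x k $ (a mod n ^ k) else 0\<bar>
       + \<bar>x $ (a div n ^ k)\<bar> * \<bar>kron_pow_deriv n i k (a mod n ^ k) x\<bar>"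
    by (simp only: kron_pow_deriv.simps abs_mult[symmetric] abs_triangle_ineq)
  also have "\<dots> \<le> M ^ k + M * (real k * M ^ (k - 1))"
    using abs_kron_pow_le[OF x M *(2)] M0 M[OF *(1)] Suc(1)[OF *(2)]
    by (intro add_mono mult_mono) auto
  \<comment> \<open>For \<open>k = 0\<close> the truncated exponent \<open>k - 1\<close> does no
    harm, because the factor \<open>real k\<close> vanishes.\<close>
  also have "\<dots> = real (Suc k) * M ^ (Suc k - 1)"
    by (cases k) (simp_all add: algebra_simps)
  finally show ?case .
qed

text \<open>The power series may be differentiated term by term inside its polydisc. Its quadratic
  term contributes half of \<open>V + V\<^sup>T\<close> applied to \<open>x\<close>, which is
  \<open>V *\<^sub>v x\<close> by symmetry; all later terms are divisible by two powers of the
  norm.\<close>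

lemma grad_energy_bigo:
  assumes E: "energy_expansion n d E v" and d: "2 \<le> d"
    and V: "V \<in> carrier_mat n n" "V\<^sup>T = V" "v 2 = vec_of_mat V" and i: "i < n"
  shows "(\<lambda>x. grad n E x $ i - (V *\<^sub>v x) $ i) \<in> O[near_origin n](\<lambda>x. vnorm x ^ 2)"
proof -
  obtain c where c: "\<forall>k\<ge>2. c k \<in> carrier_vec (n ^ k) \<and> symmetric_tensor n k (c k)"
    and series: "\<exists>\<rho>>0. summable (\<lambda>k. (\<Sum>a<n ^ (k + 2). \<bar>c (k + 2) $ a\<bar>) * \<rho> ^ (k + 2))
        \<and> (\<forall>x\<in>carrier_vec n. (\<forall>i<n. \<bar>x $ i\<bar> < \<rho>) \<longrightarrow>
             (\<lambda>k. 1/2 * (c (k + 2) \<bullet> kron_pow x (k + 2))) sums E x)"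
    and vc: "\<forall>k\<in>{2..d}. v k = c k"
    using E unfolding energy_expansion_def by blast
  obtain \<rho> where \<rho>: "0 < \<rho>"
    and summ: "summable (\<lambda>k. (\<Sum>a<n ^ (k + 2). \<bar>c (k + 2) $ a\<bar>) * \<rho> ^ (k + 2))"
    and sums: "\<And>x. x \<in> carrier_vec n \<Longrightarrow> (\<forall>i<n. \<bar>x $ i\<bar> < \<rho>) \<Longrightarrow>
        (\<lambda>k. 1/2 * (c (k + 2) \<bullet> kron_pow x (k + 2))) sums E x"
    using series by blast
  have v2: "v 2 = c 2" using vc d by simp
  define C where "C k = (\<Sum>a<n ^ (k + 2). \<bar>c (k + 2) $ a\<bar>)" for k
  have C0: "0 \<le> C k" for k by (simp add: C_def sum_nonneg)
  define e where "e k x = 1/2 * (c (k + 2) \<bullet> kron_pow x (k + 2))" for k x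
  define e' where "e' k x = 1/2 * (\<Sum>a<n ^ (k + 2). c (k + 2) $ a * kron_pow_deriv n i (k + 2) a x)" for k x
  have e_sum: "e k x = 1/2 * (\<Sum>a<n ^ (k + 2). c (k + 2) $ a * kron_pow x (k + 2) $ a)"
    if "x \<in> carrier_vec n" for k x
    using dim_kron_pow[OF that, of "k + 2"] by (simp add: e_def scalar_prod_def atLeast0LessThan)
  have e_deriv: "((\<lambda>t. e k (x + t \<cdot>\<^sub>v unit_vec n i)) has_real_derivative e' k (x + t \<cdot>\<^sub>v unit_vec n i)) (at t)"
    if x: "x \<in> carrier_vec n" for k x t
  proof -
    have xt: "x + t \<cdot>\<^sub>v unit_vec n i \<in> carrier_vec n" for t using x by simp
    show ?thesis
      unfolding e_sum[OF xt] e'_def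
      by (intro DERIV_cmult DERIV_sum kron_pow_has_deriv[OF x i]) simp
  qed
  have e'_le: "\<bar>e' k x\<bar> \<le> C k * real (k + 2) * M ^ (k + 1)"
    if "x \<in> carrier_vec n" "\<And>j. j < n \<Longrightarrow> \<bar>x $ j\<bar> \<le> M" "0 \<le> M" for k x M
  proof -
    have "\<bar>\<Sum>a<n ^ (k + 2). c (k + 2) $ a * kron_pow_deriv n i (k + 2) a x\<bar>
      \<le> (\<Sum>a<n ^ (k + 2). \<bar>c (k + 2) $ a\<bar> * (real (k + 2) * M ^ (k + 2 - 1)))"
    proof (intro order_trans[OF sum_abs] sum_mono)
      fix a assume "a \<in> {..<n ^ (k + 2)}"
      then have "\<bar>kron_pow_deriv n i (k + 2) a x\<bar> \<le> real (k + 2) * M ^ (k + 2 - 1)"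
        by (intro abs_kron_pow_deriv_le that) auto
      then show "\<bar>c (k + 2) $ a * kron_pow_deriv n i (k + 2) a x\<bar>
          \<le> \<bar>c (k + 2) $ a\<bar> * (real (k + 2) * M ^ (k + 2 - 1))"
        unfolding abs_mult by (rule mult_left_mono) simp
    qed
    also have "\<dots> = C k * real (k + 2) * M ^ (k + 1)"
      by (simp add: C_def sum_distrib_right mult.assoc)
    finally show ?thesis
      using C0[of k] that(3) unfolding e'_def abs_mult by (simp add: mult_nonneg_nonneg)
  qed
  \<comment> \<open>A majorant of the differentiated series for entries up to half the radius: the
    power of 2 gained by halving outweighs the factor \<open>k + 2\<close> from
    differentiation.\<close>
  define \<beta> where "\<beta> k = C k * real (k + 2) * (\<rho> / 2) ^ (k + 1)" for k
  have \<beta>: "summable \<beta>"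
  proof (rule summable_comparison_test')
    show "summable (\<lambda>k. (C k * \<rho> ^ (k + 2)) / \<rho>)"
      using summ by (intro summable_divide) (simp add: C_def)
    fix k :: nat
    have "k + 2 \<le> 2 ^ (k + 1)" by (induction k) auto
    then have "real (k + 2) \<le> 2 ^ (k + 1)" by (metis of_nat_le_iff of_nat_numeral of_nat_power)
    then have "real (k + 2) * (\<rho> / 2) ^ (k + 1) \<le> 2 ^ (k + 1) * (\<rho> / 2) ^ (k + 1)"
      using \<rho> by (intro mult_right_mono) auto
    also have "\<dots> = \<rho> ^ (k + 1)" by (simp flip: power_mult_distrib)
    finally have "C k * (real (k + 2) * (\<rho> / 2) ^ (k + 1)) \<le> C k * \<rho> ^ (k + 1)"
      using C0 by (intro mult_left_mono)
    moreover have "0 \<le> \<beta> k" using C0[of k] \<rho> by (simp add: \<beta>_def)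
    ultimately show "norm (\<beta> k) \<le> (C k * \<rho> ^ (k + 2)) / \<rho>"
      using \<rho> by (simp add: \<beta>_def mult.assoc)
  qed
  have grad: "grad n E x $ i = (\<Sum>k. e' k x)" and summ_e': "summable (\<lambda>k. e' k x)"
    if x: "x \<in> carrier_vec n" and small: "vnorm x < \<rho> / 4" for x
  proof -
    let ?y = "\<lambda>t. x + t \<cdot>\<^sub>v unit_vec n i"
    \<comment> \<open>A point of norm below \<rho>/4, moved by less than \<rho>/4 along one axis,
      keeps its entries below \<rho>/2, where the majorant applies.\<close>
    let ?S = "ball (0::real) (\<rho> / 4)"
    have y: "?y t \<in> carrier_vec n" for t using x by simp
    have yj: "\<bar>?y t $ j\<bar> \<le> \<rho> / 2" if "t \<in> ?S" "j < n" for t j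
    proof -
      have "\<bar>x $ j\<bar> < \<rho> / 4" using abs_index_le_vnorm[of j x] small x that by force
      moreover have "\<bar>if j = i then t else 0\<bar> < \<rho> / 4" using that \<rho> by (simp add: dist_real_def)
      moreover have "?y t $ j = x $ j + (if j = i then t else 0)" using x that i by simp
      ultimately show ?thesis by linarith
    qed
    have Ey: "(\<lambda>k. e k (?y t)) sums E (?y t)" if "t \<in> ?S" for t
      unfolding e_def using yj[OF that] \<rho> by (intro sums y) force
    have unif: "uniformly_convergent_on ?S (\<lambda>m t. \<Sum>k<m. e' k (?y t))"
    proof (rule Weierstrass_m_test'[OF _ \<beta>])
      fix k t assume "t \<in> ?S"
      then show "norm (e' k (?y t)) \<le> \<beta> k"
        unfolding \<beta>_def real_norm_def using \<rho> yj by (intro e'_le y) auto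
    qed
    have "((\<lambda>t. \<Sum>k. e k (?y t)) has_field_derivative (\<Sum>k. e' k (?y 0))) (at 0)"
    proof (rule has_field_derivative_series'(2)[OF _ _ unif])
      show "(0::real) \<in> ?S" "0 \<in> interior ?S" using \<rho> by (auto simp: interior_open)
      show "summable (\<lambda>k. e k (?y 0))" using Ey[of 0] \<rho> by (simp add: sums_iff)
    qed (auto intro!: has_field_derivative_at_within e_deriv x)
    then have "((\<lambda>t. E (?y t)) has_field_derivative (\<Sum>k. e' k (?y 0))) (at 0)"
      by (rule has_field_derivative_transform_within_open[of _ _ _ ?S]) (use Ey \<rho> in \<open>auto simp: sums_iff\<close>)
    moreover have "?y 0 = x" using x by auto
    ultimately show "grad n E x $ i = (\<Sum>k. e' k x)"
      using i by (simp add: grad_def DERIV_imp_deriv)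
    show "summable (\<lambda>k. e' k x)"
    proof (rule summable_comparison_test'[OF \<beta>])
      fix k
      show "norm (e' k x) \<le> \<beta> k"
        unfolding \<beta>_def real_norm_def using e'_le[OF x, of "\<rho> / 2" k] yj[of 0] x \<rho> by simp
    qed
  qed
  have first: "e' 0 x = (V *\<^sub>v x) $ i" if x: "x \<in> carrier_vec n" for x
  proof -
    have n: "0 < n" using i by simp
    have k1: "kron_pow x 1 $ a = x $ a" if "a < n" for a
      using index_kron_pow_Suc[OF x, of a 0] that by (simp add: index_kron_pow_0)
    have bnd: "p * n + q < n * n" if "p < n" "q < n" for p q
    proof -
      have "Suc p * n \<le> n * n" using that by (intro mult_right_mono) auto
      then show ?thesis using that by auto
    qed
    have d2: "kron_pow_deriv n i 2 (p * n + q) x = (if p = i then x $ q else 0) + (if q = i then x $ p else 0)"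
      if "p < n" "q < n" for p q
      using that k1 by (simp add: numeral_2_eq_2 index_kron_pow_0)
    \<comment> \<open>Column stacking places entry \<open>(q, p)\<close> at position
      \<open>p * n + q\<close>.\<close>
    have c2: "c 2 $ (p * n + q) = V $$ (q, p)" if "p < n" "q < n" for p q
      using V that bnd[OF that] by (simp add: v2[symmetric] vec_of_mat_def)
    have "e' 0 x = 1/2 * (\<Sum>a<n * n. c 2 $ a * kron_pow_deriv n i 2 a x)"
      by (simp add: e'_def power2_eq_square numeral_2_eq_2)
    also have "(\<Sum>a<n * n. c 2 $ a * kron_pow_deriv n i 2 a x)
        = (\<Sum>p<n. \<Sum>q<n. c 2 $ (p * n + q) * kron_pow_deriv n i 2 (p * n + q) x)"
      by (rule sum_div_mod)
    also have "\<dots> = (\<Sum>p<n. \<Sum>q<n. V $$ (q, p) * ((if p = i then x $ q else 0) + (if q = i then x $ p else 0)))"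
      by (intro sum.cong refl) (simp only: c2 d2 lessThan_iff)
    also have "\<dots> = (\<Sum>p<n. \<Sum>q<n. if p = i then V $$ (q, p) * x $ q else 0)
        + (\<Sum>p<n. \<Sum>q<n. if q = i then V $$ (q, p) * x $ p else 0)"
      unfolding sum.distrib[symmetric] by (intro sum.cong refl) (simp add: algebra_simps)
    also have "(\<Sum>p<n. \<Sum>q<n. if p = i then V $$ (q, p) * x $ q else 0) = (\<Sum>q<n. V $$ (q, i) * x $ q)"
      using i by (subst sum.swap) simp
    also have "(\<Sum>p<n. \<Sum>q<n. if q = i then V $$ (q, p) * x $ p else 0) = (\<Sum>p<n. V $$ (i, p) * x $ p)"
      using i by simp
    \<comment> \<open>Symmetry of \<open>V\<close> makes the two partial sums equal, and together
      they cancel the factor 1/2 of the energy expansion.\<close>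
    also have "(\<Sum>q<n. V $$ (q, i) * x $ q) = (\<Sum>q<n. V $$ (i, q) * x $ q)"
    proof (intro sum.cong refl)
      fix q assume "q \<in> {..<n}"
      then show "V $$ (q, i) * x $ q = V $$ (i, q) * x $ q"
        using arg_cong[OF V(2), of "\<lambda>A. A $$ (i, q)"] V(1) i by simp
    qed
    finally show ?thesis using i V(1) x by (simp add: scalar_prod_def atLeast0LessThan)
  qed
  \<comment> \<open>The majorant of the tail after removing two powers of \<rho>/2. In the estimate
    below their place is taken by the squared norm of \<open>x\<close>, so the sum of \<kappa> is
    the Landau constant.\<close>
  define \<kappa> where "\<kappa> k = C (Suc k) * real (Suc k + 2) * (\<rho> / 2) ^ k" for k
  have \<kappa>: "summable \<kappa>"
  proof -
    have "summable (\<lambda>k. \<beta> (Suc k) / (\<rho> / 2)\<^sup>2)"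
      using \<beta> summable_Suc_iff[of \<beta>] by (intro summable_divide) simp
    moreover have "\<beta> (Suc k) / (\<rho> / 2)\<^sup>2 = \<kappa> k" for k
      using \<rho> by (simp add: \<beta>_def \<kappa>_def power2_eq_square)
    ultimately show ?thesis by simp
  qed
  show ?thesis
  proof (rule bigoI[of _ "suminf \<kappa>"], unfold eventually_near_origin, intro exI[of _ "\<rho> / 4"] conjI ballI impI)
    show "0 < \<rho> / 4" using \<rho> by simp
    fix x :: "real vec" assume x: "x \<in> carrier_vec n" and small: "vnorm x < \<rho> / 4"
    have "grad n E x $ i - (V *\<^sub>v x) $ i = (\<Sum>k. e' (Suc k) x)"
      using suminf_split_head[OF summ_e'[OF x small]] by (simp add: grad[OF x small] first[OF x])
    moreover have "\<bar>\<Sum>k. e' (Suc k) x\<bar> \<le> (\<Sum>k. \<kappa> k * (vnorm x)\<^sup>2)"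
    proof -
      have le: "norm (e' (Suc k) x) \<le> \<kappa> k * (vnorm x)\<^sup>2" for k
      proof -
        have "\<bar>e' (Suc k) x\<bar> \<le> C (Suc k) * real (Suc k + 2) * vnorm x ^ (Suc k + 1)"
          using abs_index_le_vnorm[of _ x] x by (intro e'_le x) auto
        also have "vnorm x ^ (Suc k + 1) = vnorm x ^ k * (vnorm x)\<^sup>2" by (simp add: power2_eq_square)
        also have "C (Suc k) * real (Suc k + 2) * (vnorm x ^ k * (vnorm x)\<^sup>2)
            \<le> C (Suc k) * real (Suc k + 2) * ((\<rho> / 2) ^ k * (vnorm x)\<^sup>2)"
          using small C0 \<rho> by (intro mult_left_mono mult_right_mono power_mono) auto
        finally show ?thesis by (simp add: \<kappa>_def mult.assoc)
      qed
      from norm_suminf_le[OF le summable_mult2[OF \<kappa>]] show ?thesis by simp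
    qed
    moreover have "(\<Sum>k. \<kappa> k * (vnorm x)\<^sup>2) = suminf \<kappa> * (vnorm x)\<^sup>2"
      by (rule suminf_mult2[OF \<kappa>, symmetric])
    ultimately show "norm (grad n E x $ i - (V *\<^sub>v x) $ i) \<le> suminf \<kappa> * norm (vnorm x ^ 2)" by simp
  qed
qed

section \<open>First-order expansion of the closed-loop vector field\<close>

lemma vsum_index:
  assumes "finite I" "i < N" "\<And>k. k \<in> I \<Longrightarrow> h k \<in> carrier_vec N"
  shows "vsum N I h $ i = (\<Sum>k\<in>I. h k $ i)"
  unfolding vsum_def by (rule index_finsum_vec) (use assms in auto)

lemma vsum_carrier:
  assumes "\<And>k. k \<in> I \<Longrightarrow> h k \<in> carrier_vec N"
  shows "vsum N I h \<in> carrier_vec N"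
  unfolding vsum_def by (rule finsum_vec_closed) (use assms in auto)

lemma kron_pow_bigo:
  assumes "j \<le> k" "a < n ^ k"
  shows "(\<lambda>x. kron_pow x k $ a) \<in> O[near_origin n](\<lambda>x. vnorm x ^ j)"
proof (rule landau_o.big_trans[OF near_origin_bigoI[of n _ 1 k] vnorm_power_bigo[OF assms(1)]])
  fix x :: "real vec" assume x: "x \<in> carrier_vec n"
  show "\<bar>kron_pow x k $ a\<bar> \<le> 1 * vnorm x ^ k"
    using abs_kron_pow_le[OF x _ assms(2), of "vnorm x"] abs_index_le_vnorm[of _ x] x by simp
qed

lemma drift_bigo:
  assumes A: "A \<in> carrier_mat n n" and F: "\<And>p. 2 \<le> p \<Longrightarrow> F p \<in> carrier_mat n (n ^ p)" and i: "i < n"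
  shows "(\<lambda>x. drift n l A F x $ i - (A *\<^sub>v x) $ i) \<in> O[near_origin n](\<lambda>x. vnorm x ^ 2)"
proof -
  have "drift n l A F x $ i - (A *\<^sub>v x) $ i = (\<Sum>p\<in>{2..l}. \<Sum>a<n ^ p. F p $$ (i, a) * kron_pow x p $ a)"
    if x: "x \<in> carrier_vec n" for x
  proof -
    have Fx: "F p *\<^sub>v kron_pow x p \<in> carrier_vec n" if "p \<in> {2..l}" for p
      using that F[of p] kron_pow_carrier[OF x] by (intro mult_mat_vec_carrier) auto
    have "(F p *\<^sub>v kron_pow x p) $ i = (\<Sum>a<n ^ p. F p $$ (i, a) * kron_pow x p $ a)" if "p \<in> {2..l}" for p
      using that F[of p] dim_kron_pow[OF x] i by (simp add: scalar_prod_def atLeast0LessThan)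
    moreover have "vsum n {2..l} (\<lambda>p. F p *\<^sub>v kron_pow x p) \<in> carrier_vec n"
      by (rule vsum_carrier[OF Fx])
    moreover have "vsum n {2..l} (\<lambda>p. F p *\<^sub>v kron_pow x p) $ i = (\<Sum>p\<in>{2..l}. (F p *\<^sub>v kron_pow x p) $ i)"
      by (rule vsum_index[OF _ i Fx]) simp_all
    ultimately show ?thesis
      using i by (simp add: drift_def)
  qed
  then show ?thesis
    by (subst near_origin_bigo_cong)
      (auto intro!: big_sum_in_bigo landau_o.big.cmult_in_iff'[THEN iffD2] kron_pow_bigo)
qed

lemma input_map_carrier: "input_map n m l B G x \<in> carrier_mat n m"
  by (simp add: input_map_def)

text \<open>Row \<open>b\<close> of the Kronecker product with the identity carries entry
  \<open>b div m\<close> of the Kronecker power in column \<open>b mod m\<close> and zeros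
  elsewhere. Since \<open>p\<close> is at least 1, each such entry is of first order.\<close>

lemma input_map_bigo:
  assumes G: "\<And>p. 1 \<le> p \<Longrightarrow> G p \<in> carrier_mat n (m * n ^ p)" and i: "i < n" and s: "s < m"
  shows "(\<lambda>x. input_map n m l B G x $$ (i, s) - B $$ (i, s)) \<in> O[near_origin n](\<lambda>x. vnorm x ^ 1)"
proof -
  have "input_map n m l B G x $$ (i, s) - B $$ (i, s)
      = (\<Sum>p\<in>{1..l}. \<Sum>b<n ^ p * m. G p $$ (i, b) * (1\<^sub>m m $$ (b mod m, s) * kron_pow x p $ (b div m)))"
    if x: "x \<in> carrier_vec n" for x
  proof -
    have "(G p * (col_mat (kron_pow x p) \<otimes>\<^sub>m 1\<^sub>m m)) $$ (i, s)
        = (\<Sum>b<n ^ p * m. G p $$ (i, b) * (1\<^sub>m m $$ (b mod m, s) * kron_pow x p $ (b div m)))"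
      if p: "p \<in> {1..l}" for p
    proof -
      have K: "col_mat (kron_pow x p) \<in> carrier_mat (n ^ p) 1"
        using dim_kron_pow[OF x] by (auto simp: col_mat_def mat_of_cols_def)
      have "(G p * (col_mat (kron_pow x p) \<otimes>\<^sub>m 1\<^sub>m m)) $$ (i, s)
        = (\<Sum>b<n ^ p * m. G p $$ (i, b) * (col_mat (kron_pow x p) \<otimes>\<^sub>m 1\<^sub>m m) $$ (b, s))"
        using p i s G[of p] K by (simp add: scalar_prod_def atLeast0LessThan mult.commute)
      also have "\<dots> = (\<Sum>b<n ^ p * m. G p $$ (i, b) * (1\<^sub>m m $$ (b mod m, s) * kron_pow x p $ (b div m)))"
      proof (intro sum.cong refl arg_cong[of _ _ "\<lambda>t. _ * t"])
        fix b assume "b \<in> {..<n ^ p * m}"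
        then have b: "b < n ^ p * m" by simp
        show "(col_mat (kron_pow x p) \<otimes>\<^sub>m 1\<^sub>m m) $$ (b, s) = 1\<^sub>m m $$ (b mod m, s) * kron_pow x p $ (b div m)"
          using b s K div_mod_bounds[OF b] dim_kron_pow[OF x, of p]
          by (simp add: index_kron col_mat_def mat_of_cols_def)
      qed
      finally show ?thesis .
    qed
    then show ?thesis using i s by (simp add: input_map_def)
  qed
  then show ?thesis
    by (subst near_origin_bigo_cong)
      (auto intro!: big_sum_in_bigo landau_o.big.cmult_in_iff'[THEN iffD2] landau_o.big.mult_in_1
        kron_pow_bigo[where j = 1, simplified] div_mod_bounds(1) simp: div_mod_bounds)
qed

lemma mult_mat_vec_bigo:
  assumes V: "V \<in> carrier_mat n' n" and i: "i < n'"
  shows "(\<lambda>x. (V *\<^sub>v x) $ i) \<in> O[near_origin n](\<lambda>x. vnorm x ^ 1)"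
proof -
  have "(V *\<^sub>v x) $ i = (\<Sum>j<n. V $$ (i, j) * x $ j)" if "x \<in> carrier_vec n" for x
    using that V i by (simp add: scalar_prod_def atLeast0LessThan)
  moreover have "(\<lambda>x. x $ j) \<in> O[near_origin n](\<lambda>x. vnorm x ^ 1)" if "j < n" for j
    by (rule near_origin_bigoI[of n _ 1]) (use that abs_index_le_vnorm in auto)
  ultimately show ?thesis
    by (subst near_origin_bigo_cong)
      (auto intro!: big_sum_in_bigo landau_o.big.cmult_in_iff'[THEN iffD2])
qed

text \<open>Two passes through \<open>bigo_mult_diff\<close>, first for the inner product with the
  transpose of \<open>g x\<close>, then for the outer one. Knowing \<open>g\<close> up to first
  order is enough because \<open>w\<close> itself vanishes to first order.\<close>

lemma feedback_bigo:
  assumes B: "B \<in> carrier_mat n m" and V: "V \<in> carrier_mat n n"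
    and g: "\<And>x. g x \<in> carrier_mat n m"
    and gB: "\<And>i s. i < n \<Longrightarrow> s < m \<Longrightarrow>
        (\<lambda>x. g x $$ (i, s) - B $$ (i, s)) \<in> O[near_origin n](\<lambda>x. vnorm x ^ 1)"
    and w: "\<And>x. w x \<in> carrier_vec n"
    and wV: "\<And>i. i < n \<Longrightarrow> (\<lambda>x. w x $ i - (V *\<^sub>v x) $ i) \<in> O[near_origin n](\<lambda>x. vnorm x ^ 2)"
    and i: "i < n"
  shows "(\<lambda>x. (g x *\<^sub>v ((g x)\<^sup>T *\<^sub>v w x)) $ i - ((B * B\<^sup>T * V) *\<^sub>v x) $ i)
    \<in> O[near_origin n](\<lambda>x. vnorm x ^ 2)"
proof -
  have const: "(\<lambda>x. c) \<in> O[near_origin n](\<lambda>x. vnorm x ^ 0)" for c :: real by simp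
  have inner: "(\<lambda>x. (\<Sum>k<n. g x $$ (k, s) * w x $ k) - (\<Sum>k<n. B $$ (k, s) * (V *\<^sub>v x) $ k))
      \<in> O[near_origin n](\<lambda>x. vnorm x ^ 2)" if "s < m" for s
    unfolding sum_subtractf[symmetric] using that
    by (intro big_sum_in_bigo bigo_mult_diff gB const wV mult_mat_vec_bigo[OF V]) auto
  have inner': "(\<lambda>x. \<Sum>k<n. B $$ (k, s) * (V *\<^sub>v x) $ k) \<in> O[near_origin n](\<lambda>x. vnorm x ^ 1)" for s
    by (intro big_sum_in_bigo landau_o.big.cmult_in_iff'[THEN iffD2])
      (use mult_mat_vec_bigo[OF V] in auto)
  have "(\<lambda>x. (\<Sum>s<m. g x $$ (i, s) * (\<Sum>k<n. g x $$ (k, s) * w x $ k))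
      - (\<Sum>s<m. B $$ (i, s) * (\<Sum>k<n. B $$ (k, s) * (V *\<^sub>v x) $ k))) \<in> O[near_origin n](\<lambda>x. vnorm x ^ 2)"
    unfolding sum_subtractf[symmetric]
    by (intro big_sum_in_bigo bigo_mult_diff gB i const inner inner') auto
  moreover have "(g x *\<^sub>v ((g x)\<^sup>T *\<^sub>v w x)) $ i = (\<Sum>s<m. g x $$ (i, s) * (\<Sum>k<n. g x $$ (k, s) * w x $ k))" for x
    using g[of x] w[of x] i by (simp add: scalar_prod_def atLeast0LessThan)
  moreover have "((B * B\<^sup>T * V) *\<^sub>v x) $ i = (\<Sum>s<m. B $$ (i, s) * (\<Sum>k<n. B $$ (k, s) * (V *\<^sub>v x) $ k))"
    if x: "x \<in> carrier_vec n" for x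
  proof -
    have "(B * B\<^sup>T * V) *\<^sub>v x = B *\<^sub>v (B\<^sup>T *\<^sub>v (V *\<^sub>v x))"
    proof -
      have "(B * B\<^sup>T * V) *\<^sub>v x = (B * B\<^sup>T) *\<^sub>v (V *\<^sub>v x)"
        by (rule assoc_mult_mat_vec[of _ n n _ n]) (use B V x in auto)
      also have "\<dots> = B *\<^sub>v (B\<^sup>T *\<^sub>v (V *\<^sub>v x))"
        by (rule assoc_mult_mat_vec[of _ n m _ n]) (use B V x in auto)
      finally show ?thesis .
    qed
    then show ?thesis using B V x i by (simp add: scalar_prod_def[of _ "V *\<^sub>v x"] scalar_prod_def[of _ "B\<^sup>T *\<^sub>v (V *\<^sub>v x)"] atLeast0LessThan)
  qed
  ultimately show ?thesis by (subst near_origin_bigo_cong) auto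
qed

lemma bigo_square_smallo:
  assumes h: "h \<in> O[near_origin n](\<lambda>x. vnorm x ^ 2)" and c: "0 < c"
  shows "eventually (\<lambda>x. \<bar>h x\<bar> \<le> c * vnorm x) (near_origin n)"
proof -
  obtain K where K: "0 < K" "eventually (\<lambda>x. norm (h x) \<le> K * norm (vnorm x ^ 2)) (near_origin n)"
    using h by (rule landau_o.bigE)
  have "eventually (\<lambda>x. vnorm x < c / K) (near_origin n)"
    unfolding eventually_near_origin using K c by (intro exI[of _ "c / K"]) auto
  with K(2) show ?thesis
  proof eventually_elim
    case (elim x)
    have "K * (vnorm x)\<^sup>2 = (K * vnorm x) * vnorm x" by (simp add: power2_eq_square)
    also have "\<dots> \<le> c * vnorm x"
      using elim(2) K(1) by (intro mult_right_mono) (auto simp: field_simps)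
    finally show ?case using elim(1) by simp
  qed
qed

lemma mult_mat_vec_lincomb:
  fixes P Q :: "'a::comm_ring_1 mat"
  assumes "P \<in> carrier_mat n n'" "Q \<in> carrier_mat n n'" "x \<in> carrier_vec n'" "i < n"
  shows "((a \<cdot>\<^sub>m P + b \<cdot>\<^sub>m Q) *\<^sub>v x) $ i = a * (P *\<^sub>v x) $ i + b * (Q *\<^sub>v x) $ i"
  using assms by (simp add: scalar_prod_def sum_distrib_left sum.distrib algebra_simps)

text \<open>The scalars \<open>a\<close> and \<open>b\<close> cover the past loop, which runs
  against the drift, as well as the future loop. In both cases the vector field differs from its
  linear part by a quadratic error, so the instability criterion applies.\<close>

lemma closed_loop_eigenvalue_Re_le_0:
  assumes A: "A \<in> carrier_mat n n" and B: "B \<in> carrier_mat n m" and V: "V \<in> carrier_mat n n" "V\<^sup>T = V"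
    and F: "\<And>p. 2 \<le> p \<Longrightarrow> F p \<in> carrier_mat n (n ^ p)"
    and G: "\<And>p. 1 \<le> p \<Longrightarrow> G p \<in> carrier_mat n (m * n ^ p)"
    and f: "f = drift n l A F" and g: "g = input_map n m l B G"
    and E: "energy_expansion n d E v" "2 \<le> d" "v 2 = vec_of_mat V"
    and stab: "asymptotically_stable n \<phi>"
    and \<phi>: "\<And>x i. x \<in> carrier_vec n \<Longrightarrow> i < n \<Longrightarrow>
        \<phi> x $ i = a * f x $ i + b * (g x *\<^sub>v ((g x)\<^sup>T *\<^sub>v grad n E x)) $ i"
    and ev: "eigenvalue (cmat (a \<cdot>\<^sub>m A + b \<cdot>\<^sub>m (B * B\<^sup>T * V))) \<mu>"
  shows "Re \<mu> \<le> 0"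
proof (rule asymptotically_stable_eigenvalue_Re_le_0[OF _ stab _ ev])
  let ?M = "a \<cdot>\<^sub>m A + b \<cdot>\<^sub>m (B * B\<^sup>T * V)"
  have BV: "B * B\<^sup>T * V \<in> carrier_mat n n" using B V by auto
  then show "?M \<in> carrier_mat n n" by auto
  have comp: "(\<lambda>x. \<phi> x $ i - (?M *\<^sub>v x) $ i) \<in> O[near_origin n](\<lambda>x. vnorm x ^ 2)" if i: "i < n" for i
  proof -
    have 1: "(\<lambda>x. f x $ i - (A *\<^sub>v x) $ i) \<in> O[near_origin n](\<lambda>x. vnorm x ^ 2)"
      unfolding f by (rule drift_bigo[OF A F i])
    have 2: "(\<lambda>x. (g x *\<^sub>v ((g x)\<^sup>T *\<^sub>v grad n E x)) $ i - ((B * B\<^sup>T * V) *\<^sub>v x) $ i) \<in> O[near_origin n](\<lambda>x. vnorm x ^ 2)"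
      unfolding g
      by (intro feedback_bigo[OF B V(1)] input_map_carrier input_map_bigo G grad_energy_bigo[OF E(1,2) V E(3)] i)
        (auto simp: grad_def)
    have "(\<lambda>x. a * (f x $ i - (A *\<^sub>v x) $ i) + b * ((g x *\<^sub>v ((g x)\<^sup>T *\<^sub>v grad n E x)) $ i - ((B * B\<^sup>T * V) *\<^sub>v x) $ i))
      \<in> O[near_origin n](\<lambda>x. vnorm x ^ 2)"
      by (intro sum_in_bigo(1) landau_o.big.cmult_in_iff'[THEN iffD2]) (use 1 2 in auto)
    moreover have "(?M *\<^sub>v x) $ i = a * (A *\<^sub>v x) $ i + b * ((B * B\<^sup>T * V) *\<^sub>v x) $ i" if x: "x \<in> carrier_vec n" for x
      by (rule mult_mat_vec_lincomb[OF A BV x i])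
    ultimately show ?thesis
      by (subst near_origin_bigo_cong) (auto simp: \<phi> i algebra_simps)
  qed
  fix c :: real assume "0 < c"
  then have "eventually (\<lambda>x. \<forall>i\<in>{..<n}. \<bar>\<phi> x $ i - (?M *\<^sub>v x) $ i\<bar> \<le> c * vnorm x) (near_origin n)"
    by (intro eventually_ball_finite bigo_square_smallo comp ballI) auto
  then show "\<exists>\<delta>>0. \<forall>x\<in>carrier_vec n. vnorm x < \<delta> \<longrightarrow> (\<forall>i<n. \<bar>\<phi> x $ i - (?M *\<^sub>v x) $ i\<bar> \<le> c * vnorm x)"
    unfolding eventually_near_origin by (simp add: Ball_def)
qed

section \<open>Imaginary modes and the H-infinity level\<close>

lemma spectral_norm_bound:
  assumes "w \<in> carrier_vec (dim_col T)" and g: "spectral_norm T \<le> ereal g"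
  shows "vnorm (T *\<^sub>v w) \<le> g * vnorm w"
proof (cases "vnorm w = 0")
  case True
  then have "w = 0\<^sub>v (dim_col T)" using assms(1) by (simp add: vnorm_eq_0_iff)
  then have "T *\<^sub>v w = 0\<^sub>v (dim_row T)" by (intro eq_vecI) auto
  then have "vnorm (T *\<^sub>v w) = 0" by (simp add: vnorm_eq_0_iff)
  then show ?thesis using True by simp
next
  case False
  then have pos: "0 < vnorm w" using vnorm_nonneg[of w] by linarith
  let ?c = "complex_of_real (1 / vnorm w)"
  have nc: "norm ?c = 1 / vnorm w" using pos by (simp add: norm_divide)
  have "vnorm (?c \<cdot>\<^sub>v w) \<le> 1" unfolding vnorm_smult nc using pos by simp
  then have "ereal (vnorm (T *\<^sub>v (?c \<cdot>\<^sub>v w))) \<le> spectral_norm T"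
    unfolding spectral_norm_def using assms(1) by (intro SUP_upper) auto
  also have "T *\<^sub>v (?c \<cdot>\<^sub>v w) = ?c \<cdot>\<^sub>v (T *\<^sub>v w)"
    using assms(1) by (intro mult_mat_vec[of _ "dim_row T" "dim_col T"]) auto
  finally have "vnorm (T *\<^sub>v w) / vnorm w \<le> g"
    using g unfolding vnorm_smult nc by (metis ereal_less_eq(3) mult_1 order_trans times_divide_eq_left)
  then show ?thesis using pos by (simp add: divide_le_eq)
qed

text \<open>The hypothesis \<open>eq\<close> says that \<open>p\<close> is the steady-state response
  to \<open>w\<close> at frequency \<omega>, so the output is the transfer matrix applied to
  \<open>w\<close>. Working with such pairs avoids computing the transfer matrix of a closed
  loop.\<close>

lemma hinf_norm_gain:
  assumes dims: "A \<in> carrier_mat N N" "B \<in> carrier_mat N q" "C \<in> carrier_mat s N" "D \<in> carrier_mat s q"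
    and hur: "hurwitz A" and norm: "hinf_norm A B C D \<le> ereal g"
    and p: "p \<in> carrier_vec N" and w: "w \<in> carrier_vec q"
    and eq: "cmat A *\<^sub>v p + cmat B *\<^sub>v w = (\<i> * complex_of_real \<omega>) \<cdot>\<^sub>v p"
  shows "vnorm (cmat C *\<^sub>v p + cmat D *\<^sub>v w) \<le> g * vnorm w"
proof -
  let ?s = "\<i> * complex_of_real \<omega>"
  let ?P = "?s \<cdot>\<^sub>m 1\<^sub>m N - cmat A"
  have P: "?P \<in> carrier_mat N N" using dims by auto
  have Pz: "?P *\<^sub>v z = ?s \<cdot>\<^sub>v z - cmat A *\<^sub>v z" if z: "z \<in> carrier_vec N" for z
  proof -
    have "(?s \<cdot>\<^sub>m 1\<^sub>m N) *\<^sub>v z = ?s \<cdot>\<^sub>v z" using z by (intro eq_vecI) auto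
    then show ?thesis using z dims by (simp add: minus_mult_distrib_mat_vec[of _ N N])
  qed
  have "z = 0\<^sub>v N" if z: "z \<in> carrier_vec N" "?P *\<^sub>v z = 0\<^sub>v N" for z
  proof (rule ccontr)
    assume "z \<noteq> 0\<^sub>v N"
    moreover have "cmat A *\<^sub>v z = ?s \<cdot>\<^sub>v z"
    proof (rule eq_vecI, goal_cases)
      case (1 i)
      then show ?case using arg_cong[OF z(2)[unfolded Pz[OF z(1)]], of "\<lambda>u. u $ i"] z(1) dims by simp
    qed (use dims z in auto)
    ultimately have "eigenvalue (cmat A) ?s"
      using dims z(1) by (auto simp: eigenvalue_def eigenvector_def)
    then show False using hur by (force simp: hurwitz_def)
  qed
  \<comment> \<open>A Hurwitz matrix has no eigenvalue on the imaginary axis; hence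
    \<open>mat_inverse\<close> succeeds and the \<open>the\<close> in \<open>transfer\<close>
    denotes the resolvent.\<close>
  then have "det ?P \<noteq> 0" by (auto simp: det_0_iff_vec_prod_zero_field[OF P])
  then have "?P \<in> Units (ring_mat TYPE(complex) N ())" by (rule det_non_zero_imp_unit[OF P])
  then obtain R where R: "mat_inverse ?P = Some R"
    using mat_inverse(1)[OF P, of "()"] by (cases "mat_inverse ?P") auto
  note RP = mat_inverse(2)[OF P R]
  let ?T = "transfer A B C D ?s"
  have T: "?T = cmat C * R * cmat B + cmat D" using R dims by (simp add: transfer_def)
  have "?P *\<^sub>v p = cmat B *\<^sub>v w"
    unfolding Pz[OF p] eq[symmetric] using dims p w by (intro eq_vecI) auto
  then have "R *\<^sub>v (cmat B *\<^sub>v w) = R *\<^sub>v (?P *\<^sub>v p)" by simp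
  also have "\<dots> = (R * ?P) *\<^sub>v p" using RP P p by (intro assoc_mult_mat_vec[symmetric]) auto
  also have "\<dots> = p" using RP p by simp
  finally have Rp: "R *\<^sub>v (cmat B *\<^sub>v w) = p" .
  have "?T *\<^sub>v w = (cmat C * R * cmat B) *\<^sub>v w + cmat D *\<^sub>v w"
    unfolding T using dims RP w by (intro add_mult_distrib_mat_vec[of _ s q]) auto
  also have "(cmat C * R * cmat B) *\<^sub>v w = (cmat C * R) *\<^sub>v (cmat B *\<^sub>v w)"
    using dims RP w by (intro assoc_mult_mat_vec[of _ s N _ q]) auto
  also have "\<dots> = cmat C *\<^sub>v (R *\<^sub>v (cmat B *\<^sub>v w))"
    using dims RP w by (intro assoc_mult_mat_vec[of _ s N _ N]) auto
  finally have Tw: "?T *\<^sub>v w = cmat C *\<^sub>v p + cmat D *\<^sub>v w" by (simp only: Rp)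
  have "spectral_norm ?T \<le> hinf_norm A B C D" unfolding hinf_norm_def by (rule SUP_upper) simp
  then have "spectral_norm ?T \<le> ereal g" using norm by (rule order_trans)
  then show ?thesis unfolding Tw[symmetric] using w dims by (intro spectral_norm_bound) (auto simp: T)
qed

section \<open>Plant and controller in closed loop at one frequency\<close>

lemma vnorm_append_power2: "(vnorm (a @\<^sub>v b))\<^sup>2 = (vnorm a)\<^sup>2 + (vnorm b)\<^sup>2"
proof -
  have split: "(\<Sum>i<p + q. h i) = (\<Sum>i<p. h i) + (\<Sum>i<q. h (p + i))" for p q and h :: "nat \<Rightarrow> real"
    by (induction q) (simp_all add: add.assoc)
  have "(vnorm (a @\<^sub>v b))\<^sup>2 = (\<Sum>i<dim_vec a + dim_vec b. (norm ((a @\<^sub>v b) $ i))\<^sup>2)"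
    by (simp add: vnorm_power2)
  also have "\<dots> = (\<Sum>i<dim_vec a. (norm ((a @\<^sub>v b) $ i))\<^sup>2) + (\<Sum>i<dim_vec b. (norm ((a @\<^sub>v b) $ (dim_vec a + i)))\<^sup>2)"
    by (rule split)
  also have "\<dots> = (vnorm a)\<^sup>2 + (vnorm b)\<^sup>2" by (simp add: vnorm_power2)
  finally show ?thesis .
qed

lemma cmat_mult:
  assumes "M \<in> carrier_mat a b" "N \<in> carrier_mat b c"
  shows "cmat (M * N) = cmat M * cmat N"
  using of_real_hom.mat_hom_mult[OF assms] by simp

text \<open>A plant mode driven by an arbitrary input \<open>u\<^sub>t\<close> becomes a closed-loop
  response once the mismatch between \<open>u\<^sub>t\<close> and the controller output
  \<open>u\<close> is declared a disturbance at the plant input. The gain bound then compares the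
  output \<open>(C x, u)\<close> with this mismatch.\<close>

lemma closed_loop_response:
  fixes A B C AK BK CK DK :: "real mat" and x \<xi> u\<^sub>t :: "complex vec"
  assumes dims: "A \<in> carrier_mat n n" "B \<in> carrier_mat n m" "C \<in> carrier_mat r n"
      "AK \<in> carrier_mat k k" "BK \<in> carrier_mat k r" "CK \<in> carrier_mat m k" "DK \<in> carrier_mat m r"
    and hur: "hurwitz (cl_A A B C AK BK CK DK)"
    and norm: "hinf_norm (cl_A A B C AK BK CK DK) (cl_B B BK DK) (cl_C C CK DK) (cl_D DK) \<le> ereal g"
    and vecs: "x \<in> carrier_vec n" "\<xi> \<in> carrier_vec k" "u\<^sub>t \<in> carrier_vec m"
    and plant: "cmat A *\<^sub>v x + cmat B *\<^sub>v u\<^sub>t = (\<i> * complex_of_real \<omega>) \<cdot>\<^sub>v x"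
    and controller: "cmat BK *\<^sub>v (cmat C *\<^sub>v x) + cmat AK *\<^sub>v \<xi> = (\<i> * complex_of_real \<omega>) \<cdot>\<^sub>v \<xi>"
  defines "u \<equiv> cmat DK *\<^sub>v (cmat C *\<^sub>v x) + cmat CK *\<^sub>v \<xi>"
  shows "(vnorm (cmat C *\<^sub>v x))\<^sup>2 + (vnorm u)\<^sup>2 \<le> (g * vnorm (u\<^sub>t - u))\<^sup>2"
    and "u\<^sub>t = u \<Longrightarrow> x = 0\<^sub>v n \<and> \<xi> = 0\<^sub>v k"
proof -
  let ?s = "\<i> * complex_of_real \<omega>"
  let ?A = "cmat A" and ?B = "cmat B" and ?C = "cmat C"
    and ?AK = "cmat AK" and ?BK = "cmat BK" and ?CK = "cmat CK" and ?DK = "cmat DK"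
  have cdims: "?A \<in> carrier_mat n n" "?B \<in> carrier_mat n m" "?C \<in> carrier_mat r n"
      "?AK \<in> carrier_mat k k" "?BK \<in> carrier_mat k r" "?CK \<in> carrier_mat m k" "?DK \<in> carrier_mat m r"
    using dims by auto
  define p where "p = x @\<^sub>v \<xi>"
  \<comment> \<open>The plant then receives \<open>u + (u\<^sub>t - u) = u\<^sub>t\<close>; the
    measurement noise is zero.\<close>
  define w where "w = (u\<^sub>t - u) @\<^sub>v 0\<^sub>v r"
  have Cx: "?C *\<^sub>v x \<in> carrier_vec r" and DCx: "?DK *\<^sub>v (?C *\<^sub>v x) \<in> carrier_vec m"
    and CKx: "?CK *\<^sub>v \<xi> \<in> carrier_vec m" and Ax: "?A *\<^sub>v x \<in> carrier_vec n"
    using cdims vecs by (auto intro!: mult_mat_vec_carrier)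
  have u: "u \<in> carrier_vec m" unfolding u_def using DCx CKx by simp
  have But: "?B *\<^sub>v u\<^sub>t \<in> carrier_vec n" and Bu: "?B *\<^sub>v u \<in> carrier_vec n"
    using cdims vecs u by (auto intro!: mult_mat_vec_carrier)
  have clA: "cmat (cl_A A B C AK BK CK DK)
      = four_block_mat (?A + ?B * ?DK * ?C) (?B * ?CK) (?BK * ?C) ?AK"
  proof -
    have "cmat (cl_A A B C AK BK CK DK)
        = four_block_mat (cmat (A + B * DK * C)) (cmat (B * CK)) (cmat (BK * C)) (cmat AK)"
      unfolding cl_A_def by (rule map_four_block_mat[of _ n n _ k _ k]) (use dims in auto)
    also have "cmat (A + B * DK * C) = ?A + cmat (B * DK * C)"
      using dims by (intro eq_matI) auto
    also have "cmat (B * DK * C) = ?B * ?DK * ?C"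
    proof -
      have "cmat (B * DK * C) = cmat (B * DK) * ?C" by (rule cmat_mult[of _ n r _ n]) (use dims in auto)
      then show ?thesis by (simp only: cmat_mult[OF dims(2,7)])
    qed
    also have "cmat (B * CK) = ?B * ?CK" by (rule cmat_mult[OF dims(2,6)])
    also have "cmat (BK * C) = ?BK * ?C" by (rule cmat_mult[OF dims(5,3)])
    finally show ?thesis .
  qed
  have clB: "cmat (cl_B B BK DK) = four_block_mat ?B (?B * ?DK) (0\<^sub>m k m) ?BK"
  proof -
    have "cmat (cl_B B BK DK) = four_block_mat ?B (cmat (B * DK)) (cmat (0\<^sub>m (dim_row BK) (dim_col B))) ?BK"
      unfolding cl_B_def by (rule map_four_block_mat[of _ n m _ r _ k]) (use dims in auto)
    also have "cmat (B * DK) = ?B * ?DK" by (rule cmat_mult[OF dims(2,7)])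
    also have "cmat (0\<^sub>m (dim_row BK) (dim_col B)) = 0\<^sub>m k m" using dims by (intro eq_matI) auto
    finally show ?thesis .
  qed
  have clC: "cmat (cl_C C CK DK) = four_block_mat ?C (0\<^sub>m r k) (?DK * ?C) ?CK"
  proof -
    have "cmat (cl_C C CK DK) = four_block_mat ?C (cmat (0\<^sub>m (dim_row C) (dim_col CK))) (cmat (DK * C)) ?CK"
      unfolding cl_C_def by (rule map_four_block_mat[of _ r n _ k _ m]) (use dims in auto)
    also have "cmat (DK * C) = ?DK * ?C" by (rule cmat_mult[OF dims(7,3)])
    also have "cmat (0\<^sub>m (dim_row C) (dim_col CK)) = 0\<^sub>m r k" using dims by (intro eq_matI) auto
    finally show ?thesis .
  qed
  have clD: "cmat (cl_D DK) = four_block_mat (0\<^sub>m r m) (0\<^sub>m r r) (0\<^sub>m m m) ?DK"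
  proof -
    have "cmat (cl_D DK) = four_block_mat (cmat (0\<^sub>m (dim_col DK) (dim_row DK))) (cmat (0\<^sub>m (dim_col DK) (dim_col DK)))
        (cmat (0\<^sub>m (dim_row DK) (dim_row DK))) ?DK"
      unfolding cl_D_def by (rule map_four_block_mat[of _ r m _ r _ m]) (use dims in auto)
    also have "cmat (0\<^sub>m (dim_col DK) (dim_row DK)) = 0\<^sub>m r m" using dims by (intro eq_matI) auto
    also have "cmat (0\<^sub>m (dim_col DK) (dim_col DK)) = 0\<^sub>m r r" using dims by (intro eq_matI) auto
    also have "cmat (0\<^sub>m (dim_row DK) (dim_row DK)) = 0\<^sub>m m m" using dims by (intro eq_matI) auto
    finally show ?thesis .
  qed
  have zero_mult: "0\<^sub>m a b *\<^sub>v y = 0\<^sub>v a" if "y \<in> carrier_vec b" for a b and y :: "complex vec"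
    using that by (intro eq_vecI) auto
  have mult_zero: "M *\<^sub>v 0\<^sub>v b = 0\<^sub>v a" if "M \<in> carrier_mat a b" for a b and M :: "complex mat"
    using that by (intro eq_vecI) auto
  have clAp: "cmat (cl_A A B C AK BK CK DK) *\<^sub>v p = (?A *\<^sub>v x + ?B *\<^sub>v u) @\<^sub>v (?s \<cdot>\<^sub>v \<xi>)"
  proof -
    have "cmat (cl_A A B C AK BK CK DK) *\<^sub>v p
        = ((?A + ?B * ?DK * ?C) *\<^sub>v x + (?B * ?CK) *\<^sub>v \<xi>) @\<^sub>v ((?BK * ?C) *\<^sub>v x + ?AK *\<^sub>v \<xi>)"
      unfolding clA p_def by (rule four_block_mat_mult_vec) (use cdims vecs in auto)
    also have "(?BK * ?C) *\<^sub>v x = ?BK *\<^sub>v (?C *\<^sub>v x)"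
      by (rule assoc_mult_mat_vec[OF cdims(5,3) vecs(1)])
    also have "(?B * ?CK) *\<^sub>v \<xi> = ?B *\<^sub>v (?CK *\<^sub>v \<xi>)"
      by (rule assoc_mult_mat_vec[OF cdims(2,6) vecs(2)])
    also have "(?A + ?B * ?DK * ?C) *\<^sub>v x = ?A *\<^sub>v x + (?B * ?DK * ?C) *\<^sub>v x"
      by (rule add_mult_distrib_mat_vec[of _ n n]) (use cdims vecs in auto)
    also have "(?B * ?DK * ?C) *\<^sub>v x = (?B * ?DK) *\<^sub>v (?C *\<^sub>v x)"
      by (rule assoc_mult_mat_vec[of _ n r]) (use cdims vecs in auto)
    also have "\<dots> = ?B *\<^sub>v (?DK *\<^sub>v (?C *\<^sub>v x))"
      by (rule assoc_mult_mat_vec[OF cdims(2,7) Cx])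
    also have "?A *\<^sub>v x + ?B *\<^sub>v (?DK *\<^sub>v (?C *\<^sub>v x)) + ?B *\<^sub>v (?CK *\<^sub>v \<xi>)
        = ?A *\<^sub>v x + (?B *\<^sub>v (?DK *\<^sub>v (?C *\<^sub>v x)) + ?B *\<^sub>v (?CK *\<^sub>v \<xi>))"
      by (rule assoc_add_vec[of _ n]) (use cdims Ax DCx CKx in \<open>auto intro!: mult_mat_vec_carrier\<close>)
    also have "?B *\<^sub>v (?DK *\<^sub>v (?C *\<^sub>v x)) + ?B *\<^sub>v (?CK *\<^sub>v \<xi>) = ?B *\<^sub>v u"
      unfolding u_def by (rule mult_add_distrib_mat_vec[OF cdims(2) DCx CKx, symmetric])
    finally show ?thesis by (simp only: controller)
  qed
  have Acl: "cl_A A B C AK BK CK DK \<in> carrier_mat (n + k) (n + k)"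
    using dims by (auto simp: cl_A_def)
  have Bcl: "cl_B B BK DK \<in> carrier_mat (n + k) (m + r)"
    using dims by (auto simp: cl_B_def)
  have Ccl: "cl_C C CK DK \<in> carrier_mat (r + m) (n + k)"
    using dims by (auto simp: cl_C_def)
  have Dcl: "cl_D DK \<in> carrier_mat (r + m) (m + r)"
    using dims by (auto simp: cl_D_def)
  have p: "p \<in> carrier_vec (n + k)" and w: "w \<in> carrier_vec (m + r)"
    using vecs u by (auto simp: p_def w_def)
  have sp: "?s \<cdot>\<^sub>v p = (?s \<cdot>\<^sub>v x) @\<^sub>v (?s \<cdot>\<^sub>v \<xi>)"
    unfolding p_def using vecs by (intro eq_vecI) auto
  have dist: "?B *\<^sub>v (u\<^sub>t - u) = ?B *\<^sub>v u\<^sub>t - ?B *\<^sub>v u"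
    by (rule mult_minus_distrib_mat_vec[OF cdims(2) vecs(3) u])
  have clBw: "cmat (cl_B B BK DK) *\<^sub>v w = (?B *\<^sub>v (u\<^sub>t - u)) @\<^sub>v 0\<^sub>v k"
  proof -
    have "cmat (cl_B B BK DK) *\<^sub>v w
        = (?B *\<^sub>v (u\<^sub>t - u) + (?B * ?DK) *\<^sub>v 0\<^sub>v r) @\<^sub>v (0\<^sub>m k m *\<^sub>v (u\<^sub>t - u) + ?BK *\<^sub>v 0\<^sub>v r)"
      unfolding clB w_def by (rule four_block_mat_mult_vec) (use cdims vecs u in auto)
    then show ?thesis
      using cdims vecs u But Bu by (simp add: zero_mult[of _ m] mult_zero[of _ n r] mult_zero[of _ k r] dist)
  qed
  have "cmat (cl_A A B C AK BK CK DK) *\<^sub>v p + cmat (cl_B B BK DK) *\<^sub>v w = ?s \<cdot>\<^sub>v p"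
  proof -
    have "(?A *\<^sub>v x + ?B *\<^sub>v u) + (?B *\<^sub>v u\<^sub>t - ?B *\<^sub>v u) = ?A *\<^sub>v x + ?B *\<^sub>v u\<^sub>t"
      using Ax But Bu by (intro eq_vecI) auto
    then show ?thesis
      unfolding clAp clBw sp dist plant[symmetric] using Ax But Bu vecs
      by (subst append_vec_add[of _ n _ _ k]) auto
  qed
  from hinf_norm_gain[OF Acl Bcl Ccl Dcl hur norm p w this]
  have "(vnorm (cmat (cl_C C CK DK) *\<^sub>v p + cmat (cl_D DK) *\<^sub>v w))\<^sup>2 \<le> (g * vnorm w)\<^sup>2"
    by (intro power_mono) auto
  moreover have "cmat (cl_C C CK DK) *\<^sub>v p + cmat (cl_D DK) *\<^sub>v w = (?C *\<^sub>v x) @\<^sub>v u"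
  proof -
    have "cmat (cl_C C CK DK) *\<^sub>v p = (?C *\<^sub>v x + 0\<^sub>m r k *\<^sub>v \<xi>) @\<^sub>v ((?DK * ?C) *\<^sub>v x + ?CK *\<^sub>v \<xi>)"
      unfolding clC p_def by (rule four_block_mat_mult_vec) (use cdims vecs in auto)
    also have "(?DK * ?C) *\<^sub>v x = ?DK *\<^sub>v (?C *\<^sub>v x)"
      by (rule assoc_mult_mat_vec[OF cdims(7,3) vecs(1)])
    finally have 1: "cmat (cl_C C CK DK) *\<^sub>v p = (?C *\<^sub>v x) @\<^sub>v u"
      using Cx vecs by (simp add: zero_mult[of _ k] u_def)
    have "cmat (cl_D DK) *\<^sub>v w
        = (0\<^sub>m r m *\<^sub>v (u\<^sub>t - u) + 0\<^sub>m r r *\<^sub>v 0\<^sub>v r) @\<^sub>v (0\<^sub>m m m *\<^sub>v (u\<^sub>t - u) + ?DK *\<^sub>v 0\<^sub>v r)"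
      unfolding clD w_def by (rule four_block_mat_mult_vec) (use cdims vecs u in auto)
    also have "\<dots> = 0\<^sub>v r @\<^sub>v 0\<^sub>v m"
      using cdims vecs u by (simp add: zero_mult[of _ m] zero_mult[of _ r] mult_zero[of _ m r])
    finally show ?thesis
      using 1 Cx u by (simp add: append_vec_add[of _ r _ _ m])
  qed
  moreover have "vnorm w = vnorm (u\<^sub>t - u)"
    by (rule power2_eq_imp_eq) (simp_all add: w_def vnorm_append_power2 vnorm_eq_0_iff[THEN iffD2])
  ultimately show "(vnorm (cmat C *\<^sub>v x))\<^sup>2 + (vnorm u)\<^sup>2 \<le> (g * vnorm (u\<^sub>t - u))\<^sup>2"
    by (simp add: vnorm_append_power2)
  \<comment> \<open>Without a disturbance, \<open>p\<close> would be a closed-loop mode on the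
    imaginary axis.\<close>
  show "x = 0\<^sub>v n \<and> \<xi> = 0\<^sub>v k" if "u\<^sub>t = u"
  proof -
    have "cmat (cl_A A B C AK BK CK DK) *\<^sub>v p = ?s \<cdot>\<^sub>v p"
      unfolding clAp sp using plant that by simp
    moreover have "\<not> eigenvalue (cmat (cl_A A B C AK BK CK DK)) ?s"
      using hur by (force simp: hurwitz_def)
    ultimately have "p = 0\<^sub>v (n + k)"
      using p Acl by (auto simp: eigenvalue_def eigenvector_def)
    moreover have "0\<^sub>v (n + k) = 0\<^sub>v n @\<^sub>v (0\<^sub>v k :: complex vec)" by (intro eq_vecI) auto
    ultimately have "x @\<^sub>v \<xi> = 0\<^sub>v n @\<^sub>v 0\<^sub>v k" by (simp add: p_def)
    then show ?thesis using vecs by (subst (asm) append_vec_eq[of _ n]) auto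
  qed
qed

text \<open>Completing the square: right side minus left side is the squared norm of
  \<open>c w + u\<close>. The use below has \<open>c = \<gamma>\<^sup>2\<close>.\<close>

lemma gain_inequality:
  fixes u w :: "complex vec"
  assumes "u \<in> carrier_vec m" "w \<in> carrier_vec m"
  shows "(1 - c) * (c * (vnorm w)\<^sup>2 - (vnorm u)\<^sup>2) \<le> c * (vnorm (u + w))\<^sup>2"
proof -
  have "(1 - c) * (c * (cmod a)\<^sup>2 - (cmod b)\<^sup>2) \<le> c * (cmod (b + a))\<^sup>2" for a b
  proof -
    have "c * (cmod (b + a))\<^sup>2 - (1 - c) * (c * (cmod a)\<^sup>2 - (cmod b)\<^sup>2) = (cmod (c *\<^sub>R a + b))\<^sup>2"
      unfolding cmod_power2 by (simp add: power2_eq_square algebra_simps)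
    then show ?thesis by (metis diff_ge_0_iff_ge zero_le_power2)
  qed
  then have "(\<Sum>i<m. (1 - c) * (c * (cmod (w $ i))\<^sup>2 - (cmod (u $ i))\<^sup>2)) \<le> (\<Sum>i<m. c * (cmod (u $ i + w $ i))\<^sup>2)"
    by (intro sum_mono)
  then show ?thesis
    using assms by (simp add: vnorm_power2 sum_distrib_left sum_subtractf right_diff_distrib)
qed

text \<open>For \<open>\<gamma> > 1\<close> the hypothesis forces \<open>C x = 0\<close> and \<open>u\<^sub>t = 0\<close>, an undetectable mode. For \<open>\<gamma> < 1\<close>
  split \<open>u\<^sub>t\<close> into the controller response \<open>u\<close> to the output \<open>C x\<close> and a disturbance \<open>u\<^sub>t - u\<close>: if the
  disturbance did not vanish, the gain of the closed loop would be at least \<open>\<gamma>\<close>.\<close>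

lemma hinf_level_no_imaginary_mode:
  fixes x u\<^sub>t :: "complex vec"
  assumes dims: "A \<in> carrier_mat n n" "B \<in> carrier_mat n m" "C \<in> carrier_mat r n"
    and level: "hinf_level n m r A B C < ereal \<gamma>" and \<gamma>: "0 < \<gamma>" "\<gamma> \<noteq> 1" and \<eta>: "\<eta> = 1 - 1 / \<gamma>\<^sup>2"
    and vecs: "x \<in> carrier_vec n" "u\<^sub>t \<in> carrier_vec m"
    and plant: "cmat A *\<^sub>v x + cmat B *\<^sub>v u\<^sub>t = (\<i> * complex_of_real \<omega>) \<cdot>\<^sub>v x"
    and balance: "\<eta> * (vnorm (cmat C *\<^sub>v x))\<^sup>2 + (vnorm u\<^sub>t)\<^sup>2 = 0"
  shows "x = 0\<^sub>v n"
proof -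
  let ?s = "\<i> * complex_of_real \<omega>"
  \<comment> \<open>The infimum need not be attained, but some level \<open>g\<close> strictly below
    \<gamma> admits a controller; this gap produces the final contradiction.\<close>
  obtain g k AK BK CK DK where K: "AK \<in> carrier_mat k k" "BK \<in> carrier_mat k r"
      "CK \<in> carrier_mat m k" "DK \<in> carrier_mat m r"
    and hur: "hurwitz (cl_A A B C AK BK CK DK)"
    and norm: "hinf_norm (cl_A A B C AK BK CK DK) (cl_B B BK DK) (cl_C C CK DK) (cl_D DK) < ereal g"
    and g\<gamma>: "g < \<gamma>"
    using level unfolding hinf_level_def Inf_less_iff by auto
  note response = closed_loop_response[OF dims K hur less_imp_le[OF norm]]
  have g0: "0 \<le> g"
  proof -
    have "0 \<le> hinf_norm (cl_A A B C AK BK CK DK) (cl_B B BK DK) (cl_C C CK DK) (cl_D DK)"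
      unfolding hinf_norm_def by (rule SUP_upper2[of 0]) (auto intro: spectral_norm_nonneg)
    also have "\<dots> \<le> ereal g" using norm by simp
    finally show ?thesis by simp
  qed
  have Cx: "cmat C *\<^sub>v x \<in> carrier_vec r" using dims vecs by (intro mult_mat_vec_carrier) auto
  have mult_zero: "cmat M *\<^sub>v 0\<^sub>v b = 0\<^sub>v a" if "M \<in> carrier_mat a b" for a b M
    using that by (intro eq_vecI) auto
  have smult_zero: "c \<cdot>\<^sub>v 0\<^sub>v a = 0\<^sub>v a" for a and c :: complex
    by (intro eq_vecI) auto
  consider "1 < \<gamma>" | "\<gamma> < 1" using \<gamma> by linarith
  then show ?thesis
  proof cases
    case 1
    then have \<eta>0: "0 < \<eta>" by (simp add: \<eta> divide_less_eq)
    then have "(vnorm (cmat C *\<^sub>v x))\<^sup>2 = 0" "(vnorm u\<^sub>t)\<^sup>2 = 0"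
      using balance by (simp_all add: add_nonneg_eq_0_iff)
    then have C0: "cmat C *\<^sub>v x = 0\<^sub>v r" and u0: "u\<^sub>t = 0\<^sub>v m"
      using Cx vecs dims by (auto simp: vnorm_eq_0_iff)
    \<comment> \<open>With zero plant output the controller may rest at state 0, so its output
      agrees with \<open>u\<^sub>t = 0\<close> and there is no disturbance.\<close>
    have "u\<^sub>t = cmat DK *\<^sub>v (cmat C *\<^sub>v x) + cmat CK *\<^sub>v 0\<^sub>v k"
      unfolding C0 u0 mult_zero[OF K(3)] mult_zero[OF K(4)] by simp
    moreover have "cmat BK *\<^sub>v (cmat C *\<^sub>v x) + cmat AK *\<^sub>v 0\<^sub>v k = ?s \<cdot>\<^sub>v 0\<^sub>v k"
      unfolding C0 mult_zero[OF K(1)] mult_zero[OF K(2)] smult_zero by simp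
    ultimately show ?thesis using response(2)[OF vecs(1) zero_carrier_vec vecs(2) plant] by blast
  next
    case 2
    then have g1: "g < 1" using g\<gamma> by simp
    let ?Q = "?s \<cdot>\<^sub>m 1\<^sub>m k - cmat AK"
    have Q: "?Q \<in> carrier_mat k k" using K by auto
    have Qz: "?Q *\<^sub>v z = ?s \<cdot>\<^sub>v z - cmat AK *\<^sub>v z" if z: "z \<in> carrier_vec k" for z
    proof -
      have "(?s \<cdot>\<^sub>m 1\<^sub>m k) *\<^sub>v z = ?s \<cdot>\<^sub>v z" using z by (intro eq_vecI) auto
      then show ?thesis using z K by (simp add: minus_mult_distrib_mat_vec[of _ k k])
    qed
    \<comment> \<open>The controller itself has no mode at this frequency. Keep the plant at rest by
      a disturbance that cancels the controller output \<open>CK z\<close>: the gain bound with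
      \<open>g < 1\<close> forces this output to vanish, and then \<open>z\<close> would be a mode
      of the undisturbed closed loop.\<close>
    have inj: "z = 0\<^sub>v k" if z: "z \<in> carrier_vec k" "?Q *\<^sub>v z = 0\<^sub>v k" for z
    proof -
      have AKz: "cmat AK *\<^sub>v z = ?s \<cdot>\<^sub>v z"
      proof (rule eq_vecI, goal_cases)
        case (1 i)
        then show ?case using arg_cong[OF z(2)[unfolded Qz[OF z(1)]], of "\<lambda>u. u $ i"] z(1) K by simp
      qed (use K z in auto)
      have CKz: "cmat CK *\<^sub>v z \<in> carrier_vec m" using K z by (intro mult_mat_vec_carrier) auto
      have C0: "cmat C *\<^sub>v 0\<^sub>v n = 0\<^sub>v r" by (rule mult_zero[OF dims(3)])
      have plant0: "cmat A *\<^sub>v 0\<^sub>v n + cmat B *\<^sub>v 0\<^sub>v m = ?s \<cdot>\<^sub>v 0\<^sub>v n"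
        unfolding mult_zero[OF dims(1)] mult_zero[OF dims(2)] smult_zero by simp
      have ctrl0: "cmat BK *\<^sub>v (cmat C *\<^sub>v 0\<^sub>v n) + cmat AK *\<^sub>v z = ?s \<cdot>\<^sub>v z"
        unfolding C0 mult_zero[OF K(2)] AKz using z by simp
      have u: "cmat DK *\<^sub>v (cmat C *\<^sub>v 0\<^sub>v n) + cmat CK *\<^sub>v z = cmat CK *\<^sub>v z"
        unfolding C0 mult_zero[OF K(4)] using CKz by simp
      note resp0 = response[OF zero_carrier_vec z(1) zero_carrier_vec plant0 ctrl0, unfolded u]
      have "vnorm (0\<^sub>v m - cmat CK *\<^sub>v z) = vnorm (cmat CK *\<^sub>v z)"
        using K CKz by (simp add: vnorm_def L2_set_def)
      then have "(vnorm (cmat CK *\<^sub>v z))\<^sup>2 \<le> (g * vnorm (cmat CK *\<^sub>v z))\<^sup>2"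
        using resp0(1) by (smt (verit) zero_le_power2)
      then have "vnorm (cmat CK *\<^sub>v z) \<le> g * vnorm (cmat CK *\<^sub>v z)"
        by (rule power2_le_imp_le) (simp add: g0)
      then have "(1 - g) * vnorm (cmat CK *\<^sub>v z) \<le> 0" by (simp add: algebra_simps)
      then have "vnorm (cmat CK *\<^sub>v z) = 0"
        using g1 vnorm_nonneg[of "cmat CK *\<^sub>v z"] by (simp add: mult_le_0_iff)
      then have "0\<^sub>v m = cmat CK *\<^sub>v z" using CKz K by (auto simp: vnorm_eq_0_iff)
      then show ?thesis using resp0(2) by blast
    qed
    have BKCx: "cmat BK *\<^sub>v (cmat C *\<^sub>v x) \<in> carrier_vec k"
      by (rule mult_mat_vec_carrier[OF _ Cx]) (use K in auto)
    \<comment> \<open>The steady state of the controller driven by the plant output at frequency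
      \<omega>.\<close>
    obtain \<xi> where \<xi>: "\<xi> \<in> carrier_vec k" "?Q *\<^sub>v \<xi> = cmat BK *\<^sub>v (cmat C *\<^sub>v x)"
      using injective_unique_solution[OF Q inj BKCx] by auto
    have ctrl: "cmat BK *\<^sub>v (cmat C *\<^sub>v x) + cmat AK *\<^sub>v \<xi> = ?s \<cdot>\<^sub>v \<xi>"
      unfolding \<xi>(2)[symmetric] Qz[OF \<xi>(1)] using K \<xi>(1) by (intro eq_vecI) auto
    define u where "u = cmat DK *\<^sub>v (cmat C *\<^sub>v x) + cmat CK *\<^sub>v \<xi>"
    note resp = response[OF vecs(1) \<xi>(1) vecs(2) plant ctrl, folded u_def]
    have u: "u \<in> carrier_vec m"
      using mult_mat_vec_carrier[of "cmat DK" m r, OF _ Cx] mult_mat_vec_carrier[of "cmat CK" m k, OF _ \<xi>(1)] K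
      by (simp add: u_def)
    define w where "w = u\<^sub>t - u"
    have w: "w \<in> carrier_vec m" using u vecs by (simp add: w_def)
    have uw: "u + w = u\<^sub>t" unfolding w_def using u vecs by (intro eq_vecI) auto
    have \<gamma>2: "\<gamma>\<^sup>2 < 1" using 2 \<gamma> by (simp add: power2_eq_square mult_strict_mono'[of \<gamma> 1 \<gamma> 1, simplified])
    \<comment> \<open>The energy balance multiplied by the square of \<gamma>. It evaluates the
      right side of the gain inequality, whose common factor \<open>1 - \<gamma>\<^sup>2\<close> is
      positive here.\<close>
    have "(vnorm u\<^sub>t)\<^sup>2 * \<gamma>\<^sup>2 = (1 - \<gamma>\<^sup>2) * (vnorm (cmat C *\<^sub>v x))\<^sup>2"
      using balance \<gamma>(1) unfolding \<eta> by (simp add: field_simps)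
    with gain_inequality[OF u w, of "\<gamma>\<^sup>2"]
    have "(1 - \<gamma>\<^sup>2) * (\<gamma>\<^sup>2 * (vnorm w)\<^sup>2 - (vnorm u)\<^sup>2) \<le> (1 - \<gamma>\<^sup>2) * (vnorm (cmat C *\<^sub>v x))\<^sup>2"
      by (simp add: uw mult.commute)
    then have "\<gamma>\<^sup>2 * (vnorm w)\<^sup>2 - (vnorm u)\<^sup>2 \<le> (vnorm (cmat C *\<^sub>v x))\<^sup>2"
      using \<gamma>2 by (simp add: mult_le_cancel_left_pos)
    then have "\<gamma>\<^sup>2 * (vnorm w)\<^sup>2 \<le> g\<^sup>2 * (vnorm w)\<^sup>2"
      using resp(1) by (simp add: w_def power_mult_distrib)
    \<comment> \<open>The same disturbance is amplified at least by \<gamma> and at most by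
      \<open>g\<close>, hence it vanishes.\<close>
    moreover have "g\<^sup>2 < \<gamma>\<^sup>2" using g0 g\<gamma> by (intro power_strict_mono) auto
    ultimately have "(vnorm w)\<^sup>2 \<le> 0"
      by (metis linorder_not_less mult_strict_right_mono)
    then have "vnorm w = 0" by simp
    then have "w = 0\<^sub>v m" using w by (simp add: vnorm_eq_0_iff)
    then have "u\<^sub>t = u" using uw u by simp
    then show ?thesis using resp(2) by blast
  qed
qed

section \<open>Solvability\<close>

lemma drift_carrier:
  assumes F: "\<And>p. 2 \<le> p \<Longrightarrow> F p \<in> carrier_mat n (n ^ p)"
  shows "drift n l A F x \<in> carrier_vec n"
proof -
  have "vsum n {2..l} (\<lambda>p. F p *\<^sub>v kron_pow x p) \<in> carrier_vec n"
  proof (rule vsum_carrier)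
    fix p assume "p \<in> {2..l}"
    then show "F p *\<^sub>v kron_pow x p \<in> carrier_vec n" using F[of p] by (intro carrier_vecI) auto
  qed
  then show ?thesis by (intro carrier_vecI) (simp add: drift_def)
qed

section \<open>Riccati equations and imaginary eigenvalues\<close>

lemma riccati_quadratic:
  fixes A B C V :: "real mat"
  assumes A: "A \<in> carrier_mat n n" and B: "B \<in> carrier_mat n m" and C: "C \<in> carrier_mat r n"
    and V: "V \<in> carrier_mat n n" "V\<^sup>T = V" and a: "a \<in> carrier_vec n"
  shows "a \<bullet> ((A\<^sup>T * V) *\<^sub>v a) = (A *\<^sub>v a) \<bullet> (V *\<^sub>v a)"
    and "a \<bullet> ((V * A) *\<^sub>v a) = (A *\<^sub>v a) \<bullet> (V *\<^sub>v a)"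
    and "a \<bullet> ((C\<^sup>T * C) *\<^sub>v a) = (C *\<^sub>v a) \<bullet> (C *\<^sub>v a)"
    and "a \<bullet> ((V * B * B\<^sup>T * V) *\<^sub>v a) = (B\<^sup>T *\<^sub>v (V *\<^sub>v a)) \<bullet> (B\<^sup>T *\<^sub>v (V *\<^sub>v a))"
proof -
  have move: "x \<bullet> (P\<^sup>T *\<^sub>v y) = (P *\<^sub>v x) \<bullet> y"
    if "P \<in> carrier_mat p q" "x \<in> carrier_vec q" "y \<in> carrier_vec p" for P :: "real mat" and p q x y
  proof -
    have "x \<bullet> (P\<^sup>T *\<^sub>v y) = (P\<^sup>T *\<^sub>v y) \<bullet> x"
      using that by (intro comm_scalar_prod[of _ q]) auto
    also have "\<dots> = y \<bullet> (P *\<^sub>v x)" by (rule transpose_vec_mult_scalar[OF that])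
    also have "\<dots> = (P *\<^sub>v x) \<bullet> y"
      using that by (intro comm_scalar_prod[of _ p]) auto
    finally show ?thesis .
  qed
  have Va: "V *\<^sub>v a \<in> carrier_vec n" and Aa: "A *\<^sub>v a \<in> carrier_vec n" and Ca: "C *\<^sub>v a \<in> carrier_vec r"
    using A C V a by (auto intro!: mult_mat_vec_carrier)
  then have BVa: "B\<^sup>T *\<^sub>v (V *\<^sub>v a) \<in> carrier_vec m" using B by (auto intro!: mult_mat_vec_carrier)
  have AT: "A\<^sup>T \<in> carrier_mat n n" and BT: "B\<^sup>T \<in> carrier_mat m n" and CT: "C\<^sup>T \<in> carrier_mat n r"
    using A B C by auto
  show "a \<bullet> ((A\<^sup>T * V) *\<^sub>v a) = (A *\<^sub>v a) \<bullet> (V *\<^sub>v a)"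
    unfolding assoc_mult_mat_vec[OF AT V(1) a] by (rule move[OF A a Va])
  have "a \<bullet> ((V * A) *\<^sub>v a) = a \<bullet> (V\<^sup>T *\<^sub>v (A *\<^sub>v a))"
    unfolding assoc_mult_mat_vec[OF V(1) A a] V(2) ..
  also have "\<dots> = (V *\<^sub>v a) \<bullet> (A *\<^sub>v a)" by (rule move[OF V(1) a Aa])
  also have "\<dots> = (A *\<^sub>v a) \<bullet> (V *\<^sub>v a)" by (rule comm_scalar_prod[OF Va Aa])
  finally show "a \<bullet> ((V * A) *\<^sub>v a) = (A *\<^sub>v a) \<bullet> (V *\<^sub>v a)" .
  show "a \<bullet> ((C\<^sup>T * C) *\<^sub>v a) = (C *\<^sub>v a) \<bullet> (C *\<^sub>v a)"
    unfolding assoc_mult_mat_vec[OF CT C a] by (rule move[OF C a Ca])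
  have "(V * B * B\<^sup>T * V) *\<^sub>v a = (V * B * B\<^sup>T) *\<^sub>v (V *\<^sub>v a)"
    by (rule assoc_mult_mat_vec[of _ n n]) (use B V a in auto)
  also have "\<dots> = (V * B) *\<^sub>v (B\<^sup>T *\<^sub>v (V *\<^sub>v a))"
    by (rule assoc_mult_mat_vec[of _ n m]) (use B V Va in auto)
  also have "\<dots> = V *\<^sub>v (B *\<^sub>v (B\<^sup>T *\<^sub>v (V *\<^sub>v a)))"
    by (rule assoc_mult_mat_vec[OF V(1) B BVa])
  finally have eq: "(V * B * B\<^sup>T * V) *\<^sub>v a = V\<^sup>T *\<^sub>v (B *\<^sub>v (B\<^sup>T *\<^sub>v (V *\<^sub>v a)))" by (simp only: V(2))
  have BBVa: "B *\<^sub>v (B\<^sup>T *\<^sub>v (V *\<^sub>v a)) \<in> carrier_vec n" by (rule mult_mat_vec_carrier[OF B BVa])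
  have "a \<bullet> ((V * B * B\<^sup>T * V) *\<^sub>v a) = (V *\<^sub>v a) \<bullet> (B *\<^sub>v (B\<^sup>T *\<^sub>v (V *\<^sub>v a)))"
    unfolding eq by (rule move[OF V(1) a BBVa])
  also have "\<dots> = (B\<^sup>T *\<^sub>v (V *\<^sub>v a)) \<bullet> (B\<^sup>T *\<^sub>v (V *\<^sub>v a))"
    by (rule transpose_vec_mult_scalar[OF B BVa Va, symmetric])
  finally show "a \<bullet> ((V * B * B\<^sup>T * V) *\<^sub>v a) = (B\<^sup>T *\<^sub>v (V *\<^sub>v a)) \<bullet> (B\<^sup>T *\<^sub>v (V *\<^sub>v a))" .
qed

text \<open>At an eigenvector of an imaginary eigenvalue the form of
  \<open>M\<^sup>T * V + V * M\<close> vanishes. By the Riccati equation this is an energy balance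
  between the plant output and the feedback input, which the H-infinity level forbids for a nonzero
  vector.\<close>

lemma riccati_no_imaginary_eigenvalue:
  fixes A B C V :: "real mat"
  assumes A: "A \<in> carrier_mat n n" and B: "B \<in> carrier_mat n m" and C: "C \<in> carrier_mat r n"
    and V: "V \<in> carrier_mat n n" "V\<^sup>T = V"
    and are: "\<And>a. a \<in> carrier_vec n \<Longrightarrow> 2 * ((A *\<^sub>v a) \<bullet> (V *\<^sub>v a)) + p * ((C *\<^sub>v a) \<bullet> (C *\<^sub>v a))
        + q * ((B\<^sup>T *\<^sub>v (V *\<^sub>v a)) \<bullet> (B\<^sup>T *\<^sub>v (V *\<^sub>v a))) = 0"
    and pq: "p * q = - \<eta>"
    and level: "hinf_level n m r A B C < ereal \<gamma>" and \<gamma>: "0 < \<gamma>" "\<gamma> \<noteq> 1" and \<eta>: "\<eta> = 1 - 1 / \<gamma>\<^sup>2"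
    and ev: "eigenvalue (cmat (A + q \<cdot>\<^sub>m (B * B\<^sup>T * V))) \<mu>"
  shows "Re \<mu> \<noteq> 0"
proof
  assume Re0: "Re \<mu> = 0"
  define M where "M = A + q \<cdot>\<^sub>m (B * B\<^sup>T * V)"
  \<comment> \<open>The feedback gain: \<open>M = A + B * K\<close>, so \<open>K\<close> applied to
    the eigenvector is the input that sustains the mode.\<close>
  define K where "K = q \<cdot>\<^sub>m (B\<^sup>T * V)"
  have BV: "B\<^sup>T * V \<in> carrier_mat m n" using B V by auto
  then have K: "K \<in> carrier_mat m n" by (simp add: K_def)
  have MK: "M = A + B * K"
    unfolding M_def K_def using B V assoc_mult_mat[of B n m "B\<^sup>T" n V n]
    by (simp add: mult_smult_distrib[OF B BV])
  have M: "M \<in> carrier_mat n n" using A B K by (auto simp: MK)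
  obtain z where z: "z \<in> carrier_vec n" "z \<noteq> 0\<^sub>v n" "cmat M *\<^sub>v z = \<mu> \<cdot>\<^sub>v z"
    using ev M unfolding M_def[symmetric] by (auto simp: eigenvalue_def eigenvector_def)
  let ?a = "map_vec Re z" and ?b = "map_vec Im z"
  have ab: "?a \<in> carrier_vec n" "?b \<in> carrier_vec n" using z(1) by auto
  have Ka: "K *\<^sub>v a = q \<cdot>\<^sub>v (B\<^sup>T *\<^sub>v (V *\<^sub>v a))" if a: "a \<in> carrier_vec n" for a
  proof -
    have "K *\<^sub>v a = q \<cdot>\<^sub>v ((B\<^sup>T * V) *\<^sub>v a)"
      using BV a by (intro eq_vecI) (auto simp: K_def)
    also have "(B\<^sup>T * V) *\<^sub>v a = B\<^sup>T *\<^sub>v (V *\<^sub>v a)"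
      using B V a by (intro assoc_mult_mat_vec[of _ m n _ n]) auto
    finally show ?thesis .
  qed
  have quad: "a \<bullet> ((M\<^sup>T * V + V * M) *\<^sub>v a) =
      - p * ((C *\<^sub>v a) \<bullet> (C *\<^sub>v a)) + q * ((B\<^sup>T *\<^sub>v (V *\<^sub>v a)) \<bullet> (B\<^sup>T *\<^sub>v (V *\<^sub>v a)))"
    if a: "a \<in> carrier_vec n" for a
  proof -
    let ?y = "B\<^sup>T *\<^sub>v (V *\<^sub>v a)"
    have Va: "V *\<^sub>v a \<in> carrier_vec n" and Aa: "A *\<^sub>v a \<in> carrier_vec n" and Ma: "M *\<^sub>v a \<in> carrier_vec n"
      using A M V a by (auto intro!: mult_mat_vec_carrier)
    have y: "?y \<in> carrier_vec m" using B Va by (auto intro!: mult_mat_vec_carrier)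
    have By: "B *\<^sub>v ?y \<in> carrier_vec n" by (rule mult_mat_vec_carrier[OF B y])
    have MT: "M\<^sup>T * V \<in> carrier_mat n n" "V * M \<in> carrier_mat n n" using M V by auto
    have "a \<bullet> ((M\<^sup>T * V + V * M) *\<^sub>v a) = a \<bullet> ((M\<^sup>T * V) *\<^sub>v a) + a \<bullet> ((V * M) *\<^sub>v a)"
      using MT a by (simp add: add_mult_distrib_mat_vec[of _ n n] scalar_prod_add_distrib[of _ n])
    then have "a \<bullet> ((M\<^sup>T * V + V * M) *\<^sub>v a) = 2 * ((M *\<^sub>v a) \<bullet> (V *\<^sub>v a))"
      by (simp add: riccati_quadratic(1,2)[OF M B C V a])
    also have "M *\<^sub>v a = A *\<^sub>v a + (B * K) *\<^sub>v a"
      unfolding MK using A B K a by (intro add_mult_distrib_mat_vec[of _ n n]) auto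
    also have "(B * K) *\<^sub>v a = B *\<^sub>v (q \<cdot>\<^sub>v ?y)"
      unfolding Ka[OF a, symmetric] by (rule assoc_mult_mat_vec[OF B K a])
    also have "\<dots> = q \<cdot>\<^sub>v (B *\<^sub>v ?y)" by (rule mult_mat_vec[OF B y])
    also have "(A *\<^sub>v a + q \<cdot>\<^sub>v (B *\<^sub>v ?y)) \<bullet> (V *\<^sub>v a) = (A *\<^sub>v a) \<bullet> (V *\<^sub>v a) + q * ((B *\<^sub>v ?y) \<bullet> (V *\<^sub>v a))"
      using Aa By Va by (simp add: add_scalar_prod_distrib[of _ n])
    also have "(B *\<^sub>v ?y) \<bullet> (V *\<^sub>v a) = (V *\<^sub>v a) \<bullet> (B *\<^sub>v ?y)" by (rule comm_scalar_prod[OF By Va])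
    also have "\<dots> = ?y \<bullet> ?y" by (rule transpose_vec_mult_scalar[OF B y Va, symmetric])
    finally show ?thesis using are[OF a] by (simp add: algebra_simps)
  qed
  define c where "c = (vnorm (cmat C *\<^sub>v z))\<^sup>2"
  define y where "y = (vnorm (cmat (B\<^sup>T * V) *\<^sub>v z))\<^sup>2"
  have c: "c = (C *\<^sub>v ?a) \<bullet> (C *\<^sub>v ?a) + (C *\<^sub>v ?b) \<bullet> (C *\<^sub>v ?b)"
    by (simp add: c_def vnorm_parts cmat_mult_vec_parts[OF C z(1)])
  have BVz: "(B\<^sup>T * V) *\<^sub>v a = B\<^sup>T *\<^sub>v (V *\<^sub>v a)" if "a \<in> carrier_vec n" for a
    using B V that by (intro assoc_mult_mat_vec[of _ m n _ n]) auto
  have y: "y = (B\<^sup>T *\<^sub>v (V *\<^sub>v ?a)) \<bullet> (B\<^sup>T *\<^sub>v (V *\<^sub>v ?a)) + (B\<^sup>T *\<^sub>v (V *\<^sub>v ?b)) \<bullet> (B\<^sup>T *\<^sub>v (V *\<^sub>v ?b))"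
    unfolding BVz[OF ab(1), symmetric] BVz[OF ab(2), symmetric]
    by (simp add: y_def vnorm_parts cmat_mult_vec_parts[OF BV z(1)])
  have "- p * c + q * y = 0"
    using lyapunov_form_eigen[OF M V(1) ab eigenvector_parts[OF M z(1,3)]]
    by (simp add: Re0 quad[OF ab(1)] quad[OF ab(2)] c y algebra_simps)
  moreover have "(vnorm (cmat K *\<^sub>v z))\<^sup>2 = q\<^sup>2 * y"
  proof -
    have "cmat K *\<^sub>v z = complex_of_real q \<cdot>\<^sub>v (cmat (B\<^sup>T * V) *\<^sub>v z)"
      using BV z(1) by (intro eq_vecI) (auto simp: K_def scalar_prod_def sum_distrib_left algebra_simps)
    then show ?thesis by (simp add: vnorm_smult power_mult_distrib y_def)
  qed
  \<comment> \<open>The factor \<open>q\<close> turns \<open>- p\<close> into \<eta> and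
    \<open>q * y\<close> into the squared norm of the feedback input.\<close>
  moreover have "\<eta> * c + q\<^sup>2 * y = q * (- p * c + q * y)"
    using pq by (simp add: algebra_simps power2_eq_square)
  ultimately have balance: "\<eta> * (vnorm (cmat C *\<^sub>v z))\<^sup>2 + (vnorm (cmat K *\<^sub>v z))\<^sup>2 = 0"
    by (simp add: c_def)
  have "cmat A *\<^sub>v z + cmat B *\<^sub>v (cmat K *\<^sub>v z) = cmat M *\<^sub>v z"
  proof -
    have "cmat M = cmat A + cmat B * cmat K"
      unfolding MK cmat_mult[OF B K, symmetric] using A B K by (intro eq_matI) auto
    then have "cmat M *\<^sub>v z = cmat A *\<^sub>v z + (cmat B * cmat K) *\<^sub>v z"
      using A B K z(1) by (simp add: add_mult_distrib_mat_vec[of _ n n])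
    also have "(cmat B * cmat K) *\<^sub>v z = cmat B *\<^sub>v (cmat K *\<^sub>v z)"
      using B K z(1) by (intro assoc_mult_mat_vec[of _ n m _ n]) auto
    finally show ?thesis ..
  qed
  also have "\<dots> = (\<i> * complex_of_real (Im \<mu>)) \<cdot>\<^sub>v z"
    unfolding z(3) by (rule arg_cong[of _ _ "\<lambda>c. c \<cdot>\<^sub>v z"]) (simp add: complex_eq_iff Re0)
  finally have "z = 0\<^sub>v n"
    using K z(1) balance
    by (intro hinf_level_no_imaginary_mode[OF A B C level \<gamma> \<eta>, of _ "cmat K *\<^sub>v z" "Im \<mu>"])
      (auto intro!: mult_mat_vec_carrier)
  then show False using z(2) by simp
qed

text \<open>The past energy function is the case \<open>s = -1\<close>, \<open>q = 1\<close>, \<open>p = - \<eta>\<close>, the future one is \<open>s = 1\<close>,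
  \<open>q = - \<eta>\<close>, \<open>p = 1\<close>.\<close>

lemma closed_loop_lyap_unique_solution:
  fixes A B C V :: "real mat"
  assumes A: "A \<in> carrier_mat n n" and B: "B \<in> carrier_mat n m" and C: "C \<in> carrier_mat r n"
    and F: "\<And>p. 2 \<le> p \<Longrightarrow> F p \<in> carrier_mat n (n ^ p)"
    and G: "\<And>p. 1 \<le> p \<Longrightarrow> G p \<in> carrier_mat n (m * n ^ p)"
    and f: "f = drift n l A F" and g: "g = input_map n m l B G"
    and V: "V \<in> carrier_mat n n" "V\<^sup>T = V"
    and are: "\<And>a. a \<in> carrier_vec n \<Longrightarrow> 2 * ((A *\<^sub>v a) \<bullet> (V *\<^sub>v a)) + p * ((C *\<^sub>v a) \<bullet> (C *\<^sub>v a))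
        + q * ((B\<^sup>T *\<^sub>v (V *\<^sub>v a)) \<bullet> (B\<^sup>T *\<^sub>v (V *\<^sub>v a))) = 0"
    and pq: "p * q = - \<eta>"
    and level: "hinf_level n m r A B C < ereal \<gamma>" and \<gamma>: "0 < \<gamma>" "\<gamma> \<noteq> 1" and \<eta>: "\<eta> = 1 - 1 / \<gamma>\<^sup>2"
    and E: "energy_expansion n d E v" "2 \<le> d" "v 2 = vec_of_mat V"
    and stab: "asymptotically_stable n \<phi>" and s: "s \<noteq> 0"
    and \<phi>: "\<And>x i. x \<in> carrier_vec n \<Longrightarrow> i < n \<Longrightarrow>
        \<phi> x $ i = s * f x $ i + s * q * (g x *\<^sub>v ((g x)\<^sup>T *\<^sub>v grad n E x)) $ i"
    and k: "1 \<le> k" and b: "b \<in> carrier_vec (n ^ k)"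
  shows "\<exists>!z. z \<in> carrier_vec (n ^ k) \<and> (lyap k (A + q \<cdot>\<^sub>m (B * B\<^sup>T * V)))\<^sup>T *\<^sub>v z = b"
proof (rule lyap_transpose_unique_solution[OF _ k b])
  let ?X = "B * B\<^sup>T * V"
  let ?M = "A + q \<cdot>\<^sub>m ?X"
  have X: "?X \<in> carrier_mat n n" using B V by auto
  then show M: "?M \<in> carrier_mat n n" using A by auto
  fix \<mu> assume ev: "eigenvalue (cmat ?M) \<mu>"
  \<comment> \<open>The stable vector field linearizes to \<open>s\<close> times the matrix of
    interest, so its eigenvalues are scaled by \<open>s\<close>.\<close>
  have "eigenvalue (cmat (s \<cdot>\<^sub>m A + (s * q) \<cdot>\<^sub>m ?X)) (complex_of_real s * \<mu>)"
  proof -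
    have eq: "cmat (s \<cdot>\<^sub>m A + (s * q) \<cdot>\<^sub>m ?X) = complex_of_real s \<cdot>\<^sub>m cmat ?M"
      using carrier_matD[OF A] carrier_matD[OF B] carrier_matD[OF V(1)] by (intro eq_matI) (simp_all add: algebra_simps)
    obtain z where z: "z \<in> carrier_vec n" "z \<noteq> 0\<^sub>v n" "cmat ?M *\<^sub>v z = \<mu> \<cdot>\<^sub>v z"
      using ev M by (auto simp: eigenvalue_def eigenvector_def)
    have "(complex_of_real s \<cdot>\<^sub>m cmat ?M) *\<^sub>v z = complex_of_real s \<cdot>\<^sub>v (cmat ?M *\<^sub>v z)"
      using M z(1) by (intro eq_vecI) (auto simp: scalar_prod_def sum_distrib_left algebra_simps)
    then have "(complex_of_real s \<cdot>\<^sub>m cmat ?M) *\<^sub>v z = (complex_of_real s * \<mu>) \<cdot>\<^sub>v z"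
      by (simp add: z(3) smult_smult_assoc)
    then show ?thesis
      unfolding eq eigenvalue_def eigenvector_def using M z by (intro exI[of _ z]) auto
  qed
  from closed_loop_eigenvalue_Re_le_0[OF A B V F G f g E stab \<phi> this]
  have "s * Re \<mu> \<le> 0" by simp
  moreover have "Re \<mu> \<noteq> 0"
    by (rule riccati_no_imaginary_eigenvalue[OF A B C V are pq level \<gamma> \<eta> ev])
  \<comment> \<open>The half-plane sign is \<open>- s\<close>: eigenvalues lie on the right for the
    past loop and on the left for the future loop.\<close>
  ultimately show "0 < - s * Re \<mu>" using s by (simp add: order_le_less)
qed

section \<open>Lengths of the right-hand sides and conclusion\<close>

lemma dim_vec_of_mat: "dim_vec (vec_of_mat M) = dim_row M * dim_col M"
  by (simp add: vec_of_mat_def)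

lemma coefficient_terms_carrier:
  fixes F G H V :: "nat \<Rightarrow> real mat" and v :: "nat \<Rightarrow> real vec"
  assumes F: "\<And>p. 2 \<le> p \<Longrightarrow> F p \<in> carrier_mat n (n ^ p)"
    and H: "\<And>p. 1 \<le> p \<Longrightarrow> H p \<in> carrier_mat r (n ^ p)"
    and V: "\<And>i. 2 \<le> i \<Longrightarrow> i < k \<Longrightarrow> V i \<in> carrier_mat n (n ^ (i - 1))"
  shows "vsum (n ^ k) {(i, p). 2 \<le> i \<and> 2 \<le> p \<and> i + p = k + 1}
      (\<lambda>(i, p). (lyap i (F p))\<^sup>T *\<^sub>v v i) \<in> carrier_vec (n ^ k)"
    and "vsum (n ^ k) {(i, j). 2 < i \<and> 2 < j \<and> i + j = k + 2}
      (\<lambda>(i, j). real (i * j) \<cdot>\<^sub>v vec_of_mat ((V i)\<^sup>T * B * B\<^sup>T * V j)) \<in> carrier_vec (n ^ k)"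
    and "vsum (n ^ k) {(p, q). 1 \<le> p \<and> 1 \<le> q \<and> p + q = k}
      (\<lambda>(p, q). vec_of_mat ((H p)\<^sup>T * H q)) \<in> carrier_vec (n ^ k)"
    and "vsum (n ^ k) {1..2 * l} (\<lambda>e. vsum (n ^ k) {(p, q). p + q = e} (\<lambda>(p, q).
        vsum (n ^ k) {(i, j). 2 \<le> i \<and> 2 \<le> j \<and> i + j + e = k + 2} (\<lambda>(i, j).
          real (i * j) \<cdot>\<^sub>v vec_of_mat (Gam n m G p q i j (V i) (V j))))) \<in> carrier_vec (n ^ k)"
proof -
  show "vsum (n ^ k) {(i, p). 2 \<le> i \<and> 2 \<le> p \<and> i + p = k + 1}
      (\<lambda>(i, p). (lyap i (F p))\<^sup>T *\<^sub>v v i) \<in> carrier_vec (n ^ k)"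
  proof (rule vsum_carrier, clarify)
    fix i p :: nat assume ip: "2 \<le> i" "2 \<le> p" "i + p = k + 1"
    \<comment> \<open>The transposed Lyapunov matrix of the rectangular \<open>F p\<close> has
      \<open>n ^ (i - 1) * n ^ p\<close> rows, one tensor factor being replaced by \<open>p\<close>
      factors.\<close>
    then have "k = (i - 1) + p" by simp
    then have "n ^ k = n ^ (i - 1) * n ^ p" by (simp only: power_add)
    then show "(lyap i (F p))\<^sup>T *\<^sub>v v i \<in> carrier_vec (n ^ k)"
      using F[OF ip(2)] by (intro carrier_vecI) (simp add: lyap_def)
  qed
  show "vsum (n ^ k) {(i, j). 2 < i \<and> 2 < j \<and> i + j = k + 2}
      (\<lambda>(i, j). real (i * j) \<cdot>\<^sub>v vec_of_mat ((V i)\<^sup>T * B * B\<^sup>T * V j)) \<in> carrier_vec (n ^ k)"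
  proof (rule vsum_carrier, clarify)
    fix i j :: nat assume ij: "2 < i" "2 < j" "i + j = k + 2"
    \<comment> \<open>As both indices exceed 2 and add up to \<open>k + 2\<close>, both are less
      than \<open>k\<close>, where the sizes of the coefficients are known.\<close>
    then have "k = (i - 1) + (j - 1)" by simp
    then have "n ^ k = n ^ (i - 1) * n ^ (j - 1)" by (simp only: power_add)
    then show "real (i * j) \<cdot>\<^sub>v vec_of_mat ((V i)\<^sup>T * B * B\<^sup>T * V j) \<in> carrier_vec (n ^ k)"
      using V[of i] V[of j] ij by (intro carrier_vecI) (simp add: dim_vec_of_mat)
  qed
  show "vsum (n ^ k) {(p, q). 1 \<le> p \<and> 1 \<le> q \<and> p + q = k}
      (\<lambda>(p, q). vec_of_mat ((H p)\<^sup>T * H q)) \<in> carrier_vec (n ^ k)"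
  proof (rule vsum_carrier, clarify)
    fix p q :: nat assume pq: "1 \<le> p" "1 \<le> q" "k = p + q"
    show "vec_of_mat ((H p)\<^sup>T * H q) \<in> carrier_vec (n ^ (p + q))"
      using H[OF pq(1)] H[OF pq(2)] by (intro carrier_vecI) (simp add: dim_vec_of_mat power_add)
  qed
  show "vsum (n ^ k) {1..2 * l} (\<lambda>e. vsum (n ^ k) {(p, q). p + q = e} (\<lambda>(p, q).
        vsum (n ^ k) {(i, j). 2 \<le> i \<and> 2 \<le> j \<and> i + j + e = k + 2} (\<lambda>(i, j).
          real (i * j) \<cdot>\<^sub>v vec_of_mat (Gam n m G p q i j (V i) (V j))))) \<in> carrier_vec (n ^ k)"
  proof (rule vsum_carrier, rule vsum_carrier, clarify, rule vsum_carrier, clarify)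
    fix p q i j :: nat assume ij: "2 \<le> i" "2 \<le> j" "i + j + (p + q) = k + 2"
    \<comment> \<open>The outer factors of \<open>Gam\<close> fix its size as \<open>n ^ p\<close>
      by \<open>n ^ (k - p)\<close>, because the \<open>k\<close> of its definition is the present
      one.\<close>
    then have "k = p + (i + j + p + q - 2 - p)" by simp
    then have "n ^ k = n ^ p * n ^ (i + j + p + q - 2 - p)" by (simp only: power_add)
    then show "real (i * j) \<cdot>\<^sub>v vec_of_mat (Gam n m G p q i j (V i) (V j)) \<in> carrier_vec (n ^ k)"
      by (intro carrier_vecI) (simp add: dim_vec_of_mat Gam_def Let_def col_mat_def)
  qed
qed

theorem theorem3:
  fixes n m r l d :: nat
    and A B C :: "real mat"
    and F G H V W :: "nat \<Rightarrow> real mat"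
    and v w :: "nat \<Rightarrow> real vec"
    and f :: "real vec \<Rightarrow> real vec" and g :: "real vec \<Rightarrow> real mat" and h :: "real vec \<Rightarrow> real vec"
    and Epast Efuture :: "real vec \<Rightarrow> real"
    and \<gamma> \<eta> :: real
  assumes A: "A \<in> carrier_mat n n" and B: "B \<in> carrier_mat n m" and C: "C \<in> carrier_mat r n"
    and F: "\<And>p. 2 \<le> p \<Longrightarrow> F p \<in> carrier_mat n (n ^ p)"
    and G: "\<And>p. 1 \<le> p \<Longrightarrow> G p \<in> carrier_mat n (m * n ^ p)"
    and H: "\<And>p. 2 \<le> p \<Longrightarrow> H p \<in> carrier_mat r (n ^ p)"
    and F_zero: "\<And>p. 2 \<le> p \<Longrightarrow> l < p \<Longrightarrow> F p = 0\<^sub>m n (n ^ p)"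
    and G_zero: "\<And>p. 1 \<le> p \<Longrightarrow> l < p \<Longrightarrow> G p = 0\<^sub>m n (m * n ^ p)"
    and H_zero: "\<And>p. 2 \<le> p \<Longrightarrow> l < p \<Longrightarrow> H p = 0\<^sub>m r (n ^ p)"
    and G0: "G 0 = B" and H1: "H 1 = C"
    and f_def: "f = drift n l A F"
    and g_def: "g = input_map n m l B G"
    and h_def: "h = output_map r l C H"
    and gamma_pos: "0 < \<gamma>" and gamma_ne1: "\<gamma> \<noteq> 1"
    and gamma_level: "hinf_level n m r A B C < ereal \<gamma>"
    and eta: "\<eta> = 1 - 1 / \<gamma>\<^sup>2"
    and past: "past_energy_function n m f g h \<eta> Epast"
    and future: "future_energy_function n m f g h \<gamma> \<eta> Efuture"
    and past_expansion: "energy_expansion n d Epast v"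
    and future_expansion: "energy_expansion n d Efuture w"
    and V: "\<And>i. 2 \<le> i \<Longrightarrow> i \<le> d \<Longrightarrow> V i \<in> carrier_mat n (n ^ (i - 1)) \<and> v i = vec_of_mat (V i)"
    and W: "\<And>i. 2 \<le> i \<Longrightarrow> i \<le> d \<Longrightarrow> W i \<in> carrier_mat n (n ^ (i - 1)) \<and> w i = vec_of_mat (W i)"
    and V2: "sym_psd n (V 2)" and W2: "sym_psd n (W 2)"
    and past_are: "0\<^sub>m n n = A\<^sup>T * V 2 + V 2 * A - \<eta> \<cdot>\<^sub>m (C\<^sup>T * C) + V 2 * B * B\<^sup>T * V 2"
    and future_are: "0\<^sub>m n n = A\<^sup>T * W 2 + W 2 * A + C\<^sup>T * C - \<eta> \<cdot>\<^sub>m (W 2 * B * B\<^sup>T * W 2)"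
  shows "\<forall>k. 3 \<le> k \<and> k \<le> d \<longrightarrow>
      (\<exists>!z. z \<in> carrier_vec (n ^ k) \<and>
        (lyap k (A + B * B\<^sup>T * V 2))\<^sup>T *\<^sub>v z =
          - vsum (n ^ k) {(i, p). 2 \<le> i \<and> 2 \<le> p \<and> i + p = k + 1}
              (\<lambda>(i, p). (lyap i (F p))\<^sup>T *\<^sub>v v i)
          - (1/4) \<cdot>\<^sub>v vsum (n ^ k) {(i, j). 2 < i \<and> 2 < j \<and> i + j = k + 2}
              (\<lambda>(i, j). real (i * j) \<cdot>\<^sub>v vec_of_mat ((V i)\<^sup>T * B * B\<^sup>T * V j))
          + \<eta> \<cdot>\<^sub>v vsum (n ^ k) {(p, q). 1 \<le> p \<and> 1 \<le> q \<and> p + q = k}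
              (\<lambda>(p, q). vec_of_mat ((H p)\<^sup>T * H q))
          - (1/4) \<cdot>\<^sub>v vsum (n ^ k) {1..2 * l} (\<lambda>e.
              vsum (n ^ k) {(p, q). p + q = e} (\<lambda>(p, q).
                vsum (n ^ k) {(i, j). 2 \<le> i \<and> 2 \<le> j \<and> i + j + e = k + 2} (\<lambda>(i, j).
                  real (i * j) \<cdot>\<^sub>v vec_of_mat (Gam n m G p q i j (V i) (V j))))))
    \<and> (\<exists>!z. z \<in> carrier_vec (n ^ k) \<and>
        (lyap k (A - \<eta> \<cdot>\<^sub>m (B * B\<^sup>T * W 2)))\<^sup>T *\<^sub>v z =
          - vsum (n ^ k) {(i, p). 2 \<le> i \<and> 2 \<le> p \<and> i + p = k + 1}
              (\<lambda>(i, p). (lyap i (F p))\<^sup>T *\<^sub>v w i)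
          + (\<eta>/4) \<cdot>\<^sub>v vsum (n ^ k) {(i, j). 2 < i \<and> 2 < j \<and> i + j = k + 2}
              (\<lambda>(i, j). real (i * j) \<cdot>\<^sub>v vec_of_mat ((W i)\<^sup>T * B * B\<^sup>T * W j))
          - vsum (n ^ k) {(p, q). 1 \<le> p \<and> 1 \<le> q \<and> p + q = k}
              (\<lambda>(p, q). vec_of_mat ((H p)\<^sup>T * H q))
          + (\<eta>/4) \<cdot>\<^sub>v vsum (n ^ k) {1..2 * l} (\<lambda>e.
              vsum (n ^ k) {(p, q). p + q = e} (\<lambda>(p, q).
                vsum (n ^ k) {(i, j). 2 \<le> i \<and> 2 \<le> j \<and> i + j + e = k + 2} (\<lambda>(i, j).
                  real (i * j) \<cdot>\<^sub>v vec_of_mat (Gam n m G p q i j (W i) (W j))))))"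
proof (intro allI impI, elim conjE)
  fix k :: nat assume k: "3 \<le> k" "k \<le> d"
  have d: "2 \<le> d" and k1: "1 \<le> k" using k by auto
  have V2': "V 2 \<in> carrier_mat n n" "(V 2)\<^sup>T = V 2" and W2': "W 2 \<in> carrier_mat n n" "(W 2)\<^sup>T = W 2"
    using V2 W2 by (auto simp: sym_psd_def)
  have V2v: "v 2 = vec_of_mat (V 2)" and W2w: "w 2 = vec_of_mat (W 2)" using V[of 2] W[of 2] d by auto
  have H': "H p \<in> carrier_mat r (n ^ p)" if "1 \<le> p" for p
    using that C H1 H[of p] by (cases "p = 1") auto
  have Vk: "V i \<in> carrier_mat n (n ^ (i - 1))" and Wk: "W i \<in> carrier_mat n (n ^ (i - 1))"
    if "2 \<le> i" "i < k" for i
    using V[of i] W[of i] that k by auto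
  have fx: "f x \<in> carrier_vec n" and gx: "g x \<in> carrier_mat n m" for x
    unfolding f_def g_def by (intro drift_carrier F) (simp_all add: input_map_carrier)
  note coeff_V = coefficient_terms_carrier[OF F H' Vk]
  note coeff_W = coefficient_terms_carrier[OF F H' Wk]
  \<comment> \<open>The next facts turn the matrix Riccati equations into identities between real
    numbers, one for each vector \<open>a\<close>.\<close>
  have lincomb: "a \<bullet> ((X1 + X2 + X3 + X4) *\<^sub>v a) = a \<bullet> (X1 *\<^sub>v a) + a \<bullet> (X2 *\<^sub>v a) + a \<bullet> (X3 *\<^sub>v a) + a \<bullet> (X4 *\<^sub>v a)"
    if "X1 \<in> carrier_mat n n" "X2 \<in> carrier_mat n n" "X3 \<in> carrier_mat n n" "X4 \<in> carrier_mat n n"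
      "a \<in> carrier_vec n" for X1 X2 X3 X4 :: "real mat" and a
    using that by (simp add: scalar_prod_mult_mat_vec sum.distrib ring_distribs)
  have scale: "a \<bullet> ((c \<cdot>\<^sub>m X) *\<^sub>v a) = c * (a \<bullet> (X *\<^sub>v a))"
    if "X \<in> carrier_mat n n" "a \<in> carrier_vec n" for X :: "real mat" and c a
    using that by (simp add: scalar_prod_mult_mat_vec sum_distrib_left algebra_simps)
  have carriers: "A\<^sup>T * U \<in> carrier_mat n n" "U * A \<in> carrier_mat n n" "C\<^sup>T * C \<in> carrier_mat n n"
    "U * B * B\<^sup>T * U \<in> carrier_mat n n" "B * B\<^sup>T * U \<in> carrier_mat n n" if "U \<in> carrier_mat n n" for U
    using A B C that by auto
  \<comment> \<open>Writing subtraction as a negative multiple gives the past and the future case a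
    common shape, with the signs moved into \<open>p\<close> and \<open>q\<close>.\<close>
  have minus_smult: "X - c \<cdot>\<^sub>m Y = X + (- c) \<cdot>\<^sub>m Y"
    if "X \<in> carrier_mat n n" "Y \<in> carrier_mat n n" for X Y :: "real mat" and c
    using that by (intro eq_matI) auto
  have zero: "a \<bullet> (0\<^sub>m n n *\<^sub>v a) = 0" if "a \<in> carrier_vec n" for a :: "real vec"
    using that by (simp add: scalar_prod_mult_mat_vec)
  have are_V: "2 * ((A *\<^sub>v a) \<bullet> (V 2 *\<^sub>v a)) + (- \<eta>) * ((C *\<^sub>v a) \<bullet> (C *\<^sub>v a))
      + 1 * ((B\<^sup>T *\<^sub>v (V 2 *\<^sub>v a)) \<bullet> (B\<^sup>T *\<^sub>v (V 2 *\<^sub>v a))) = 0" if a: "a \<in> carrier_vec n" for a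
  proof -
    note VC = carriers[OF V2'(1)]
    have "0\<^sub>m n n = A\<^sup>T * V 2 + V 2 * A + (- \<eta>) \<cdot>\<^sub>m (C\<^sup>T * C) + V 2 * B * B\<^sup>T * V 2"
      unfolding past_are by (subst minus_smult) (use VC in auto)
    then have "0 = a \<bullet> ((A\<^sup>T * V 2 + V 2 * A + (- \<eta>) \<cdot>\<^sub>m (C\<^sup>T * C) + V 2 * B * B\<^sup>T * V 2) *\<^sub>v a)"
      using zero[OF a] by simp
    then show ?thesis
      using lincomb[OF VC(1,2) _ VC(4) a, of "(- \<eta>) \<cdot>\<^sub>m (C\<^sup>T * C)"] VC(3)
      by (simp add: scale[OF VC(3) a] riccati_quadratic[OF A B C V2' a])
  qed
  have are_W: "2 * ((A *\<^sub>v a) \<bullet> (W 2 *\<^sub>v a)) + 1 * ((C *\<^sub>v a) \<bullet> (C *\<^sub>v a))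
      + (- \<eta>) * ((B\<^sup>T *\<^sub>v (W 2 *\<^sub>v a)) \<bullet> (B\<^sup>T *\<^sub>v (W 2 *\<^sub>v a))) = 0" if a: "a \<in> carrier_vec n" for a
  proof -
    note WC = carriers[OF W2'(1)]
    have "0\<^sub>m n n = A\<^sup>T * W 2 + W 2 * A + C\<^sup>T * C + (- \<eta>) \<cdot>\<^sub>m (W 2 * B * B\<^sup>T * W 2)"
      unfolding future_are by (rule minus_smult) (use WC in auto)
    then have "0 = a \<bullet> ((A\<^sup>T * W 2 + W 2 * A + C\<^sup>T * C + (- \<eta>) \<cdot>\<^sub>m (W 2 * B * B\<^sup>T * W 2)) *\<^sub>v a)"
      using zero[OF a] by simp
    then show ?thesis
      using lincomb[OF WC(1,2,3) _ a, of "(- \<eta>) \<cdot>\<^sub>m (W 2 * B * B\<^sup>T * W 2)"] WC(4)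
      by (simp add: scale[OF WC(4) a] riccati_quadratic[OF A B C W2' a])
  qed
  have stab_V: "asymptotically_stable n (\<lambda>x. - f x - g x *\<^sub>v ((g x)\<^sup>T *\<^sub>v grad n Epast x))"
    using past by (simp add: past_energy_function_def)
  have stab_W: "asymptotically_stable n (\<lambda>x. f x - \<eta> \<cdot>\<^sub>v (g x *\<^sub>v ((g x)\<^sup>T *\<^sub>v grad n Efuture x)))"
    using future by (simp add: future_energy_function_def)
  have unique_V: "\<exists>!z. z \<in> carrier_vec (n ^ k) \<and> (lyap k (A + 1 \<cdot>\<^sub>m (B * B\<^sup>T * V 2)))\<^sup>T *\<^sub>v z = b"
    if "b \<in> carrier_vec (n ^ k)" for b
  proof (rule closed_loop_lyap_unique_solution[OF A B C F G f_def g_def V2' are_V _ gamma_level gamma_pos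
      gamma_ne1 eta past_expansion d V2v stab_V, of "-1", OF _ _ _ _ _ _ k1 that])
    fix x :: "real vec" and i assume "x \<in> carrier_vec n" "i < n"
    then show "(- f x - g x *\<^sub>v ((g x)\<^sup>T *\<^sub>v grad n Epast x)) $ i
        = - 1 * f x $ i + - 1 * 1 * (g x *\<^sub>v ((g x)\<^sup>T *\<^sub>v grad n Epast x)) $ i"
      using fx[of x] gx[of x] by simp
  qed simp_all
  have unique_W: "\<exists>!z. z \<in> carrier_vec (n ^ k) \<and> (lyap k (A + (- \<eta>) \<cdot>\<^sub>m (B * B\<^sup>T * W 2)))\<^sup>T *\<^sub>v z = b"
    if "b \<in> carrier_vec (n ^ k)" for b
  proof (rule closed_loop_lyap_unique_solution[OF A B C F G f_def g_def W2' are_W _ gamma_level gamma_pos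
      gamma_ne1 eta future_expansion d W2w stab_W, of 1, OF _ _ _ _ _ _ k1 that])
    fix x :: "real vec" and i assume "x \<in> carrier_vec n" "i < n"
    then show "(f x - \<eta> \<cdot>\<^sub>v (g x *\<^sub>v ((g x)\<^sup>T *\<^sub>v grad n Efuture x))) $ i
        = 1 * f x $ i + 1 * (- \<eta>) * (g x *\<^sub>v ((g x)\<^sup>T *\<^sub>v grad n Efuture x)) $ i"
      using fx[of x] gx[of x] by simp
  qed simp_all
  have MV: "A + B * B\<^sup>T * V 2 = A + 1 \<cdot>\<^sub>m (B * B\<^sup>T * V 2)"
    by (intro eq_matI) auto
  have MW: "A - \<eta> \<cdot>\<^sub>m (B * B\<^sup>T * W 2) = A + (- \<eta>) \<cdot>\<^sub>m (B * B\<^sup>T * W 2)"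
    by (rule minus_smult[OF A carriers(5)[OF W2'(1)]])
  show "(\<exists>!z. z \<in> carrier_vec (n ^ k) \<and>
        (lyap k (A + B * B\<^sup>T * V 2))\<^sup>T *\<^sub>v z =
          - vsum (n ^ k) {(i, p). 2 \<le> i \<and> 2 \<le> p \<and> i + p = k + 1}
              (\<lambda>(i, p). (lyap i (F p))\<^sup>T *\<^sub>v v i)
          - (1/4) \<cdot>\<^sub>v vsum (n ^ k) {(i, j). 2 < i \<and> 2 < j \<and> i + j = k + 2}
              (\<lambda>(i, j). real (i * j) \<cdot>\<^sub>v vec_of_mat ((V i)\<^sup>T * B * B\<^sup>T * V j))
          + \<eta> \<cdot>\<^sub>v vsum (n ^ k) {(p, q). 1 \<le> p \<and> 1 \<le> q \<and> p + q = k}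
              (\<lambda>(p, q). vec_of_mat ((H p)\<^sup>T * H q))
          - (1/4) \<cdot>\<^sub>v vsum (n ^ k) {1..2 * l} (\<lambda>e.
              vsum (n ^ k) {(p, q). p + q = e} (\<lambda>(p, q).
                vsum (n ^ k) {(i, j). 2 \<le> i \<and> 2 \<le> j \<and> i + j + e = k + 2} (\<lambda>(i, j).
                  real (i * j) \<cdot>\<^sub>v vec_of_mat (Gam n m G p q i j (V i) (V j))))))
    \<and> (\<exists>!z. z \<in> carrier_vec (n ^ k) \<and>
        (lyap k (A - \<eta> \<cdot>\<^sub>m (B * B\<^sup>T * W 2)))\<^sup>T *\<^sub>v z =
          - vsum (n ^ k) {(i, p). 2 \<le> i \<and> 2 \<le> p \<and> i + p = k + 1}
              (\<lambda>(i, p). (lyap i (F p))\<^sup>T *\<^sub>v w i)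
          + (\<eta>/4) \<cdot>\<^sub>v vsum (n ^ k) {(i, j). 2 < i \<and> 2 < j \<and> i + j = k + 2}
              (\<lambda>(i, j). real (i * j) \<cdot>\<^sub>v vec_of_mat ((W i)\<^sup>T * B * B\<^sup>T * W j))
          - vsum (n ^ k) {(p, q). 1 \<le> p \<and> 1 \<le> q \<and> p + q = k}
              (\<lambda>(p, q). vec_of_mat ((H p)\<^sup>T * H q))
          + (\<eta>/4) \<cdot>\<^sub>v vsum (n ^ k) {1..2 * l} (\<lambda>e.
              vsum (n ^ k) {(p, q). p + q = e} (\<lambda>(p, q).
                vsum (n ^ k) {(i, j). 2 \<le> i \<and> 2 \<le> j \<and> i + j + e = k + 2} (\<lambda>(i, j).
                  real (i * j) \<cdot>\<^sub>v vec_of_mat (Gam n m G p q i j (W i) (W j))))))"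
    unfolding MV MW
    by (intro conjI unique_V unique_W add_carrier_vec minus_carrier_vec uminus_carrier_vec[THEN iffD2]
        smult_carrier_vec[THEN iffD2] coeff_V coeff_W)
qed

end
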